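(* Let $I=[0,1]$ and let $T:I\to I$ be the map $$T(x)=2x+\tfrac12 x(1-x)\pmod 1 .$$ Then: (a) $T$ admits a unique absolutely continuous invariant probability measure $\nu$, and if $\psi:I\to\mathbb R$ is a function of bounded variation, the Central Limit Theorem holds: $$\frac{1}{\sqrt n}\left(\sum_{i=0}^{n-1}\psi(T^i x)-n\int_I\psi\,d\nu\right)\ \overset{\text{law}}{\longrightarrow}\ \mathcal N(0,\sigma^2).$$ (b) For $\psi(x)=x^2$ the diffusion coefficient satisfies $\sigma^2\in[0.3458,\,0.4152]$.
   Context: Absolute continuity is with respect to Lebesgue measure on $I=[0,1]$. The convergence in law is for $x$ distributed according to $\nu$. For $\psi$ of bounded variation, the diffusion coefficient (variance) $\sigma^2$ is $$\sigma^2:=\lim_{n\to\infty}\frac1n\int_I\left(\sum_{i=0}^{n-1}\psi(T^i x)-n\int_I\psi\,d\nu\right)^2d\nu(x)$$ (the limit exists for this map). When $\sigma^2=0$, $\mathcal N(0,0)$ denotes the point mass at $0$. *)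

theory Defs
  imports "HOL-Probability.Probability"
begin

definition T :: "real \<Rightarrow> real" where
  "T x = frac (2 * x + 1/2 * x * (1 - x))"

(* The measure lives on the Borel sigma-algebra of [0,1]; fixing the underlying space and
   sigma-algebra makes equality of such measures, and hence "unique", literal. *)
definition acip :: "(real \<Rightarrow> real) \<Rightarrow> real measure \<Rightarrow> bool" where
  "acip S \<nu> \<longleftrightarrow>
     sets \<nu> = sets (restrict_space borel {0..1}) \<and>
     prob_space \<nu> \<and>
     absolutely_continuous (restrict_space lborel {0..1}) \<nu> \<and>
     S \<in> measurable \<nu> \<nu> \<and> distr \<nu> \<nu> S = \<nu>"

definition bounded_variation_on :: "real \<Rightarrow> real \<Rightarrow> (real \<Rightarrow> real) \<Rightarrow> bool" where
  "bounded_variation_on a b f \<longleftrightarrow>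
     (\<exists>B. \<forall>(n::nat) (x::nat \<Rightarrow> real). x 0 = a \<and> x n = b \<and> (\<forall>i<n. x i < x (Suc i)) \<longrightarrow>
        (\<Sum>i<n. \<bar>f (x (Suc i)) - f (x i)\<bar>) \<le> B)"

definition centred_birkhoff_sum ::
  "(real \<Rightarrow> real) \<Rightarrow> real measure \<Rightarrow> (real \<Rightarrow> real) \<Rightarrow> nat \<Rightarrow> real \<Rightarrow> real" where
  "centred_birkhoff_sum S \<nu> \<psi> n x =
     (\<Sum>i<n. \<psi> ((S ^^ i) x)) - real n * (\<integral>y. \<psi> y \<partial>\<nu>)"

definition scaled_variance ::
  "(real \<Rightarrow> real) \<Rightarrow> real measure \<Rightarrow> (real \<Rightarrow> real) \<Rightarrow> nat \<Rightarrow> real" where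
  "scaled_variance S \<nu> \<psi> n =
     1 / real n * (\<integral>x. (centred_birkhoff_sum S \<nu> \<psi> n x)\<^sup>2 \<partial>\<nu>)"

(* lim is meaningful only for convergent sequences, so convergence has to be
   asserted separately. *)
definition diffusion_coeff ::
  "(real \<Rightarrow> real) \<Rightarrow> real measure \<Rightarrow> (real \<Rightarrow> real) \<Rightarrow> real" where
  "diffusion_coeff S \<nu> \<psi> = lim (scaled_variance S \<nu> \<psi>)"

(* N(0, v), parametrised by the variance v, whereas normal_density takes the standard
   deviation. The degenerate case is needed because normal_density 0 0 is identically 0. *)
definition centred_normal :: "real \<Rightarrow> real measure" where
  "centred_normal v =
     (if v = 0 then return borel 0 else density lborel (normal_density 0 (sqrt v)))"

end

theory Submission
  imports Defs "HOL-Computational_Algebra.Polynomial"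
begin

text \<open>
  Let \<open>F x = (5x - x\<^sup>2)/2\<close>, so that \<open>T\<close> is \<open>F\<close> modulo 1. Since \<open>F\<close> increases from
  \<open>0\<close> to \<open>2\<close> on \<open>[0,1]\<close> with slope between \<open>3/2\<close> and \<open>5/2\<close>, the map has two full expanding
  branches. Since \<open>F\<close> is concave, the derivatives of the inverse branches are increasing. The
  transfer operator \<open>L\<close> therefore preserves the cone of nonnegative increasing functions, and on
  this cone the variation \<open>f 1 - f 0\<close> obeys the exact identity
  \<open>L f 1 - L f 0 = 2/3 * f 1 - 2/5 * f 0\<close> (\<open>transfer_oscillation\<close>).

  This identity yields a spectral gap without functional analysis. An increasing density whose variation
  is at most \<open>14/15\<close> of its mass is bounded below by \<open>1/15\<close> of its mass. Removing this constant
  part and applying \<open>L\<close> leads back to such a density (\<open>balanced_reduced_transfer\<close>). For two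
  densities of equal mass the removed parts agree, so the difference of the iterates decays like
  \<open>(14/15)\<^sup>n\<close>. Functions of bounded variation are differences of increasing functions, so that for
  every such function \<open>h\<close> of mean zero the series of the \<open>L\<^sup>k h\<close> converges to a function of
  bounded variation that solves the Poisson equation (\<open>transfer_iterate_sums\<close>,
  \<open>poisson_equation\<close>). The invariant density \<open>\<rho>\<close> is obtained in this way, and decay of
  correlations, extended by density to \<open>L\<^sup>1\<close>, makes every absolutely continuous invariant
  probability measure equal to \<open>\<rho> dx\<close> (\<open>acip_unique\<close>).

  For an observable \<open>\<psi>\<close> of bounded variation let \<open>c\<close> be its centred version and let \<open>a\<close> solve
  \<open>a - L a = L (c \<rho>)\<close>. Correlations then telescope, and \<open>1/n\<close> times the second moment of the
  Birkhoff sum converges to the Green--Kubo value \<open>\<sigma>\<^sup>2\<close> (\<open>second_moment_asymp\<close>). For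
  the central limit theorem a second Poisson equation supplies a function \<open>b\<close> such that
  \<open>\<rho> + ita + t\<^sup>2b\<close> is an eigenfunction of \<open>f \<mapsto> L (exp(itc) f)\<close> with eigenvalue
  \<open>1 - \<sigma>\<^sup>2t\<^sup>2/2\<close>, up to an error of order \<open>t\<^sup>3\<close>. Taking \<open>t = s / sqrt n\<close> and iterating
  \<open>n\<close> times gives convergence of the characteristic functions to \<open>exp(-\<sigma>\<^sup>2s\<^sup>2/2)\<close>
  (\<open>paired_inv_density_tendsto\<close>).

  For \<open>\<psi> x = x\<^sup>2\<close> the enclosure comes from explicit approximations of \<open>\<rho>\<close> and of the
  solution of the Poisson equation. Functions of the form \<open>(K \<circ> (F - 1))'\<close> with a polynomial \<open>K\<close>
  are polynomials, and so are their images \<open>(K x + K (x - 1))'\<close> under \<open>L\<close>. Hence the residuals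
  are polynomials with rational coefficients, and their Lipschitz constants can be bounded by exact
  arithmetic. On functions of mean zero \<open>L\<close> contracts Lipschitz constants by \<open>887/1000\<close>
  (\<open>lip_transfer\<close>), which turns bounds on residuals into a bound on the error of \<open>\<sigma>\<^sup>2\<close>
  (\<open>diffusion_coeff_square_approx\<close>). The true value is close to \<open>0.3601\<close>, and the upper end
  of the interval is far from being attained; the accuracy is needed for the lower end.
\<close>

section \<open>Inverse branches and the transfer operator\<close>

text \<open>The inverse of \<open>lift_map\<close> on \<open>[0,2]\<close>. It encodes both inverse branches of \<open>T\<close>, as
  \<open>x \<mapsto> inv_branch x\<close> and \<open>x \<mapsto> inv_branch (x + 1)\<close> on \<open>[0,1]\<close>; these share the
  endpoint \<open>inv_branch 1\<close>, which is the discontinuity of \<open>T\<close>.\<close>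
definition inv_branch :: "real \<Rightarrow> real" where
  "inv_branch y = (5 - sqrt (25 - 8 * y)) / 2"

definition inv_branch_deriv :: "real \<Rightarrow> real" where
  "inv_branch_deriv y = 2 / sqrt (25 - 8 * y)"

definition lift_map :: "real \<Rightarrow> real" where
  "lift_map x = (5 * x - x\<^sup>2) / 2"

lemma T_eq_frac_lift_map: "T x = frac (lift_map x)"
  by (simp add: T_def lift_map_def field_simps power2_eq_square)

lemma lift_map_inv_branch: "y \<le> 25/8 \<Longrightarrow> lift_map (inv_branch y) = y"
  by (simp add: lift_map_def inv_branch_def field_simps power2_eq_square)

lemma inv_branch_mono: "x \<le> y \<Longrightarrow> inv_branch x \<le> inv_branch y"
  by (simp add: inv_branch_def)

lemma inv_branch_0 [simp]: "inv_branch 0 = 0"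
proof -
  have "sqrt 25 = (5::real)" by (rule real_sqrt_unique) auto
  then show ?thesis by (simp add: inv_branch_def)
qed

lemma inv_branch_2 [simp]: "inv_branch 2 = 1"
proof -
  have "sqrt 9 = (3::real)" by (rule real_sqrt_unique) auto
  then show ?thesis by (simp add: inv_branch_def)
qed

lemma inv_branch_bounds: "0 \<le> y \<Longrightarrow> y \<le> 2 \<Longrightarrow> 0 \<le> inv_branch y \<and> inv_branch y \<le> 1"
  using inv_branch_mono[of 0 y] inv_branch_mono[of y 2] by simp

lemma inv_branch_in_unit [simp]:
  "x \<in> {0..1} \<Longrightarrow> inv_branch x \<in> {0..1}" "x \<in> {0..1} \<Longrightarrow> inv_branch (x + 1) \<in> {0..1}"
  using inv_branch_bounds[of x] inv_branch_bounds[of "x+1"] by auto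

lemma inv_branch_deriv_0 [simp]: "inv_branch_deriv 0 = 2/5"
proof -
  have "sqrt 25 = (5::real)" by (rule real_sqrt_unique) auto
  then show ?thesis by (simp add: inv_branch_deriv_def)
qed

lemma inv_branch_deriv_2 [simp]: "inv_branch_deriv 2 = 2/3"
proof -
  have "sqrt 9 = (3::real)" by (rule real_sqrt_unique) auto
  then show ?thesis by (simp add: inv_branch_deriv_def)
qed

text \<open>The derivative of the inverse in terms of the point reached: it is the reciprocal of the slope
  \<open>5/2 - z\<close> of \<open>lift_map\<close> at \<open>z = inv_branch y\<close>. This keeps square roots out of
  most later computations.\<close>
lemma inv_branch_deriv_eq: "y < 25/8 \<Longrightarrow> inv_branch_deriv y = 1 / (5/2 - inv_branch y)"
  by (simp add: inv_branch_deriv_def inv_branch_def field_simps)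

lemma inv_branch_deriv_pos: "y < 25/8 \<Longrightarrow> 0 < inv_branch_deriv y"
  by (simp add: inv_branch_deriv_def)

lemma inv_branch_deriv_mono: "x \<le> y \<Longrightarrow> y < 25/8 \<Longrightarrow> inv_branch_deriv x \<le> inv_branch_deriv y"
  by (auto simp: inv_branch_deriv_def intro!: divide_left_mono mult_pos_pos)

lemma inv_branch_deriv_nonneg [simp]:
  "x \<in> {0..1} \<Longrightarrow> 0 \<le> inv_branch_deriv x" "x \<in> {0..1} \<Longrightarrow> 0 \<le> inv_branch_deriv (x + 1)"
  using inv_branch_deriv_pos[of x] inv_branch_deriv_pos[of "x+1"] by auto

lemma has_derivative_inv_branch:
  "y < 25/8 \<Longrightarrow> (inv_branch has_real_derivative inv_branch_deriv y) (at y)"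
  unfolding inv_branch_def [abs_def] inv_branch_deriv_def
  by (auto intro!: derivative_eq_intros simp: field_simps)

lemma continuous_on_inv_branch_deriv: "continuous_on {..<25/8} inv_branch_deriv"
  unfolding inv_branch_deriv_def [abs_def] by (intro continuous_intros) auto

lemma T_in_unit: "T x \<in> {0..1}"
  by (simp add: T_def frac_lt_1 less_imp_le)

lemma T_inv_branch:
  assumes "x \<in> {0..<1}"
  shows "T (inv_branch x) = x" "T (inv_branch (x + 1)) = x"
proof -
  show "T (inv_branch x) = x"
    using assms lift_map_inv_branch[of x] by (simp add: T_eq_frac_lift_map frac_eq)
  have "frac (x + 1) = x" using assms by (simp add: frac_1_eq frac_eq)
  then show "T (inv_branch (x + 1)) = x"
    using assms lift_map_inv_branch[of "x + 1"] by (simp add: T_eq_frac_lift_map)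
qed

text \<open>The Perron--Frobenius operator for Lebesgue measure: the density at \<open>x\<close> of the image under
  \<open>T\<close> of a density \<open>f\<close>. Only the values of \<open>f\<close> on \<open>[0,1]\<close> enter at points of
  \<open>[0,1]\<close>.\<close>
definition transfer :: "(real \<Rightarrow> real) \<Rightarrow> real \<Rightarrow> real" where
  "transfer f x = inv_branch_deriv x * f (inv_branch x)
     + inv_branch_deriv (x + 1) * f (inv_branch (x + 1))"

abbreviation unit_leb :: "real measure" where
  "unit_leb \<equiv> restrict_space lborel {0..1}"

interpretation unit_leb: prob_space unit_leb
  by (rule prob_spaceI) (simp add: space_restrict_space emeasure_restrict_space)

lemma space_unit_leb [simp]: "space unit_leb = {0..1}"
  by (simp add: space_restrict_space)

lemma borel_measurable_inv_branch [measurable]: "inv_branch \<in> borel_measurable borel"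
  unfolding inv_branch_def [abs_def] by measurable

lemma borel_measurable_inv_branch_deriv [measurable]: "inv_branch_deriv \<in> borel_measurable borel"
  unfolding inv_branch_deriv_def [abs_def] by measurable

lemma borel_measurable_T [measurable]: "T \<in> borel_measurable borel"
  unfolding T_def [abs_def] frac_def by measurable

lemma measurable_T_unit: "T \<in> measurable unit_leb unit_leb"
  by (rule measurable_restrict_space3) (use T_in_unit in auto)

lemma measurable_unit_inv_branch:
  "inv_branch \<in> measurable unit_leb unit_leb"
  "(\<lambda>x. inv_branch (x + 1)) \<in> measurable unit_leb unit_leb"
  by (rule measurable_restrict_space3; use inv_branch_in_unit in auto)+

lemma measurable_transfer:
  assumes [measurable]: "f \<in> borel_measurable unit_leb"
  shows "transfer f \<in> borel_measurable unit_leb"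
proof -
  note measurable_unit_inv_branch [measurable]
  have [measurable]: "inv_branch_deriv \<in> borel_measurable unit_leb"
    "(\<lambda>x. inv_branch_deriv (x + 1)) \<in> borel_measurable unit_leb"
    by (rule measurable_restrict_space1; measurable)+
  show ?thesis unfolding transfer_def [abs_def] by measurable
qed

text \<open>The shift \<open>s\<close> selects the branch, so that one change of variables serves both.\<close>
lemma nn_integral_substitution_inv_branch:
  fixes u :: "real \<Rightarrow> ennreal"
  assumes [measurable]: "u \<in> borel_measurable borel" and "0 \<le> s" "s \<le> 1"
  shows "(\<integral>\<^sup>+z. u z * indicator {inv_branch s..inv_branch (s + 1)} z \<partial>lborel)
    = (\<integral>\<^sup>+x. u (inv_branch (x + s)) * ennreal (inv_branch_deriv (x + s)) * indicator {0..1} x \<partial>lborel)"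
proof -
  have "(\<integral>\<^sup>+z. u z * indicator {inv_branch (0 + s)..inv_branch (1 + s)} z \<partial>lborel)
    = (\<integral>\<^sup>+x. u (inv_branch (x + s)) * ennreal (inv_branch_deriv (x + s)) * indicator {0..1} x \<partial>lborel)"
  proof (rule nn_integral_substitution_aux[where g = "\<lambda>x. inv_branch (x + s)" and g' = "\<lambda>x. inv_branch_deriv (x + s)"])
    show "((\<lambda>x. inv_branch (x + s)) has_real_derivative inv_branch_deriv (x + s)) (at x)"
      if "x \<in> {0..1}" for x
      using DERIV_shift[of inv_branch "inv_branch_deriv (x + s)" x s] has_derivative_inv_branch[of "x + s"] that assms
      by simp
    show "continuous_on {0..1} (\<lambda>x. inv_branch_deriv (x + s))"
      by (rule continuous_on_compose2[OF continuous_on_inv_branch_deriv])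
         (use assms in \<open>auto intro!: continuous_intros\<close>)
    show "0 \<le> inv_branch_deriv (x + s)" if "x \<in> {0..1}" for x
      using inv_branch_deriv_pos[of "x + s"] that assms by simp
  qed auto
  then show ?thesis by (simp add: add.commute)
qed

text \<open>The defining duality of the transfer operator. Split the integral at the discontinuity of
  \<open>T\<close> and substitute an inverse branch on either side. The discontinuity itself and the point
  \<open>1\<close>, where \<open>frac\<close> jumps, are null sets.\<close>
lemma nn_integral_T_transfer:
  fixes \<phi> :: "real \<Rightarrow> ennreal"
  assumes f: "f \<in> borel_measurable unit_leb" "\<And>x. x \<in> {0..1} \<Longrightarrow> 0 \<le> f x"
    and \<phi>: "\<phi> \<in> borel_measurable unit_leb"
  shows "(\<integral>\<^sup>+x. ennreal (f x) * \<phi> (T x) \<partial>unit_leb) = (\<integral>\<^sup>+x. ennreal (transfer f x) * \<phi> x \<partial>unit_leb)"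
proof -
  define u where "u x = ennreal (f x) * \<phi> (T x) * indicator {0..1} x" for x
  note f(1)[measurable] \<phi>[measurable] measurable_T_unit[measurable]
  have "(\<lambda>x. ennreal (f x) * \<phi> (T x)) \<in> borel_measurable unit_leb"
    by measurable
  then have [measurable]: "u \<in> borel_measurable borel"
    unfolding u_def [abs_def] by (subst (asm) borel_measurable_restrict_space_iff_ennreal) auto
  have c: "0 \<le> inv_branch 1" "inv_branch 1 \<le> 1" using inv_branch_bounds[of 1] by auto
  have "(\<integral>\<^sup>+x. ennreal (f x) * \<phi> (T x) \<partial>unit_leb) = (\<integral>\<^sup>+z. u z \<partial>lborel)"
    unfolding u_def by (rule nn_integral_restrict_space) simp
  also have "\<dots> = (\<integral>\<^sup>+z. u z * indicator {inv_branch 0..inv_branch (0 + 1)} z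
      + u z * indicator {inv_branch 1..inv_branch (1 + 1)} z \<partial>lborel)"
    using c by (intro nn_integral_cong_AE, use AE_lborel_singleton[of "inv_branch 1"] in eventually_elim)
       (auto simp: u_def split: split_indicator)
  also have "\<dots> = (\<integral>\<^sup>+z. u z * indicator {inv_branch 0..inv_branch (0 + 1)} z \<partial>lborel)
      + (\<integral>\<^sup>+z. u z * indicator {inv_branch 1..inv_branch (1 + 1)} z \<partial>lborel)"
    by (rule nn_integral_add) auto
  also have "\<dots> = (\<integral>\<^sup>+x. u (inv_branch (x + 0)) * ennreal (inv_branch_deriv (x + 0)) * indicator {0..1} x \<partial>lborel)
      + (\<integral>\<^sup>+x. u (inv_branch (x + 1)) * ennreal (inv_branch_deriv (x + 1)) * indicator {0..1} x \<partial>lborel)"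
    by (subst (1 2) nn_integral_substitution_inv_branch) auto
  also have "\<dots> = (\<integral>\<^sup>+x. u (inv_branch (x + 0)) * ennreal (inv_branch_deriv (x + 0)) * indicator {0..1} x
      + u (inv_branch (x + 1)) * ennreal (inv_branch_deriv (x + 1)) * indicator {0..1} x \<partial>lborel)"
    by (rule nn_integral_add[symmetric]) auto
  also have "\<dots> = (\<integral>\<^sup>+x. ennreal (transfer f x) * \<phi> x * indicator {0..1} x \<partial>lborel)"
  proof (intro nn_integral_cong_AE, use AE_lborel_singleton[of 1] in eventually_elim)
    fix x :: real assume "x \<noteq> 1"
    then show "u (inv_branch (x + 0)) * ennreal (inv_branch_deriv (x + 0)) * indicator {0..1} x
      + u (inv_branch (x + 1)) * ennreal (inv_branch_deriv (x + 1)) * indicator {0..1} x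
      = ennreal (transfer f x) * \<phi> x * indicator {0..1} x"
    proof (cases "x \<in> {0..1}")
      case True
      with \<open>x \<noteq> 1\<close> have T: "T (inv_branch x) = x" "T (inv_branch (x + 1)) = x"
        using T_inv_branch[of x] by auto
      have "ennreal (transfer f x) = ennreal (inv_branch_deriv x) * ennreal (f (inv_branch x))
        + ennreal (inv_branch_deriv (x + 1)) * ennreal (f (inv_branch (x + 1)))"
        unfolding transfer_def using True f(2)[OF inv_branch_in_unit(1)] f(2)[OF inv_branch_in_unit(2)]
        by (subst ennreal_plus, simp_all del: atLeastAtMost_iff) (subst (1 2) ennreal_mult, simp_all del: atLeastAtMost_iff)
      moreover have "u (inv_branch x) = ennreal (f (inv_branch x)) * \<phi> x"
        "u (inv_branch (x + 1)) = ennreal (f (inv_branch (x + 1))) * \<phi> x"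
        unfolding u_def T using True by (simp_all del: atLeastAtMost_iff)
      ultimately show ?thesis using True
        by (simp add: distrib_right distrib_left mult_ac del: atLeastAtMost_iff)
    qed auto
  qed
  also have "\<dots> = (\<integral>\<^sup>+x. ennreal (transfer f x) * \<phi> x \<partial>unit_leb)"
    by (subst nn_integral_restrict_space) auto
  finally show ?thesis .
qed

lemma transfer_nonneg:
  assumes "\<And>x. x \<in> {0..1} \<Longrightarrow> 0 \<le> f x" and "x \<in> {0..1}"
  shows "0 \<le> transfer f x"
  unfolding transfer_def using assms(2)
  by (intro add_nonneg_nonneg mult_nonneg_nonneg inv_branch_deriv_nonneg assms(1) inv_branch_in_unit)

lemma distr_density_T:
  assumes f: "f \<in> borel_measurable unit_leb" "\<And>x. x \<in> {0..1} \<Longrightarrow> 0 \<le> f x"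
  shows "distr (density unit_leb f) unit_leb T = density unit_leb (transfer f)"
proof (rule measure_eqI)
  show "sets (distr (density unit_leb f) unit_leb T) = sets (density unit_leb (transfer f))" by simp
  fix A assume "A \<in> sets (distr (density unit_leb f) unit_leb T)"
  then have A [measurable]: "A \<in> sets unit_leb" by simp
  note f(1)[measurable] measurable_T_unit[measurable] measurable_transfer[OF f(1), measurable]
  have "emeasure (distr (density unit_leb f) unit_leb T) A
    = (\<integral>\<^sup>+x. ennreal (f x) * indicator A (T x) \<partial>unit_leb)"
    using measurable_sets[OF measurable_T_unit A]
    by (auto simp: emeasure_distr emeasure_density intro!: nn_integral_cong split: split_indicator)
  also have "\<dots> = emeasure (density unit_leb (transfer f)) A"
    using nn_integral_T_transfer[of f "indicator A"] f by (simp add: emeasure_density)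
  finally show "emeasure (distr (density unit_leb f) unit_leb T) A = emeasure (density unit_leb (transfer f)) A" .
qed

lemma integral_T_transfer_nonneg:
  fixes \<phi> :: "real \<Rightarrow> 'a::{banach, second_countable_topology}"
  assumes f: "f \<in> borel_measurable unit_leb" "\<And>x. x \<in> {0..1} \<Longrightarrow> 0 \<le> f x"
    and [measurable]: "\<phi> \<in> borel_measurable unit_leb"
  shows "(\<integral>x. f x *\<^sub>R \<phi> (T x) \<partial>unit_leb) = (\<integral>x. transfer f x *\<^sub>R \<phi> x \<partial>unit_leb)"
proof -
  note f(1)[measurable] measurable_T_unit[measurable] measurable_transfer[OF f(1), measurable]
  have "(\<integral>x. f x *\<^sub>R \<phi> (T x) \<partial>unit_leb) = (\<integral>x. \<phi> (T x) \<partial>density unit_leb f)"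
    using f(2) by (subst integral_density) auto
  also have "\<dots> = (\<integral>x. \<phi> x \<partial>distr (density unit_leb f) unit_leb T)"
    by (subst integral_distr) auto
  also have "\<dots> = (\<integral>x. transfer f x *\<^sub>R \<phi> x \<partial>unit_leb)"
    using transfer_nonneg[of f] f by (subst distr_density_T, blast, blast, subst integral_density) auto
  finally show ?thesis .
qed

section \<open>Contraction on increasing densities\<close>

lemma transfer_cong:
  assumes "\<And>x. x \<in> {0..1} \<Longrightarrow> f x = g x" and "x \<in> {0..1}"
  shows "transfer f x = transfer g x"
  unfolding transfer_def
  using assms(1)[OF inv_branch_in_unit(1)[OF assms(2)]] assms(1)[OF inv_branch_in_unit(2)[OF assms(2)]]
  by simp

lemma transfer_iterate_cong:
  assumes "\<And>x. x \<in> {0..1} \<Longrightarrow> f x = g x" and "x \<in> {0..1}"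
  shows "(transfer ^^ n) f x = (transfer ^^ n) g x"
  using assms(2)
proof (induction n arbitrary: x)
  case 0
  then show ?case using assms(1) by simp
next
  case (Suc n)
  show ?case unfolding funpow.simps o_apply by (rule transfer_cong) (use Suc in auto)
qed

lemma transfer_add: "transfer (\<lambda>x. f x + g x) = (\<lambda>x. transfer f x + transfer g x)"
  and transfer_diff: "transfer (\<lambda>x. f x - g x) = (\<lambda>x. transfer f x - transfer g x)"
  and transfer_cmult: "transfer (\<lambda>x. c * f x) = (\<lambda>x. c * transfer f x)"
  by (auto simp: transfer_def fun_eq_iff algebra_simps)

lemma transfer_iterate_diff:
  "(transfer ^^ n) (\<lambda>x. f x - g x) = (\<lambda>x. (transfer ^^ n) f x - (transfer ^^ n) g x)"
  by (induction n) (simp_all add: transfer_diff)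

lemma transfer_iterate_cmult: "(transfer ^^ n) (\<lambda>x. c * f x) = (\<lambda>x. c * (transfer ^^ n) f x)"
  by (induction n) (simp_all add: transfer_cmult)

text \<open>The cone on which the transfer operator is studied. It is preserved because the inverse branches
  and their derivatives are nonnegative and increasing; the latter reflects the concavity of
  \<open>lift_map\<close>.\<close>
definition incr_nonneg :: "(real \<Rightarrow> real) \<Rightarrow> bool" where
  "incr_nonneg f \<longleftrightarrow> mono_on {0..1} f \<and> 0 \<le> f 0"

abbreviation unit_mean :: "(real \<Rightarrow> real) \<Rightarrow> real" where
  "unit_mean f \<equiv> (\<integral>x. f x \<partial>unit_leb)"

lemma incr_nonnegI:
  assumes "\<And>x y. 0 \<le> x \<Longrightarrow> x \<le> y \<Longrightarrow> y \<le> 1 \<Longrightarrow> f x \<le> f y" "0 \<le> f 0"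
  shows "incr_nonneg f"
  using assms by (auto simp: incr_nonneg_def mono_on_def)

lemma incr_nonneg_mono: "incr_nonneg f \<Longrightarrow> 0 \<le> x \<Longrightarrow> x \<le> y \<Longrightarrow> y \<le> 1 \<Longrightarrow> f x \<le> f y"
  by (auto simp: incr_nonneg_def mono_on_def)

lemma incr_nonneg_bounds:
  assumes "incr_nonneg f" "x \<in> {0..1}"
  shows "f 0 \<le> f x" "f x \<le> f 1" "0 \<le> f x"
  using assms incr_nonneg_mono[of f 0 x] incr_nonneg_mono[of f x 1] by (auto simp: incr_nonneg_def)

lemma sets_unit_leb: "sets unit_leb = sets (restrict_space borel {0..1})"
  by (rule sets_restrict_space_cong) simp

lemma incr_nonneg_measurable: "incr_nonneg f \<Longrightarrow> f \<in> borel_measurable unit_leb"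
  using borel_measurable_mono_on_fnc[of "{0..1}" f] measurable_cong_sets[OF sets_unit_leb refl]
  by (auto simp: incr_nonneg_def)

lemma bounded_measurable_integrable:
  fixes f :: "real \<Rightarrow> 'a::{banach, second_countable_topology}"
  assumes "f \<in> borel_measurable unit_leb" "\<And>x. x \<in> {0..1} \<Longrightarrow> norm (f x) \<le> B"
  shows "integrable unit_leb f"
  by (rule unit_leb.integrable_const_bound[of _ B]) (use assms in auto)

lemma incr_nonneg_integrable: "incr_nonneg f \<Longrightarrow> integrable unit_leb f"
  by (rule bounded_measurable_integrable[of _ "f 1"])
     (auto simp: incr_nonneg_measurable incr_nonneg_bounds)

lemma incr_nonneg_const: "0 \<le> c \<Longrightarrow> incr_nonneg (\<lambda>_. c)"
  by (rule incr_nonnegI) auto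

lemma incr_nonneg_add: "incr_nonneg f \<Longrightarrow> incr_nonneg g \<Longrightarrow> incr_nonneg (\<lambda>x. f x + g x)"
  unfolding incr_nonneg_def by (auto intro: mono_onI add_mono dest: mono_onD)

lemma incr_nonneg_mult: "incr_nonneg f \<Longrightarrow> incr_nonneg g \<Longrightarrow> incr_nonneg (\<lambda>x. f x * g x)"
proof (rule incr_nonnegI)
  assume fg: "incr_nonneg f" "incr_nonneg g"
  show "0 \<le> f 0 * g 0" using fg by (simp add: incr_nonneg_def)
  fix x y :: real assume xy: "0 \<le> x" "x \<le> y" "y \<le> 1"
  show "f x * g x \<le> f y * g y"
    using incr_nonneg_mono[OF fg(1) xy] incr_nonneg_mono[OF fg(2) xy]
      incr_nonneg_bounds(3)[OF fg(1), of y] incr_nonneg_bounds(3)[OF fg(2), of x] xy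
    by (intro mult_mono) auto
qed

lemma incr_nonneg_transfer:
  assumes f: "incr_nonneg f"
  shows "incr_nonneg (transfer f)"
proof (rule incr_nonnegI)
  fix x y :: real assume xy: "0 \<le> x" "x \<le> y" "y \<le> 1"
  then have "x \<in> {0..1}" "y \<in> {0..1}" by auto
  note br = inv_branch_in_unit[OF this(1)] inv_branch_in_unit[OF this(2)]
  have "f (inv_branch x) \<le> f (inv_branch y)" "f (inv_branch (x + 1)) \<le> f (inv_branch (y + 1))"
    using xy br by (auto intro!: incr_nonneg_mono[OF f] inv_branch_mono)
  moreover have "inv_branch_deriv x \<le> inv_branch_deriv y" "inv_branch_deriv (x + 1) \<le> inv_branch_deriv (y + 1)"
    using xy by (auto intro!: inv_branch_deriv_mono)
  ultimately show "transfer f x \<le> transfer f y"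
    unfolding transfer_def using xy br inv_branch_deriv_pos[of y] inv_branch_deriv_pos[of "y + 1"]
    by (intro add_mono mult_mono incr_nonneg_bounds[OF f]) auto
qed (use transfer_nonneg[of f 0] incr_nonneg_bounds[OF f] in auto)

text \<open>The right end of the first branch and the left end of the second are the same point with the same
  weight, so their contributions cancel. For an increasing function the left-hand side is the total
  variation, and the identity is a Lasota--Yorke inequality: writing the right-hand side as
  \<open>2/3 * (f 1 - f 0) + 4/15 * f 0\<close>, the variation contracts by \<open>2/3\<close> up to a multiple of
  the minimum, which is at most the mean.\<close>
lemma transfer_oscillation: "transfer f 1 - transfer f 0 = 2/3 * f 1 - 2/5 * f 0"
  by (simp add: transfer_def)

lemma transfer_integral:
  assumes f: "incr_nonneg f"
  shows "unit_mean (transfer f) = unit_mean f"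
  using integral_T_transfer_nonneg[of f "\<lambda>_. 1::real"] incr_nonneg_measurable[OF f] incr_nonneg_bounds[OF f]
  by simp

lemma incr_nonneg_mean_bounds:
  assumes f: "incr_nonneg f"
  shows "f 0 \<le> unit_mean f" "unit_mean f \<le> f 1"
proof -
  have "unit_mean (\<lambda>_. f 0) \<le> unit_mean f" "unit_mean f \<le> unit_mean (\<lambda>_. f 1)"
    by (rule integral_mono; use incr_nonneg_integrable[OF f] incr_nonneg_bounds[OF f] in auto)+
  then show "f 0 \<le> unit_mean f" "unit_mean f \<le> f 1"
    by (simp_all add: unit_leb.prob_space[simplified])
qed

text \<open>Increasing densities of mass \<open>A\<close> whose variation is controlled by the mass. The bound
  \<open>14/15\<close> is below \<open>1\<close>, which keeps the minimum at least \<open>A/15\<close>.\<close>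
definition balanced :: "real \<Rightarrow> (real \<Rightarrow> real) \<Rightarrow> bool" where
  "balanced A f \<longleftrightarrow> incr_nonneg f \<and> unit_mean f = A \<and> f 1 - f 0 \<le> 14/15 * A"

text \<open>The transfer operator after removal of the constant \<open>A/15\<close> and rescaling back to mass
  \<open>A\<close>.\<close>
definition reduced_transfer :: "real \<Rightarrow> (real \<Rightarrow> real) \<Rightarrow> real \<Rightarrow> real" where
  "reduced_transfer A f = transfer (\<lambda>x. 15/14 * f x - A / 14)"

text \<open>The removal of \<open>A/15\<close> leaves a nonnegative function. After rescaling by \<open>15/14\<close> its
  variation is at most \<open>A\<close>, and \<open>transfer_oscillation\<close> brings this down to at most
  \<open>2/3 * A + 4/15 * A = 14/15 * A\<close>. Thus \<open>14/15\<close> is the value at which the removed mass, the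
  bound on the variation and the contraction fit together.\<close>
lemma balanced_reduced_transfer:
  assumes f: "balanced A f"
  shows "balanced A (reduced_transfer A f)"
proof -
  define h where "h x = 15/14 * f x - A / 14" for x
  from f have fi: "incr_nonneg f" and A: "unit_mean f = A" and osc: "f 1 - f 0 \<le> 14/15 * A"
    by (auto simp: balanced_def)
  note fm = incr_nonneg_mean_bounds[OF fi, unfolded A]
  have h: "incr_nonneg h"
    using incr_nonneg_mono[OF fi] osc fm by (intro incr_nonnegI) (auto simp: h_def)
  have "unit_mean h = A"
    unfolding h_def using incr_nonneg_integrable[OF fi]
    by (simp add: A unit_leb.prob_space[simplified])
  moreover have "transfer h 1 - transfer h 0 \<le> 14/15 * A"
  proof -
    have "2/3 * h 1 - 2/5 * h 0 = 5/7 * (f 1 - f 0) + 2/7 * f 0 - 2/105 * A"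
      by (simp add: h_def field_simps)
    then show ?thesis unfolding transfer_oscillation using osc fm by argo
  qed
  ultimately show ?thesis
    unfolding balanced_def reduced_transfer_def
    using incr_nonneg_transfer[OF h] transfer_integral[OF h] by (simp add: h_def[abs_def])
qed

lemma balanced_bounds:
  assumes f: "balanced A f" and x: "x \<in> {0..1}"
  shows "0 \<le> f x" "f x \<le> 2 * A"
proof -
  from f have fi: "incr_nonneg f" and A: "unit_mean f = A" and osc: "f 1 - f 0 \<le> 14/15 * A"
    by (auto simp: balanced_def)
  show "0 \<le> f x" by (rule incr_nonneg_bounds[OF fi x])
  have "0 \<le> f 0" using fi by (simp add: incr_nonneg_def)
  then show "f x \<le> 2 * A"
    using incr_nonneg_mean_bounds[OF fi, unfolded A] incr_nonneg_bounds[OF fi x] osc by simp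
qed

lemma balanced_iterate: "balanced A f \<Longrightarrow> balanced A ((reduced_transfer A ^^ n) f)"
  by (induction n) (auto simp: balanced_reduced_transfer)

text \<open>The removed constants cancel in a difference, so each step gains the factor \<open>14/15\<close> while the
  two remaining functions stay balanced of the same mass.\<close>
lemma transfer_iterate_balanced_diff:
  "(transfer ^^ n) (\<lambda>x. f x - g x)
    = (\<lambda>x. (14/15) ^ n * ((reduced_transfer A ^^ n) f x - (reduced_transfer A ^^ n) g x))"
proof (induction n)
  case (Suc n)
  have step: "transfer (\<lambda>x. c * (u x - v x)) = (\<lambda>x. 14/15 * c * (reduced_transfer A u x - reduced_transfer A v x))"
    for c u v by (simp add: reduced_transfer_def transfer_def fun_eq_iff algebra_simps)
  show ?case by (simp add: Suc step)
qed auto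

text \<open>By the Jordan decomposition these are the functions of bounded variation on \<open>[0,1]\<close>. Working
  with the decomposition instead of the variation makes the class visibly an algebra that is stable under
  the transfer operator.\<close>
definition incr_diff :: "(real \<Rightarrow> real) \<Rightarrow> bool" where
  "incr_diff h \<longleftrightarrow> (\<exists>f g. incr_nonneg f \<and> incr_nonneg g \<and> (\<forall>x\<in>{0..1}. h x = f x - g x))"

lemma incr_diffI:
  "incr_nonneg f \<Longrightarrow> incr_nonneg g \<Longrightarrow> (\<And>x. x \<in> {0..1} \<Longrightarrow> h x = f x - g x) \<Longrightarrow> incr_diff h"
  by (auto simp: incr_diff_def)

lemma incr_diffE:
  assumes "incr_diff h"
  obtains f g where "incr_nonneg f" "incr_nonneg g" "\<And>x. x \<in> {0..1} \<Longrightarrow> h x = f x - g x"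
  using assms unfolding incr_diff_def by blast

lemma incr_nonneg_imp_incr_diff: "incr_nonneg f \<Longrightarrow> incr_diff f"
  by (rule incr_diffI[of f "\<lambda>_. 0"]) (auto intro: incr_nonneg_const)

lemma incr_diff_const: "incr_diff (\<lambda>_. c)"
  by (rule incr_diffI[of "\<lambda>_. max c 0" "\<lambda>_. max (-c) 0"]) (auto intro: incr_nonneg_const)

lemma incr_diff_add:
  assumes "incr_diff u" "incr_diff v" shows "incr_diff (\<lambda>x. u x + v x)"
proof -
  from assms(1) obtain a b where 1: "incr_nonneg a" "incr_nonneg b" "\<And>x. x \<in> {0..1} \<Longrightarrow> u x = a x - b x"
    by (rule incr_diffE) blast
  from assms(2) obtain c d where 2: "incr_nonneg c" "incr_nonneg d" "\<And>x. x \<in> {0..1} \<Longrightarrow> v x = c x - d x"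
    by (rule incr_diffE) blast
  show ?thesis
    by (rule incr_diffI[of "\<lambda>x. a x + c x" "\<lambda>x. b x + d x"]) (use 1 2 in \<open>auto intro: incr_nonneg_add\<close>)
qed

lemma incr_diff_mult:
  assumes "incr_diff u" "incr_diff v" shows "incr_diff (\<lambda>x. u x * v x)"
proof -
  from assms(1) obtain a b where 1: "incr_nonneg a" "incr_nonneg b" "\<And>x. x \<in> {0..1} \<Longrightarrow> u x = a x - b x"
    by (rule incr_diffE) blast
  from assms(2) obtain c d where 2: "incr_nonneg c" "incr_nonneg d" "\<And>x. x \<in> {0..1} \<Longrightarrow> v x = c x - d x"
    by (rule incr_diffE) blast
  show ?thesis
  proof (rule incr_diffI)
    show "incr_nonneg (\<lambda>x. a x * c x + b x * d x)" "incr_nonneg (\<lambda>x. a x * d x + b x * c x)"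
      using 1 2 by (auto intro!: incr_nonneg_add incr_nonneg_mult)
    show "u x * v x = (a x * c x + b x * d x) - (a x * d x + b x * c x)" if "x \<in> {0..1}" for x
      unfolding 1(3)[OF that] 2(3)[OF that] by (simp add: algebra_simps)
  qed
qed

lemma incr_diff_cmult: "incr_diff u \<Longrightarrow> incr_diff (\<lambda>x. c * u x)"
  by (rule incr_diff_mult[OF incr_diff_const])

lemma incr_diff_diff: "incr_diff u \<Longrightarrow> incr_diff v \<Longrightarrow> incr_diff (\<lambda>x. u x - v x)"
  using incr_diff_add[of u "\<lambda>x. -1 * v x"] incr_diff_cmult[of v "-1"] by simp

lemma incr_diff_transfer: "incr_diff u \<Longrightarrow> incr_diff (transfer u)"
proof (erule incr_diffE)
  fix f g assume 1: "incr_nonneg f" "incr_nonneg g" "\<And>x. x \<in> {0..1} \<Longrightarrow> u x = f x - g x"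
  show "incr_diff (transfer u)"
  proof (rule incr_diffI)
    show "transfer u x = transfer f x - transfer g x" if "x \<in> {0..1}" for x
      using transfer_cong[of u "\<lambda>x. f x - g x" x] 1(3) that by (simp add: transfer_diff)
  qed (use 1 incr_nonneg_transfer in auto)
qed

lemma incr_diff_transfer_iterate: "incr_diff u \<Longrightarrow> incr_diff ((transfer ^^ n) u)"
  by (induction n) (auto simp: incr_diff_transfer)

lemma incr_diff_measurable: "incr_diff u \<Longrightarrow> u \<in> borel_measurable unit_leb"
proof (erule incr_diffE)
  fix f g assume 1: "incr_nonneg f" "incr_nonneg g" "\<And>x. x \<in> {0..1} \<Longrightarrow> u x = f x - g x"
  have "(\<lambda>x. f x - g x) \<in> borel_measurable unit_leb"
    using incr_nonneg_measurable[OF 1(1)] incr_nonneg_measurable[OF 1(2)] by measurable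
  then show ?thesis using 1(3) by (subst measurable_cong[of _ u "\<lambda>x. f x - g x"]) auto
qed

lemma incr_diff_bounded:
  assumes "incr_diff u"
  obtains B where "0 \<le> B" "\<And>x. x \<in> {0..1} \<Longrightarrow> \<bar>u x\<bar> \<le> B"
proof -
  from assms obtain f g where 1: "incr_nonneg f" "incr_nonneg g" "\<And>x. x \<in> {0..1} \<Longrightarrow> u x = f x - g x"
    by (rule incr_diffE) blast
  show ?thesis
  proof (rule that[of "f 1 + g 1"])
    show "\<bar>u x\<bar> \<le> f 1 + g 1" if "x \<in> {0..1}" for x
      using 1(3)[OF that] incr_nonneg_bounds[OF 1(1) that] incr_nonneg_bounds[OF 1(2) that] by linarith
  qed (use incr_nonneg_bounds[OF 1(1), of 1] incr_nonneg_bounds[OF 1(2), of 1] in simp)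
qed

lemma incr_diff_integrable: "incr_diff u \<Longrightarrow> integrable unit_leb u"
  by (rule incr_diff_bounded, assumption, rule bounded_measurable_integrable)
     (auto simp: incr_diff_measurable)

lemma integral_T_transfer:
  fixes \<phi> :: "real \<Rightarrow> 'a::{banach, second_countable_topology}"
  assumes u: "incr_diff u"
    and \<phi>: "\<phi> \<in> borel_measurable unit_leb" "\<And>x. x \<in> {0..1} \<Longrightarrow> norm (\<phi> x) \<le> B"
  shows "(\<integral>x. u x *\<^sub>R \<phi> (T x) \<partial>unit_leb) = (\<integral>x. transfer u x *\<^sub>R \<phi> x \<partial>unit_leb)"
proof -
  from u obtain f g where 1: "incr_nonneg f" "incr_nonneg g" and ufg: "\<And>x. x \<in> {0..1} \<Longrightarrow> u x = f x - g x"
    by (rule incr_diffE) blast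
  note \<phi>(1)[measurable] measurable_T_unit[measurable] incr_nonneg_measurable[measurable]
  have int: "integrable unit_leb (\<lambda>x. p x *\<^sub>R q x)"
    if p: "incr_nonneg p" and q [measurable]: "q \<in> borel_measurable unit_leb" and b: "\<And>x. x \<in> {0..1} \<Longrightarrow> norm (q x) \<le> B"
    for p and q :: "real \<Rightarrow> 'a"
  proof (rule bounded_measurable_integrable[of _ "p 1 * B"])
    show "(\<lambda>x. p x *\<^sub>R q x) \<in> borel_measurable unit_leb"
      using incr_nonneg_measurable[OF p] by measurable
    show "norm (p x *\<^sub>R q x) \<le> p 1 * B" if "x \<in> {0..1}" for x
      using b[OF that] incr_nonneg_bounds[OF p that] by (auto intro!: mult_mono)
  qed
  have T1: "(\<lambda>x. \<phi> (T x)) \<in> borel_measurable unit_leb" by measurable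
  have T2: "norm (\<phi> (T x)) \<le> B" if "x \<in> {0..1}" for x using \<phi>(2)[OF T_in_unit] .
  have "(\<integral>x. u x *\<^sub>R \<phi> (T x) \<partial>unit_leb) = (\<integral>x. f x *\<^sub>R \<phi> (T x) - g x *\<^sub>R \<phi> (T x) \<partial>unit_leb)"
    by (intro Bochner_Integration.integral_cong) (auto simp: ufg scaleR_left_diff_distrib)
  also have "\<dots> = (\<integral>x. f x *\<^sub>R \<phi> (T x) \<partial>unit_leb) - (\<integral>x. g x *\<^sub>R \<phi> (T x) \<partial>unit_leb)"
    by (intro Bochner_Integration.integral_diff int 1 T1 T2)
  also have "(\<integral>x. f x *\<^sub>R \<phi> (T x) \<partial>unit_leb) = (\<integral>x. transfer f x *\<^sub>R \<phi> x \<partial>unit_leb)"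
    by (rule integral_T_transfer_nonneg[OF incr_nonneg_measurable[OF 1(1)] incr_nonneg_bounds(3)[OF 1(1)] \<phi>(1)])
  also have "(\<integral>x. g x *\<^sub>R \<phi> (T x) \<partial>unit_leb) = (\<integral>x. transfer g x *\<^sub>R \<phi> x \<partial>unit_leb)"
    by (rule integral_T_transfer_nonneg[OF incr_nonneg_measurable[OF 1(2)] incr_nonneg_bounds(3)[OF 1(2)] \<phi>(1)])
  also have "(\<integral>x. transfer f x *\<^sub>R \<phi> x \<partial>unit_leb) - (\<integral>x. transfer g x *\<^sub>R \<phi> x \<partial>unit_leb)
      = (\<integral>x. transfer f x *\<^sub>R \<phi> x - transfer g x *\<^sub>R \<phi> x \<partial>unit_leb)"
    by (intro Bochner_Integration.integral_diff[symmetric] int incr_nonneg_transfer 1 \<phi>)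
  also have "\<dots> = (\<integral>x. transfer u x *\<^sub>R \<phi> x \<partial>unit_leb)"
  proof (intro Bochner_Integration.integral_cong refl)
    fix x assume "x \<in> space unit_leb"
    then have "transfer u x = transfer f x - transfer g x"
      using transfer_cong[of u "\<lambda>x. f x - g x" x] ufg by (simp add: transfer_diff)
    then show "transfer f x *\<^sub>R \<phi> x - transfer g x *\<^sub>R \<phi> x = transfer u x *\<^sub>R \<phi> x"
      by (simp add: scaleR_left_diff_distrib)
  qed
  finally show ?thesis .
qed

lemma transfer_mean: "incr_diff u \<Longrightarrow> unit_mean (transfer u) = unit_mean u"
  using integral_T_transfer[of u "\<lambda>_. 1::real" 1] by simp

lemma transfer_iterate_mean: "incr_diff u \<Longrightarrow> unit_mean ((transfer ^^ n) u) = unit_mean u"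
  by (induction n) (auto simp: transfer_mean incr_diff_transfer_iterate)

text \<open>Adding a large constant raises the mass and keeps the variation, so every function of the cone
  becomes balanced.\<close>
lemma balanced_add_const:
  assumes f: "incr_nonneg f" and k: "15/14 * f 1 \<le> k"
  shows "balanced (unit_mean f + k) (\<lambda>x. f x + k)"
proof -
  have "0 \<le> f 0" "0 \<le> f 1" "0 \<le> unit_mean f"
    using f incr_nonneg_bounds[OF f, of 1] incr_nonneg_mean_bounds[OF f] by (auto simp: incr_nonneg_def)
  then show ?thesis
    using k f incr_nonneg_integrable[OF f]
    by (auto simp: balanced_def unit_leb.prob_space[simplified] intro!: incr_nonneg_add incr_nonneg_const)
qed

lemma zero_mean_eq_balanced_diff:
  assumes h: "incr_diff h" "unit_mean h = 0"
  obtains A f g where "balanced A f" "balanced A g" "\<And>x. x \<in> {0..1} \<Longrightarrow> h x = f x - g x"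
proof -
  from h(1) obtain f g where 1: "incr_nonneg f" "incr_nonneg g" and hfg: "\<And>x. x \<in> {0..1} \<Longrightarrow> h x = f x - g x"
    by (rule incr_diffE) blast
  have "unit_mean h = unit_mean (\<lambda>x. f x - g x)"
    by (intro Bochner_Integration.integral_cong) (auto simp: hfg)
  with h have m: "unit_mean f = unit_mean g"
    using incr_nonneg_integrable[OF 1(1)] incr_nonneg_integrable[OF 1(2)] by simp
  have "0 \<le> f 1" "0 \<le> g 1" using incr_nonneg_bounds[OF 1(1), of 1] incr_nonneg_bounds[OF 1(2), of 1] by auto
  then show ?thesis
    using that[OF balanced_add_const[OF 1(1), of "15/14 * (f 1 + g 1)"] balanced_add_const[OF 1(2), of "15/14 * (f 1 + g 1)", folded m]] hfg
    by simp
qed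

text \<open>The spectral gap. The bound is the geometric factor of \<open>transfer_iterate_balanced_diff\<close>. The
  sum is again a difference of increasing functions, since a convergent series of increasing functions
  with positive coefficients is increasing.\<close>
theorem transfer_iterate_sums:
  assumes h: "incr_diff h" "unit_mean h = 0"
  obtains b B where "incr_diff b" "\<And>x. x \<in> {0..1} \<Longrightarrow> (\<lambda>n. (transfer ^^ n) h x) sums b x"
    "\<And>n x. x \<in> {0..1} \<Longrightarrow> \<bar>(transfer ^^ n) h x\<bar> \<le> B * (14/15) ^ n"
proof -
  obtain A f g where fg: "balanced A f" "balanced A g" and hfg: "\<And>x. x \<in> {0..1} \<Longrightarrow> h x = f x - g x"
    using zero_mean_eq_balanced_diff[OF h] by blast
  define F where "F u n x = (14/15) ^ n * (reduced_transfer A ^^ n) u x" for u n and x :: real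
  have bnd: "0 \<le> F u n x \<and> F u n x \<le> 2 * A * (14/15) ^ n" if "balanced A u" "x \<in> {0..1}" for u n x
    using balanced_bounds[OF balanced_iterate[OF that(1)] that(2), of n] by (simp add: F_def)
  have summ: "summable (\<lambda>n. F u n x)" if "balanced A u" "x \<in> {0..1}" for u x
    by (rule summable_comparison_test'[of "\<lambda>n. 2 * A * (14/15) ^ n" 0])
       (use bnd[OF that] in \<open>auto intro!: summable_mult summable_geometric\<close>)
  have incr: "incr_nonneg (\<lambda>x. \<Sum>n. F u n x)" if u: "balanced A u" for u
  proof (rule incr_nonnegI)
    fix x y :: real assume "0 \<le> x" "x \<le> y" "y \<le> 1"
    moreover from this have "F u n x \<le> F u n y" for n
      using balanced_iterate[OF u, of n] by (auto simp: F_def balanced_def incr_nonneg_mono)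
    ultimately show "(\<Sum>n. F u n x) \<le> (\<Sum>n. F u n y)"
      by (intro suminf_le summ u) auto
  qed (use summ[OF u, of 0] bnd[OF u, of 0] in \<open>auto intro!: suminf_nonneg\<close>)
  have eq: "(transfer ^^ n) h x = F f n x - F g n x" if "x \<in> {0..1}" for n x
  proof -
    have "(transfer ^^ n) h x = (transfer ^^ n) (\<lambda>x. f x - g x) x"
      by (rule transfer_iterate_cong) (use hfg that in auto)
    then show ?thesis unfolding transfer_iterate_balanced_diff[where A = A]
      by (simp add: F_def algebra_simps)
  qed
  show ?thesis
  proof (rule that[of "\<lambda>x. (\<Sum>n. F f n x) - (\<Sum>n. F g n x)" "2 * A"])
    show "incr_diff (\<lambda>x. (\<Sum>n. F f n x) - (\<Sum>n. F g n x))"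
      by (rule incr_diffI[OF incr[OF fg(1)] incr[OF fg(2)]]) simp
    fix x :: real assume x: "x \<in> {0..1}"
    show "(\<lambda>n. (transfer ^^ n) h x) sums ((\<Sum>n. F f n x) - (\<Sum>n. F g n x))"
      unfolding eq[OF x] by (intro sums_diff summable_sums summ fg x)
    show "\<bar>(transfer ^^ n) h x\<bar> \<le> 2 * A * (14/15) ^ n" for n
      unfolding eq[OF x] using bnd[OF fg(1) x, of n] bnd[OF fg(2) x, of n] by linarith
  qed
qed

lemma poisson_equation:
  assumes h: "incr_diff h" "unit_mean h = 0"
  obtains b where "incr_diff b" "\<And>x. x \<in> {0..1} \<Longrightarrow> b x - transfer b x = h x"
    "\<And>x. x \<in> {0..1} \<Longrightarrow> (\<lambda>n. (transfer ^^ n) h x) sums b x"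
proof -
  obtain b where b: "incr_diff b" "\<And>x. x \<in> {0..1} \<Longrightarrow> (\<lambda>n. (transfer ^^ n) h x) sums b x"
    using transfer_iterate_sums[OF h] by metis
  have "b x - transfer b x = h x" if x: "x \<in> {0..1}" for x
  proof -
    have "(\<lambda>n. inv_branch_deriv x * (transfer ^^ n) h (inv_branch x)
        + inv_branch_deriv (x + 1) * (transfer ^^ n) h (inv_branch (x + 1))) sums transfer b x"
      unfolding transfer_def[of b] by (intro sums_add sums_mult b(2) inv_branch_in_unit x)
    then have "(\<lambda>n. (transfer ^^ Suc n) h x) sums transfer b x"
      by (simp add: transfer_def)
    then have "(\<lambda>n. (transfer ^^ n) h x) sums (transfer b x + (transfer ^^ 0) h x)"
      by (subst (asm) sums_Suc_iff) simp
    then show ?thesis using sums_unique2[OF b(2)[OF x]] by simp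
  qed
  with b show ?thesis using that by blast
qed

text \<open>Existence of the limit is established in the next lemma, by writing the \<open>n\<close>-th iterate of the
  constant density as \<open>1\<close> plus the \<open>n\<close>-th partial sum of the series for
  \<open>h = transfer 1 - 1\<close>.\<close>
definition inv_density :: "real \<Rightarrow> real" where
  "inv_density x = lim (\<lambda>n. (transfer ^^ n) (\<lambda>_. 1) x)"

lemma
  shows inv_density_tendsto: "\<And>x. x \<in> {0..1} \<Longrightarrow> (\<lambda>n. (transfer ^^ n) (\<lambda>_. 1) x) \<longlonglongrightarrow> inv_density x"
    and transfer_inv_density: "\<And>x. x \<in> {0..1} \<Longrightarrow> transfer inv_density x = inv_density x"
    and incr_nonneg_inv_density: "incr_nonneg inv_density"
    and inv_density_mean: "unit_mean inv_density = 1"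
proof -
  define h where "h x = transfer (\<lambda>_. 1) x - 1" for x
  have one: "incr_nonneg (\<lambda>_. 1)" by (rule incr_nonneg_const) simp
  have tone: "incr_diff (transfer (\<lambda>_. 1))"
    by (rule incr_diff_transfer[OF incr_diff_const])
  have h: "incr_diff h"
    unfolding h_def by (rule incr_diff_diff[OF tone incr_diff_const])
  have h0: "unit_mean h = 0"
    unfolding h_def using incr_diff_integrable[OF tone] transfer_integral[OF one]
    by (simp add: unit_leb.prob_space[simplified])
  obtain b B where b: "incr_diff b" "\<And>x. x \<in> {0..1} \<Longrightarrow> b x - transfer b x = h x"
    "\<And>x. x \<in> {0..1} \<Longrightarrow> (\<lambda>n. (transfer ^^ n) h x) sums b x"
    by (rule poisson_equation[OF h h0]) blast
  have iter: "(transfer ^^ n) (\<lambda>_. 1) x = 1 + (\<Sum>k<n. (transfer ^^ k) h x)" for n x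
  proof (induction n)
    case (Suc n)
    have "h = (\<lambda>x. transfer (\<lambda>_. 1) x - (\<lambda>_. 1) x)" by (simp add: h_def fun_eq_iff)
    then have "(transfer ^^ n) h x = (transfer ^^ n) (transfer (\<lambda>_. 1)) x - (transfer ^^ n) (\<lambda>_. 1) x"
      by (simp add: transfer_iterate_diff)
    also have "(transfer ^^ n) (transfer (\<lambda>_. 1)) = (transfer ^^ Suc n) (\<lambda>_. 1)"
      by (simp add: funpow_swap1)
    finally show ?case using Suc by simp
  qed simp
  have lim1: "(\<lambda>n. (transfer ^^ n) (\<lambda>_. 1) x) \<longlonglongrightarrow> 1 + b x" if "x \<in> {0..1}" for x
    unfolding iter using b(3)[OF that] by (intro tendsto_intros) (simp add: sums_def)
  have eq: "inv_density x = 1 + b x" if "x \<in> {0..1}" for x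
    unfolding inv_density_def by (rule limI[OF lim1[OF that]])
  show lim: "(\<lambda>n. (transfer ^^ n) (\<lambda>_. 1) x) \<longlonglongrightarrow> inv_density x" if "x \<in> {0..1}" for x
    using lim1[OF that] eq[OF that] by simp
  show "transfer inv_density x = inv_density x" if x: "x \<in> {0..1}" for x
  proof -
    have "transfer inv_density x = transfer (\<lambda>x. (\<lambda>_. 1) x + b x) x"
      by (rule transfer_cong) (use eq x in auto)
    also have "\<dots> = transfer (\<lambda>_. 1) x + transfer b x" by (simp add: transfer_add)
    finally show ?thesis using b(2)[OF x] eq[OF x] by (simp add: h_def)
  qed
  have incr_n: "incr_nonneg ((transfer ^^ n) (\<lambda>_. 1))" for n
    by (induction n) (auto simp: one incr_nonneg_transfer)
  show inc: "incr_nonneg inv_density"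
  proof (rule incr_nonnegI)
    show "inv_density x \<le> inv_density y" if "0 \<le> x" "x \<le> y" "y \<le> 1" for x y
      using that incr_nonneg_mono[OF incr_n that]
      by (intro LIMSEQ_le[OF lim[of x] lim[of y]]) auto
    show "0 \<le> inv_density 0"
      using incr_n by (intro LIMSEQ_le_const[OF lim[of 0]]) (auto simp: incr_nonneg_def)
  qed
  obtain K where K: "\<And>n. (transfer ^^ n) (\<lambda>_. 1) 1 \<le> K"
    using convergent_imp_Bseq[OF convergentI[OF lim[of 1]]] by (auto simp: Bseq_def abs_le_iff)
  have "(\<lambda>n. unit_mean ((transfer ^^ n) (\<lambda>_. 1))) \<longlonglongrightarrow> unit_mean inv_density"
  proof (rule integral_dominated_convergence[where w = "\<lambda>_. K"])
    show "AE x in unit_leb. norm ((transfer ^^ n) (\<lambda>_. 1) x) \<le> K" for n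
      using incr_nonneg_bounds[OF incr_n, of _ n] K[of n] by (intro AE_I2) (auto intro: order_trans)
  qed (use lim incr_n inc in \<open>auto simp: incr_nonneg_measurable\<close>)
  moreover have "unit_mean ((transfer ^^ n) (\<lambda>_. 1)) = 1" for n
    using transfer_iterate_mean[OF incr_diff_const, of n 1] by (simp add: unit_leb.prob_space[simplified])
  ultimately show "unit_mean inv_density = 1" using LIMSEQ_unique[OF _ tendsto_const] by auto
qed

lemma incr_diff_inv_density: "incr_diff inv_density"
  by (rule incr_nonneg_imp_incr_diff[OF incr_nonneg_inv_density])

lemma transfer_iterate_inv_density: "x \<in> {0..1} \<Longrightarrow> (transfer ^^ n) inv_density x = inv_density x"
proof (induction n arbitrary: x)
  case (Suc n)
  have "(transfer ^^ Suc n) inv_density x = transfer inv_density x"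
    unfolding funpow.simps o_apply by (rule transfer_cong) (use Suc in auto)
  then show ?case using transfer_inv_density[OF Suc.prems] by simp
qed simp

text \<open>Subtracting the right multiple of the invariant density leaves a function of mean zero, to which
  the spectral gap applies.\<close>
theorem transfer_iterate_converges:
  assumes f: "incr_diff f"
  obtains B where "\<And>n x. x \<in> {0..1} \<Longrightarrow> \<bar>(transfer ^^ n) f x - unit_mean f * inv_density x\<bar> \<le> B * (14/15) ^ n"
proof -
  define h where "h x = f x - unit_mean f * inv_density x" for x
  have h: "incr_diff h"
    unfolding h_def by (intro incr_diff_diff f incr_diff_cmult incr_diff_inv_density)
  have "unit_mean h = 0"
    unfolding h_def using incr_diff_integrable[OF f] incr_diff_integrable[OF incr_diff_inv_density]
    by (simp add: inv_density_mean)
  then obtain B where B: "\<And>n x. x \<in> {0..1} \<Longrightarrow> \<bar>(transfer ^^ n) h x\<bar> \<le> B * (14/15) ^ n"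
    using transfer_iterate_sums[OF h] by metis
  show ?thesis
    by (rule that[of B])
       (use B in \<open>simp add: h_def[abs_def] transfer_iterate_diff transfer_iterate_cmult transfer_iterate_inv_density\<close>)
qed

text \<open>Exponential decay of correlations between a function of bounded variation and a bounded one.\<close>
lemma transfer_iterate_pairing:
  assumes u: "incr_diff u" and \<phi>: "\<phi> \<in> borel_measurable unit_leb" "\<And>x. x \<in> {0..1} \<Longrightarrow> \<bar>\<phi> x\<bar> \<le> C"
  obtains B where "\<And>n. \<bar>(\<integral>x. (transfer ^^ n) u x * \<phi> x \<partial>unit_leb)
    - unit_mean u * (\<integral>x. inv_density x * \<phi> x \<partial>unit_leb)\<bar> \<le> B * (14/15) ^ n"
proof -
  obtain B where B: "\<And>n x. x \<in> {0..1} \<Longrightarrow> \<bar>(transfer ^^ n) u x - unit_mean u * inv_density x\<bar> \<le> B * (14/15) ^ n"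
    by (rule transfer_iterate_converges[OF u]) blast
  have int: "integrable unit_leb (\<lambda>x. v x * \<phi> x)" if v: "incr_diff v" for v
  proof -
    obtain K where K: "0 \<le> K" "\<And>x. x \<in> {0..1} \<Longrightarrow> \<bar>v x\<bar> \<le> K" using incr_diff_bounded[OF v] by blast
    show ?thesis
    proof (rule bounded_measurable_integrable[of _ "K * C"])
      show "(\<lambda>x. v x * \<phi> x) \<in> borel_measurable unit_leb"
        by (intro borel_measurable_times incr_diff_measurable v \<phi>)
      show "norm (v x * \<phi> x) \<le> K * C" if "x \<in> {0..1}" for x
        unfolding real_norm_def abs_mult by (intro mult_mono K \<phi> that) simp
    qed
  qed
  have "\<bar>(\<integral>x. (transfer ^^ n) u x * \<phi> x \<partial>unit_leb) - unit_mean u * (\<integral>x. inv_density x * \<phi> x \<partial>unit_leb)\<bar>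
    \<le> B * C * (14/15) ^ n" for n
  proof -
    have "(\<integral>x. (transfer ^^ n) u x * \<phi> x \<partial>unit_leb) - unit_mean u * (\<integral>x. inv_density x * \<phi> x \<partial>unit_leb)
      = (\<integral>x. ((transfer ^^ n) u x - unit_mean u * inv_density x) * \<phi> x \<partial>unit_leb)"
      using int[OF incr_diff_transfer_iterate[OF u, of n]] int[OF incr_diff_cmult[OF incr_diff_inv_density, of "unit_mean u"]]
      by (simp add: left_diff_distrib mult.assoc)
    moreover have "\<bar>\<integral>x. ((transfer ^^ n) u x - unit_mean u * inv_density x) * \<phi> x \<partial>unit_leb\<bar> \<le> unit_mean (\<lambda>_. B * C * (14/15) ^ n)"
    proof (rule integral_abs_bound_integral)
      show "integrable unit_leb (\<lambda>x. ((transfer ^^ n) u x - unit_mean u * inv_density x) * \<phi> x)"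
        by (rule int) (intro incr_diff_diff incr_diff_transfer_iterate u incr_diff_cmult incr_diff_inv_density)
      fix x assume "x \<in> space unit_leb"
      then have x: "x \<in> {0..1}" by simp
      have "\<bar>(transfer ^^ n) u x - unit_mean u * inv_density x\<bar> * \<bar>\<phi> x\<bar> \<le> (B * (14/15) ^ n) * C"
        by (intro mult_mono B \<phi> x) (use B[OF x, of n] in linarith, simp)
      then show "\<bar>((transfer ^^ n) u x - unit_mean u * inv_density x) * \<phi> x\<bar> \<le> B * C * (14/15) ^ n"
        by (simp add: abs_mult mult_ac)
    qed simp
    ultimately show ?thesis by (simp add: unit_leb.prob_space[simplified])
  qed
  then show ?thesis by (rule that)
qed

section \<open>Existence and uniqueness of the invariant measure\<close>

lemma measurable_T_iterate: "(T ^^ n) \<in> measurable unit_leb unit_leb"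
proof (induction n)
  case (Suc n)
  show ?case unfolding funpow.simps by (rule measurable_comp[OF Suc measurable_T_unit])
qed simp

lemma T_iterate_in_unit: "x \<in> {0..1} \<Longrightarrow> (T ^^ n) x \<in> {0..1}"
  by (cases n) (use T_in_unit in auto)

lemma integral_T_iterate_transfer:
  fixes \<phi> :: "real \<Rightarrow> 'a::{banach, second_countable_topology}"
  assumes u: "incr_diff u"
    and \<phi>: "\<phi> \<in> borel_measurable unit_leb" "\<And>x. x \<in> {0..1} \<Longrightarrow> norm (\<phi> x) \<le> B"
  shows "(\<integral>x. u x *\<^sub>R \<phi> ((T ^^ n) x) \<partial>unit_leb) = (\<integral>x. (transfer ^^ n) u x *\<^sub>R \<phi> x \<partial>unit_leb)"
  using u
proof (induction n arbitrary: u)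
  case (Suc n)
  have "(\<integral>x. u x *\<^sub>R \<phi> ((T ^^ Suc n) x) \<partial>unit_leb) = (\<integral>x. u x *\<^sub>R \<phi> ((T ^^ n) (T x)) \<partial>unit_leb)"
    by (simp add: funpow_swap1)
  also have "\<dots> = (\<integral>x. transfer u x *\<^sub>R \<phi> ((T ^^ n) x) \<partial>unit_leb)"
  proof (rule integral_T_transfer[OF Suc.prems])
    show "(\<lambda>x. \<phi> ((T ^^ n) x)) \<in> borel_measurable unit_leb"
      by (rule measurable_compose[OF measurable_T_iterate \<phi>(1)])
    show "norm (\<phi> ((T ^^ n) x)) \<le> B" if "x \<in> {0..1}" for x
      by (rule \<phi>(2)[OF T_iterate_in_unit[OF that]])
  qed
  also have "\<dots> = (\<integral>x. (transfer ^^ Suc n) u x *\<^sub>R \<phi> x \<partial>unit_leb)"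
    using Suc.IH[OF incr_diff_transfer[OF Suc.prems]] by (simp add: funpow_swap1)
  finally show ?case .
qed simp

definition inv_measure :: "real measure" where
  "inv_measure = density unit_leb (\<lambda>x. ennreal (inv_density x))"

lemma inv_density_measurable: "inv_density \<in> borel_measurable unit_leb"
  by (rule incr_nonneg_measurable[OF incr_nonneg_inv_density])

lemma inv_density_ennreal_measurable: "(\<lambda>x. ennreal (inv_density x)) \<in> borel_measurable unit_leb"
  by (rule measurable_compose[OF inv_density_measurable measurable_ennreal])

lemma inv_density_nonneg: "x \<in> {0..1} \<Longrightarrow> 0 \<le> inv_density x"
  by (rule incr_nonneg_bounds(3)[OF incr_nonneg_inv_density])

lemma space_inv_measure [simp]: "space inv_measure = {0..1}"
  by (simp add: inv_measure_def)

lemma sets_inv_measure [simp, measurable_cong]: "sets inv_measure = sets unit_leb"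
  by (simp add: inv_measure_def)

lemma prob_space_inv_measure: "prob_space inv_measure"
proof (rule prob_spaceI)
  have "emeasure inv_measure (space inv_measure) = (\<integral>\<^sup>+x. ennreal (inv_density x) \<partial>unit_leb)"
    unfolding inv_measure_def using inv_density_ennreal_measurable sets.top[of unit_leb]
    by (subst emeasure_density) (auto intro!: nn_integral_cong simp del: sets.top)
  also have "\<dots> = ennreal (unit_mean inv_density)"
    by (rule nn_integral_eq_integral)
       (use inv_density_nonneg incr_diff_integrable[OF incr_diff_inv_density] in auto)
  finally show "emeasure inv_measure (space inv_measure) = 1" by (simp add: inv_density_mean)
qed

interpretation inv_measure: prob_space inv_measure by (rule prob_space_inv_measure)

lemma integral_inv_measure:
  fixes \<phi> :: "real \<Rightarrow> 'a::{banach, second_countable_topology}"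
  assumes "\<phi> \<in> borel_measurable unit_leb"
  shows "(\<integral>x. \<phi> x \<partial>inv_measure) = (\<integral>x. inv_density x *\<^sub>R \<phi> x \<partial>unit_leb)"
  unfolding inv_measure_def
  by (rule integral_density) (use assms inv_density_measurable inv_density_nonneg in auto)

lemma acip_inv_measure: "acip T inv_measure"
proof -
  have "distr inv_measure inv_measure T = distr inv_measure unit_leb T"
    by (rule distr_cong) auto
  also have "\<dots> = density unit_leb (transfer inv_density)"
    unfolding inv_measure_def
    by (rule distr_density_T) (auto simp: inv_density_measurable inv_density_nonneg)
  also have "\<dots> = inv_measure"
    unfolding inv_measure_def
    by (rule density_cong)
       (use inv_density_measurable measurable_transfer[OF inv_density_measurable] transfer_inv_density in auto)
  finally have "distr inv_measure inv_measure T = inv_measure" .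
  moreover have "absolutely_continuous unit_leb inv_measure"
    unfolding inv_measure_def by (rule absolutely_continuousI_density[OF inv_density_ennreal_measurable])
  moreover have "T \<in> measurable inv_measure inv_measure"
    using measurable_T_unit by (simp cong: measurable_cong_sets)
  ultimately show ?thesis
    unfolding acip_def using sets_unit_leb prob_space_inv_measure by simp
qed

text \<open>Uniqueness follows from mixing with respect to Lebesgue measure. If \<open>h\<close> is the density of an
  invariant probability measure, the sequence in question is constant, and its limit is the measure
  defined by \<open>inv_density\<close>. Decay of correlations gives the property for functions of bounded variation;
  since an invariant density is only known to be integrable, it has to be extended to
  \<open>L\<^sup>1\<close>.\<close>
definition mixing :: "(real \<Rightarrow> real) \<Rightarrow> bool" where
  "mixing h \<longleftrightarrow> (\<forall>A\<in>sets unit_leb. (\<lambda>n. \<integral>x. h x * indicator A ((T ^^ n) x) \<partial>unit_leb)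
     \<longlonglongrightarrow> unit_mean h * measure inv_measure A)"

lemma indicator_T_iterate_measurable:
  "A \<in> sets unit_leb \<Longrightarrow> (\<lambda>x. indicator A ((T ^^ n) x) :: real) \<in> borel_measurable unit_leb"
  by (rule measurable_compose[OF measurable_T_iterate]) simp

lemma integrable_mult_indicator_T_iterate:
  fixes h :: "real \<Rightarrow> real"
  assumes "integrable unit_leb h" "A \<in> sets unit_leb"
  shows "integrable unit_leb (\<lambda>x. h x * indicator A ((T ^^ n) x))"
  by (rule Bochner_Integration.integrable_bound[OF assms(1)])
     (use assms indicator_T_iterate_measurable[OF assms(2), of n] in \<open>auto simp: indicator_def abs_mult intro!: AE_I2\<close>)

lemma measure_inv_measure_eq:
  assumes A: "A \<in> sets unit_leb"
  shows "measure inv_measure A = (\<integral>x. inv_density x * indicator A x \<partial>unit_leb)"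
proof -
  have "A \<inter> {0..1} = A" using sets.sets_into_space[OF A] by auto
  then have "(\<integral>x. indicator A x \<partial>inv_measure) = measure inv_measure A"
    using A by simp
  then show ?thesis
    using integral_inv_measure[of "indicator A :: real \<Rightarrow> real"] A by simp
qed

lemma mixing_incr_diff:
  assumes h: "incr_diff h"
  shows "mixing h"
  unfolding mixing_def
proof
  fix A assume A: "A \<in> sets unit_leb"
  have ind: "(indicator A :: real \<Rightarrow> real) \<in> borel_measurable unit_leb" using A by simp
  obtain B where B: "\<And>n. \<bar>(\<integral>x. (transfer ^^ n) h x * indicator A x \<partial>unit_leb)
    - unit_mean h * (\<integral>x. inv_density x * indicator A x \<partial>unit_leb)\<bar> \<le> B * (14/15) ^ n"
    by (rule transfer_iterate_pairing[OF h ind, of 1]) (auto simp: indicator_def)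
  have bound: "\<bar>(\<integral>x. h x * indicator A ((T ^^ n) x) \<partial>unit_leb) - unit_mean h * measure inv_measure A\<bar> \<le> B * (14/15) ^ n" for n
    using B[of n] integral_T_iterate_transfer[OF h ind, of 1 n]
    by (simp add: measure_inv_measure_eq[OF A] indicator_def)
  have "(\<lambda>n. (\<integral>x. h x * indicator A ((T ^^ n) x) \<partial>unit_leb) - unit_mean h * measure inv_measure A) \<longlonglongrightarrow> 0"
  proof (rule Lim_null_comparison)
    show "\<forall>\<^sub>F n in sequentially. norm ((\<integral>x. h x * indicator A ((T ^^ n) x) \<partial>unit_leb) - unit_mean h * measure inv_measure A) \<le> B * (14/15) ^ n"
      using bound by simp
    show "(\<lambda>n. B * (14/15) ^ n) \<longlonglongrightarrow> 0"
      by (intro tendsto_mult_right_zero LIMSEQ_power_zero) simp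
  qed
  then show "(\<lambda>n. \<integral>x. h x * indicator A ((T ^^ n) x) \<partial>unit_leb) \<longlonglongrightarrow> unit_mean h * measure inv_measure A"
    by (rule LIM_zero_cancel)
qed

text \<open>The pairing with an indicator function is a contraction in \<open>L\<^sup>1\<close>, uniformly in
  \<open>n\<close>, so limits may be exchanged.\<close>
lemma mixing_L1_limit:
  assumes s: "\<And>i. integrable unit_leb (s i)" "\<And>i. mixing (s i)" and h: "integrable unit_leb h"
    and lim: "(\<lambda>i. unit_mean (\<lambda>x. \<bar>s i x - h x\<bar>)) \<longlonglongrightarrow> 0"
  shows "mixing h"
  unfolding mixing_def
proof
  fix A assume A: "A \<in> sets unit_leb"
  let ?c = "measure inv_measure A"
  show "(\<lambda>n. \<integral>x. h x * indicator A ((T ^^ n) x) \<partial>unit_leb) \<longlonglongrightarrow> unit_mean h * ?c"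
  proof (rule LIMSEQ_I)
    fix e :: real assume "0 < e"
    then obtain i where i: "\<bar>unit_mean (\<lambda>x. \<bar>s i x - h x\<bar>)\<bar> < e / 3"
      using LIMSEQ_D[OF lim, of "e / 3"] by auto
    define d where "d = unit_mean (\<lambda>x. \<bar>s i x - h x\<bar>)"
    from \<open>0 < e\<close> obtain N where N: "\<And>n. N \<le> n \<Longrightarrow> \<bar>(\<integral>x. s i x * indicator A ((T ^^ n) x) \<partial>unit_leb) - unit_mean (s i) * ?c\<bar> < e / 3"
      using s(2)[of i] A LIMSEQ_D[of "\<lambda>n. \<integral>x. s i x * indicator A ((T ^^ n) x) \<partial>unit_leb" "unit_mean (s i) * ?c" "e / 3"]
      unfolding mixing_def by auto
    have m: "\<bar>unit_mean (s i) - unit_mean h\<bar> \<le> d"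
    proof -
      have "unit_mean (s i) - unit_mean h = unit_mean (\<lambda>x. s i x - h x)" using s(1) h by simp
      then show ?thesis unfolding d_def by (simp only: integral_abs_bound)
    qed
    have c: "\<bar>unit_mean (s i) * ?c - unit_mean h * ?c\<bar> \<le> d"
    proof -
      have "\<bar>unit_mean (s i) * ?c - unit_mean h * ?c\<bar> = \<bar>unit_mean (s i) - unit_mean h\<bar> * ?c"
        by (simp add: left_diff_distrib[symmetric] abs_mult)
      also have "\<dots> \<le> d * 1" using m by (intro mult_mono) auto
      finally show ?thesis by simp
    qed
    show "\<exists>N. \<forall>n\<ge>N. norm ((\<integral>x. h x * indicator A ((T ^^ n) x) \<partial>unit_leb) - unit_mean h * ?c) < e"
    proof (intro exI[of _ N] allI impI)
      fix n assume n: "N \<le> n"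
      have "\<bar>(\<integral>x. h x * indicator A ((T ^^ n) x) \<partial>unit_leb) - (\<integral>x. s i x * indicator A ((T ^^ n) x) \<partial>unit_leb)\<bar>
        = \<bar>\<integral>x. h x * indicator A ((T ^^ n) x) - s i x * indicator A ((T ^^ n) x) \<partial>unit_leb\<bar>"
        using integrable_mult_indicator_T_iterate[OF h A] integrable_mult_indicator_T_iterate[OF s(1) A]
        by (subst Bochner_Integration.integral_diff) auto
      also have "\<dots> \<le> d"
        unfolding d_def
      proof (rule integral_abs_bound_integral)
        show "integrable unit_leb (\<lambda>x. h x * indicator A ((T ^^ n) x) - s i x * indicator A ((T ^^ n) x))"
          using integrable_mult_indicator_T_iterate[OF h A] integrable_mult_indicator_T_iterate[OF s(1) A] by auto
        show "integrable unit_leb (\<lambda>x. \<bar>s i x - h x\<bar>)" using s(1) h by auto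
      qed (auto simp: indicator_def)
      finally show "norm ((\<integral>x. h x * indicator A ((T ^^ n) x) \<partial>unit_leb) - unit_mean h * ?c) < e"
        using c N[OF n] i unfolding d_def[symmetric] real_norm_def by linarith
    qed
  qed
qed

lemma mixing_add:
  assumes "integrable unit_leb f" "mixing f" "integrable unit_leb g" "mixing g"
  shows "mixing (\<lambda>x. f x + g x)"
  unfolding mixing_def
proof
  fix A assume A: "A \<in> sets unit_leb"
  have "(\<lambda>n. (\<integral>x. f x * indicator A ((T ^^ n) x) \<partial>unit_leb) + (\<integral>x. g x * indicator A ((T ^^ n) x) \<partial>unit_leb))
    \<longlonglongrightarrow> unit_mean f * measure inv_measure A + unit_mean g * measure inv_measure A"
    using assms A by (intro tendsto_add) (auto simp: mixing_def)
  then show "(\<lambda>n. \<integral>x. (f x + g x) * indicator A ((T ^^ n) x) \<partial>unit_leb)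
    \<longlonglongrightarrow> unit_mean (\<lambda>x. f x + g x) * measure inv_measure A"
    using assms A by (simp add: distrib_right integrable_mult_indicator_T_iterate)
qed

lemma mixing_cmult: "mixing f \<Longrightarrow> mixing (\<lambda>x. c * f x)"
  unfolding mixing_def by (auto simp: mult.assoc intro!: tendsto_mult)

lemma indicator_integrable_unit:
  "B \<in> sets borel \<Longrightarrow> integrable unit_leb (indicator B :: real \<Rightarrow> real)"
  by (rule bounded_measurable_integrable[of _ 1])
     (auto intro!: measurable_restrict_space1 simp: indicator_def)

text \<open>Half-lines have indicator functions of bounded variation and generate the Borel sets; the step to
  disjoint unions is an \<open>L\<^sup>1\<close> limit.\<close>
lemma mixing_indicator:
  assumes "B \<in> sets (borel :: real measure)"
  shows "mixing (indicator B)"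
proof -
  have sb: "sets (borel :: real measure) = sigma_sets UNIV (range atMost)"
    by (subst borel_eq_atMost) simp
  have "Int_stable (range atMost :: real set set)"
    by (auto simp: Int_stable_def)
  moreover have "range atMost \<subseteq> Pow (UNIV :: real set)" by simp
  ultimately show ?thesis
    using assms[unfolded sb]
  proof (rule sigma_sets_induct_disjoint)
    fix B :: "real set" assume "B \<in> range atMost"
    then obtain a where B: "B = {..a}" by auto
    have "incr_diff (indicator B)"
      by (rule incr_diffI[of "\<lambda>_. 1" "\<lambda>x. if x \<le> a then 0 else 1"])
         (auto simp: B indicator_def intro!: incr_nonnegI)
    then show "mixing (indicator B)" by (rule mixing_incr_diff)
  next
    have "(indicator {} :: real \<Rightarrow> real) = (\<lambda>_. 0)" by (simp add: fun_eq_iff)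
    then show "mixing (indicator {})" by (simp add: mixing_incr_diff[OF incr_diff_const])
  next
    fix B :: "real set" assume B: "B \<in> sigma_sets UNIV (range atMost)" "mixing (indicator B)"
    have "mixing (\<lambda>x. 1 + -1 * indicator B x)"
      using B sb by (intro mixing_add mixing_cmult mixing_incr_diff[OF incr_diff_const]) (auto simp: indicator_integrable_unit)
    moreover have "(indicator (UNIV - B) :: real \<Rightarrow> real) = (\<lambda>x. 1 + -1 * indicator B x)"
      by (auto simp: fun_eq_iff indicator_def)
    ultimately show "mixing (indicator (UNIV - B))" by simp
  next
    fix B :: "nat \<Rightarrow> real set"
    assume disj: "disjoint_family B" and B: "range B \<subseteq> sigma_sets UNIV (range atMost)" and mix: "\<And>i. mixing (indicator (B i))"
    have Bb [measurable]: "B i \<in> sets borel" for i using B sb by auto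
    let ?s = "\<lambda>n x. \<Sum>i<n. indicator (B i) x :: real"
    have int: "integrable unit_leb (?s n)" for n
      by (intro Bochner_Integration.integrable_sum indicator_integrable_unit Bb)
    have mixs: "mixing (?s n)" for n
    proof (induction n)
      case (Suc n)
      show ?case using mixing_add[OF int[of n] Suc indicator_integrable_unit[OF Bb] mix[of n]] by simp
    qed (simp add: mixing_incr_diff[OF incr_diff_const])
    have s_eq: "?s n x = indicator (\<Union>i<n. B i) x" for n x
      using disjoint_family_on_mono[OF _ disj, of "{..<n}"]
      by (auto simp: fun_eq_iff indicator_UN_disjoint)
    show "mixing (indicator (\<Union>i. B i))"
    proof (rule mixing_L1_limit[OF int mixs])
      show "integrable unit_leb (indicator (\<Union>i. B i) :: real \<Rightarrow> real)"
        by (rule indicator_integrable_unit) measurable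
      have "(\<lambda>i. unit_mean (\<lambda>x. \<bar>?s i x - indicator (\<Union>i. B i) x\<bar>)) \<longlonglongrightarrow> unit_mean (\<lambda>_. 0)"
      proof (rule integral_dominated_convergence[where w = "\<lambda>_. 1"])
        show "AE x in unit_leb. (\<lambda>i. \<bar>?s i x - indicator (\<Union>i. B i) x\<bar>) \<longlonglongrightarrow> 0"
        proof (rule AE_I2)
          fix x
          have "(\<lambda>n. indicator (\<Union>i<n. B i) x :: real) \<longlonglongrightarrow> indicator (\<Union>i. B i) x"
            by (rule LIMSEQ_indicator_UN)
          then show "(\<lambda>i. \<bar>?s i x - indicator (\<Union>i. B i) x\<bar>) \<longlonglongrightarrow> 0"
            unfolding s_eq by (intro tendsto_rabs_zero LIM_zero)
        qed
        show "AE x in unit_leb. norm \<bar>?s i x - indicator (\<Union>i. B i) x\<bar> \<le> 1" for i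
          unfolding s_eq by (auto simp: indicator_def)
        have [measurable]: "(indicator (\<Union>i. B i) :: real \<Rightarrow> real) \<in> borel_measurable unit_leb"
          by (intro measurable_restrict_space1 borel_measurable_indicator) auto
        show "(\<lambda>x. \<bar>?s i x - indicator (\<Union>i. B i) x\<bar>) \<in> borel_measurable unit_leb" for i
          using borel_measurable_integrable[OF int[of i]] by measurable
      qed auto
      then show "(\<lambda>i. unit_mean (\<lambda>x. \<bar>?s i x - indicator (\<Union>i. B i) x\<bar>)) \<longlonglongrightarrow> 0" by simp
    qed
  qed
qed

lemma mixing_integrable:
  assumes "integrable unit_leb h"
  shows "mixing h"
  using assms
proof (induction rule: integrable_induct)
  case (base A c)
  then have "A \<in> sets borel" by (auto simp: sets_restrict_space)
  from mixing_cmult[OF mixing_indicator[OF this], of c] show ?case by (simp add: mult.commute)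
next
  case (add f g)
  then show ?case by (intro mixing_add)
next
  case (lim f s)
  have "(\<lambda>i. unit_mean (\<lambda>x. \<bar>s i x - f x\<bar>)) \<longlonglongrightarrow> unit_mean (\<lambda>_. 0)"
  proof (rule integral_dominated_convergence[where w = "\<lambda>x. 3 * \<bar>f x\<bar>"])
    show "AE x in unit_leb. (\<lambda>i. \<bar>s i x - f x\<bar>) \<longlonglongrightarrow> 0"
      using lim by (intro AE_I2 tendsto_rabs_zero LIM_zero) auto
    show "AE x in unit_leb. norm \<bar>s i x - f x\<bar> \<le> 3 * \<bar>f x\<bar>" for i
    proof (rule AE_I2)
      fix x assume "x \<in> space unit_leb"
      moreover have "\<And>i x. x \<in> space unit_leb \<Longrightarrow> norm (s i x) \<le> 2 * norm (f x)" using lim by blast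
      ultimately have "\<bar>s i x\<bar> \<le> 2 * \<bar>f x\<bar>" by (metis real_norm_def)
      then show "norm \<bar>s i x - f x\<bar> \<le> 3 * \<bar>f x\<bar>" by simp
    qed
  qed (use lim in auto)
  then show ?case using lim by (intro mixing_L1_limit[of s f]) auto
qed

theorem acip_unique:
  assumes nu: "acip T \<nu>"
  shows "\<nu> = inv_measure"
proof -
  from nu have sets: "sets \<nu> = sets unit_leb" and prob: "prob_space \<nu>"
    and ac: "absolutely_continuous unit_leb \<nu>" and meas: "T \<in> measurable \<nu> \<nu>" and inv: "distr \<nu> \<nu> T = \<nu>"
    by (simp_all add: acip_def sets_unit_leb)
  interpret nu: prob_space \<nu> by fact
  have space: "space \<nu> = {0..1}" using sets_eq_imp_space_eq[OF sets] by simp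
  obtain h' where h': "h' \<in> borel_measurable unit_leb" "density unit_leb h' = \<nu>"
    using unit_leb.Radon_Nikodym[OF ac sets] by blast
  define h where "h x = enn2real (h' x)" for x
  have hm [measurable]: "h \<in> borel_measurable unit_leb" unfolding h_def using h'(1) by measurable
  have tot: "(\<integral>\<^sup>+x. h' x \<partial>unit_leb) = 1"
  proof -
    have "(\<integral>\<^sup>+x. h' x \<partial>unit_leb) = (\<integral>\<^sup>+x. h' x * indicator {0..1} x \<partial>unit_leb)"
      by (rule nn_integral_cong) simp
    also have "\<dots> = emeasure (density unit_leb h') {0..1}"
      using h'(1) sets.top[of unit_leb] by (subst emeasure_density) (simp_all del: sets.top)
    also have "\<dots> = 1" unfolding h'(2) using nu.emeasure_space_1 by (simp only: space)
    finally show ?thesis .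
  qed
  have "AE x in unit_leb. h' x \<noteq> \<infinity>"
    by (rule nn_integral_PInf_AE) (use h' tot in auto)
  then have hh': "AE x in unit_leb. h' x = ennreal (h x)"
    by eventually_elim (simp add: h_def top.not_eq_extremum)
  have nu_h: "\<nu> = density unit_leb (\<lambda>x. ennreal (h x))"
    unfolding h'(2)[symmetric] by (rule density_cong) (use h' hh' in auto)
  have h_nn: "(\<integral>\<^sup>+x. ennreal (h x) \<partial>unit_leb) = 1"
    unfolding tot[symmetric] by (rule nn_integral_cong_AE) (use hh' in auto)
  have h0: "0 \<le> h x" for x by (simp add: h_def)
  have hint: "integrable unit_leb h"
    by (rule integrableI_nonneg) (use h0 h_nn in auto)
  have hmean: "unit_mean h = 1"
    using nn_integral_eq_integral[OF hint] h0 h_nn by simp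
  have inv_n: "(\<integral>x. indicator A ((T ^^ n) x) \<partial>\<nu>) = measure \<nu> A" if A: "A \<in> sets \<nu>" for A n
  proof (induction n)
    case (Suc n)
    have m: "(\<lambda>x. indicator A ((T ^^ n) x) :: real) \<in> borel_measurable \<nu>"
      using indicator_T_iterate_measurable[of A n] A sets by (simp cong: measurable_cong_sets)
    have "(\<integral>x. indicat_real A ((T ^^ Suc n) x) \<partial>\<nu>) = (\<integral>x. indicator A ((T ^^ n) (T x)) \<partial>\<nu>)"
      by (simp add: funpow_swap1)
    also have "\<dots> = (\<integral>x. indicator A ((T ^^ n) x) \<partial>distr \<nu> \<nu> T)"
      by (rule integral_distr[symmetric]) (use meas m in auto)
    finally show ?case using Suc inv by simp
  qed (use A in simp)
  show ?thesis
  proof (rule measure_eqI)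
    show "sets \<nu> = sets inv_measure" using sets by simp
    fix A assume A: "A \<in> sets \<nu>"
    then have A': "A \<in> sets unit_leb" using sets by simp
    have const: "(\<integral>x. h x * indicator A ((T ^^ n) x) \<partial>unit_leb) = measure \<nu> A" for n
      using inv_n[OF A, of n] integral_density[OF indicator_T_iterate_measurable[OF A', of n] hm] h0
      by (simp add: nu_h[symmetric])
    have "(\<lambda>n. \<integral>x. h x * indicator A ((T ^^ n) x) \<partial>unit_leb) \<longlonglongrightarrow> measure inv_measure A"
      using mixing_integrable[OF hint] A' by (simp add: mixing_def hmean)
    then have "(\<lambda>n. measure \<nu> A) \<longlonglongrightarrow> measure inv_measure A"
      unfolding const .
    then have "measure \<nu> A = measure inv_measure A" by (simp add: LIMSEQ_const_iff)
    then show "emeasure \<nu> A = emeasure inv_measure A"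
      by (simp add: nu.emeasure_eq_measure inv_measure.emeasure_eq_measure)
  qed
qed

section \<open>Functions of bounded variation and normal laws\<close>

text \<open>Jordan decomposition: if \<open>V y\<close> is the variation on \<open>[0,y]\<close>, then \<open>V\<close> and
  \<open>V - \<psi>\<close> are increasing. The constant \<open>\<bar>\<psi> 0\<bar>\<close> makes both of them nonnegative.\<close>
lemma bounded_variation_imp_incr_diff:
  assumes "bounded_variation_on 0 1 \<psi>"
  shows "incr_diff \<psi>"
proof -
  obtain B where B: "\<And>n x. x 0 = 0 \<Longrightarrow> x n = 1 \<Longrightarrow> (\<forall>i<n. x i < x (Suc i)) \<Longrightarrow>
      (\<Sum>i<n. \<bar>\<psi> (x (Suc i)) - \<psi> (x i)\<bar>) \<le> B"
    using assms unfolding bounded_variation_on_def by blast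
  \<comment> \<open>the sums over partitions of \<open>[0,y]\<close>, which for \<open>y \<le> 1\<close> extend to partitions of \<open>[0,1]\<close>\<close>
  define W where "W y = {\<Sum>i<n. \<bar>\<psi> (x (Suc i)) - \<psi> (x i)\<bar> | n x. x 0 = 0 \<and> x n = y \<and> (\<forall>i<n. x i < x (Suc i))}"
    for y :: real
  have ext: "s + \<bar>\<psi> z - \<psi> y\<bar> \<in> W z" if "s \<in> W y" "y < z" for s y z
  proof -
    from that(1) obtain n x where x: "x 0 = 0" "x n = y" "\<forall>i<n. x i < x (Suc i)"
      and s: "s = (\<Sum>i<n. \<bar>\<psi> (x (Suc i)) - \<psi> (x i)\<bar>)" unfolding W_def by blast
    define x' where "x' = x(Suc n := z)"
    have "(\<Sum>i<Suc n. \<bar>\<psi> (x' (Suc i)) - \<psi> (x' i)\<bar>) = s + \<bar>\<psi> z - \<psi> y\<bar>"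
      using x by (simp add: s x'_def)
    moreover have "x' 0 = 0" "x' (Suc n) = z" "\<forall>i<Suc n. x' i < x' (Suc i)"
      using x that(2) by (auto simp: x'_def less_Suc_eq)
    ultimately show ?thesis
      unfolding W_def mem_Collect_eq by (intro exI[of _ "Suc n"] exI[of _ x']) (simp del: sum.lessThan_Suc)
  qed
  have W0: "0 \<in> W 0"
    unfolding W_def by (rule CollectI, rule exI[of _ 0], rule exI[of _ "\<lambda>_. 0"]) simp
  have ne: "W y \<noteq> {}" if "0 \<le> y" for y
    using W0 ext[OF W0, of y] that by (cases "y = 0") auto
  have bound: "s \<le> B" if s: "s \<in> W y" and y: "y \<le> 1" for s y
  proof -
    have "s' \<le> B" if "s' \<in> W 1" for s' using that B unfolding W_def by blast
    then show ?thesis using ext[OF s, of 1] s y by (cases "y = 1") force+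
  qed
  have bdd: "bdd_above (W y)" if "y \<le> 1" for y using bound[OF _ that] by (auto intro!: bdd_aboveI)
  define V where "V y = Sup (W y)" for y
  have V_step: "V y + \<bar>\<psi> z - \<psi> y\<bar> \<le> V z" if "0 \<le> y" "y \<le> z" "z \<le> 1" for y z
  proof (cases "y = z")
    case False
    have "V y \<le> V z - \<bar>\<psi> z - \<psi> y\<bar>"
      unfolding V_def
    proof (rule cSup_least[OF ne[OF that(1)]])
      fix s assume "s \<in> W y"
      then have "s + \<bar>\<psi> z - \<psi> y\<bar> \<in> W z" using False that by (intro ext) auto
      then have "s + \<bar>\<psi> z - \<psi> y\<bar> \<le> Sup (W z)" by (rule cSup_upper[OF _ bdd[OF that(3)]])
      then show "s \<le> Sup (W z) - \<bar>\<psi> z - \<psi> y\<bar>" by simp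
    qed
    then show ?thesis by simp
  qed simp
  have V0: "0 \<le> V 0" unfolding V_def by (rule cSup_upper[OF W0 bdd]) simp
  have p: "incr_nonneg (\<lambda>y. V y + \<bar>\<psi> 0\<bar>)"
    using V_step V0 by (intro incr_nonnegI) (fastforce, simp)
  have q: "incr_nonneg (\<lambda>y. V y + \<bar>\<psi> 0\<bar> - \<psi> y)"
  proof (rule incr_nonnegI)
    fix x y :: real assume "0 \<le> x" "x \<le> y" "y \<le> 1"
    from V_step[OF this] show "V x + \<bar>\<psi> 0\<bar> - \<psi> x \<le> V y + \<bar>\<psi> 0\<bar> - \<psi> y" by linarith
  qed (use V0 in linarith)
  show ?thesis by (rule incr_diffI[OF p q]) simp
qed

lemma char_centred_normal:
  assumes "0 \<le> v"
  shows "char (centred_normal v) s = complex_of_real (exp (- v * s\<^sup>2 / 2))"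
proof (cases "v = 0")
  case True
  then show ?thesis by (simp add: centred_normal_def char_def integral_return)
next
  case False
  define \<sigma> where "\<sigma> = sqrt v"
  have \<sigma>: "0 < \<sigma>" "\<sigma>\<^sup>2 = v" using False assms by (auto simp: \<sigma>_def)
  have "char (centred_normal v) s = (\<integral>x. normal_density 0 \<sigma> x *\<^sub>R iexp (s * x) \<partial>lborel)"
    using False by (simp add: char_def centred_normal_def \<sigma>_def integral_density)
  also have "\<dots> = \<bar>\<sigma>\<bar> *\<^sub>R (\<integral>x. normal_density 0 \<sigma> (0 + \<sigma> * x) *\<^sub>R iexp (s * (0 + \<sigma> * x)) \<partial>lborel)"
    using \<sigma> by (intro lborel_integral_real_affine) simp
  also have "\<dots> = (\<integral>x. \<bar>\<sigma>\<bar> *\<^sub>R (normal_density 0 \<sigma> (0 + \<sigma> * x) *\<^sub>R iexp (s * (0 + \<sigma> * x))) \<partial>lborel)"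
    by (rule integral_scaleR_right[symmetric])
  also have "\<dots> = (\<integral>x. std_normal_density x *\<^sub>R iexp ((s * \<sigma>) * x) \<partial>lborel)"
  proof (intro Bochner_Integration.integral_cong refl)
    fix x
    have "\<bar>\<sigma>\<bar> * normal_density 0 \<sigma> (0 + \<sigma> * x) = std_normal_density x"
      using \<sigma>(1) by (simp add: normal_density_def real_sqrt_mult power_mult_distrib field_simps)
    then show "\<bar>\<sigma>\<bar> *\<^sub>R (normal_density 0 \<sigma> (0 + \<sigma> * x) *\<^sub>R iexp (s * (0 + \<sigma> * x)))
      = std_normal_density x *\<^sub>R iexp ((s * \<sigma>) * x)"
      by (simp only: scaleR_scaleR) (simp add: mult_ac)
  qed
  also have "\<dots> = char std_normal_distribution (s * \<sigma>)"
    by (simp add: char_def integral_density)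
  also have "\<dots> = complex_of_real (exp (- v * s\<^sup>2 / 2))"
    using \<sigma> by (simp add: char_std_normal_distribution power_mult_distrib mult.commute)
  finally show ?thesis .
qed

lemma real_distribution_centred_normal:
  assumes "0 \<le> v"
  shows "real_distribution (centred_normal v)"
proof (cases "v = 0")
  case True
  then show ?thesis
    by (auto simp: centred_normal_def real_distribution_def real_distribution_axioms_def intro!: prob_space_return)
next
  case False
  then show ?thesis using assms
    by (auto simp: centred_normal_def real_distribution_def real_distribution_axioms_def intro!: prob_space_normal_density)
qed

section \<open>Variance and central limit theorem from a Poisson equation\<close>

text \<open>The algebra behind the perturbation argument. With \<open>e = exp(itc)\<close> the left-hand side is the
  error made when the product of \<open>e\<close> with the perturbed density \<open>r + ita + t\<^sup>2b\<close> is replaced by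
  its second-order expansion in \<open>t\<close>; the right-hand side displays it as terms of third order.\<close>
lemma perturbed_density_expansion:
  fixes t r a b c e :: complex
  shows "e * (r + \<i> * t * a + t\<^sup>2 * b) - (r + \<i> * t * (a + c * r) + t\<^sup>2 * (b - (a * c + c\<^sup>2 * r / 2)))
    = (e - (1 + \<i> * (t * c) - (t * c)\<^sup>2 / 2)) * (r + \<i> * t * a + t\<^sup>2 * b)
      + (\<i> * t ^ 3 * c * b - \<i> * t ^ 3 * c\<^sup>2 * a / 2 - t ^ 4 * c\<^sup>2 * b / 2)"
  by (simp add: algebra_simps power2_eq_square power3_eq_cube power4_eq_xxxx)

lemma perturbed_density_remainder:
  fixes t r a b c M :: real
  assumes t: "\<bar>t\<bar> \<le> 1" and M: "\<bar>r\<bar> \<le> M" "\<bar>a\<bar> \<le> M" "\<bar>b\<bar> \<le> M" "\<bar>c\<bar> \<le> M"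
  shows "norm (iexp (t * c) * (of_real r + \<i> * of_real t * of_real a + (of_real t)\<^sup>2 * of_real b)
      - (of_real r + \<i> * of_real t * of_real (a + c * r) + (of_real t)\<^sup>2 * of_real (b - (a * c + c\<^sup>2 * r / 2))))
    \<le> (3 * M ^ 4 + M\<^sup>2 + M ^ 3) * \<bar>t\<bar> ^ 3"
proof -
  define f where "f = complex_of_real r + \<i> * of_real t * of_real a + (of_real t)\<^sup>2 * of_real b"
  define q where "q = iexp (t * c) - (1 + \<i> * of_real (t * c) - (of_real (t * c))\<^sup>2 / 2)"
  define z where "z = \<i> * of_real t ^ 3 * of_real c * of_real b - \<i> * of_real t ^ 3 * (of_real c)\<^sup>2 * of_real a / 2
    - of_real t ^ 4 * (of_real c)\<^sup>2 * complex_of_real b / 2"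
  have M0: "0 \<le> M" using M by linarith
  have t2: "\<bar>t\<bar>\<^sup>2 \<le> 1" using power_le_one[of "\<bar>t\<bar>" 2] t by simp
  have t4: "\<bar>t\<bar> ^ 4 \<le> \<bar>t\<bar> ^ 3" using t by (intro power_decreasing) auto
  have "norm f \<le> \<bar>r\<bar> + \<bar>t\<bar> * \<bar>a\<bar> + \<bar>t\<bar>\<^sup>2 * \<bar>b\<bar>"
    unfolding f_def by (intro order_trans[OF norm_triangle_ineq] add_mono) (auto simp: norm_mult norm_power)
  also have "\<dots> \<le> M + 1 * M + 1 * M"
    by (intro add_mono mult_mono M t t2) (use M0 in auto)
  finally have f: "norm f \<le> 3 * M" by simp
  have "norm q \<le> \<bar>t * c\<bar> ^ 3"
  proof -
    have "q = iexp (t * c) - (\<Sum>k\<le>2. (\<i> * of_real (t * c)) ^ k / fact k)"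
      by (simp add: q_def numeral_2_eq_2 power2_eq_square algebra_simps)
    then have "norm q \<le> \<bar>t * c\<bar> ^ Suc 2 / fact (Suc 2)" using iexp_approx1[of "t * c" 2] by simp
    also have "\<dots> \<le> \<bar>t * c\<bar> ^ 3" by (simp add: fact_numeral field_simps)
    finally show ?thesis .
  qed
  also have "\<dots> \<le> M ^ 3 * \<bar>t\<bar> ^ 3"
    unfolding abs_mult power_mult_distrib mult.commute[of "\<bar>t\<bar> ^ 3"]
    by (intro mult_right_mono power_mono M) auto
  finally have q: "norm q \<le> M ^ 3 * \<bar>t\<bar> ^ 3" .
  have "norm z \<le> \<bar>t\<bar> ^ 3 * (\<bar>c\<bar> * \<bar>b\<bar>) + \<bar>t\<bar> ^ 3 * (\<bar>c\<bar>\<^sup>2 * \<bar>a\<bar> / 2) + \<bar>t\<bar> ^ 4 * (\<bar>c\<bar>\<^sup>2 * \<bar>b\<bar> / 2)"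
    unfolding z_def
    by (intro order_trans[OF norm_triangle_ineq4] add_mono) (auto simp: norm_mult norm_power norm_divide)
  also have "\<dots> \<le> \<bar>t\<bar> ^ 3 * (M * M) + \<bar>t\<bar> ^ 3 * (M\<^sup>2 * M / 2) + \<bar>t\<bar> ^ 3 * (M\<^sup>2 * M / 2)"
    by (intro add_mono mult_mono divide_right_mono power_mono M t4) (use M0 in auto)
  also have "\<dots> = (M\<^sup>2 + M ^ 3) * \<bar>t\<bar> ^ 3" by (simp add: power2_eq_square power3_eq_cube algebra_simps)
  finally have z: "norm z \<le> (M\<^sup>2 + M ^ 3) * \<bar>t\<bar> ^ 3" .
  have "norm (q * f + z) \<le> (M ^ 3 * \<bar>t\<bar> ^ 3) * (3 * M) + (M\<^sup>2 + M ^ 3) * \<bar>t\<bar> ^ 3"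
    by (intro order_trans[OF norm_triangle_ineq] add_mono z)
       (unfold norm_mult, intro mult_mono q f, use M0 in auto)
  also have "\<dots> = (3 * M ^ 4 + M\<^sup>2 + M ^ 3) * \<bar>t\<bar> ^ 3"
    by (simp add: power3_eq_cube power4_eq_xxxx algebra_simps)
  finally show ?thesis
    using perturbed_density_expansion[of "iexp (t * c)" "of_real r" "of_real t" "of_real a" "of_real b" "of_real c"]
    by (simp add: q_def f_def z_def)
qed

text \<open>Here \<open>c\<close> is an observable of mean zero for the invariant measure, and \<open>a\<close> is, up to a
  multiple of \<open>inv_density\<close>, the series of the iterates \<open>transfer ^^ k\<close> of \<open>c * inv_density\<close> over
  \<open>k \<ge> 1\<close>. That multiple does not influence the variance, because \<open>c\<close> is centred.\<close>
locale poisson_solution =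
  fixes c a :: "real \<Rightarrow> real"
  assumes c: "incr_diff c" and a: "incr_diff a"
    and centred: "unit_mean (\<lambda>x. c x * inv_density x) = 0"
    and poisson: "\<And>x. x \<in> {0..1} \<Longrightarrow> a x - transfer a x = transfer (\<lambda>x. c x * inv_density x) x"
begin

text \<open>The Green--Kubo formula, in which the series of correlations has been summed into \<open>a\<close>.\<close>
definition variance :: real where
  "variance = unit_mean (\<lambda>x. (c x)\<^sup>2 * inv_density x) + 2 * unit_mean (\<lambda>x. a x * c x)"

definition birkhoff :: "nat \<Rightarrow> real \<Rightarrow> real" where
  "birkhoff n x = (\<Sum>i<n. c ((T ^^ i) x))"

lemma birkhoff_Suc: "birkhoff (Suc n) x = c x + birkhoff n (T x)"
  unfolding birkhoff_def by (simp add: sum.lessThan_Suc_shift funpow_swap1 del: sum.lessThan_Suc)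

lemma birkhoff_measurable: "birkhoff n \<in> borel_measurable unit_leb"
  unfolding birkhoff_def [abs_def]
  by (intro borel_measurable_sum measurable_compose[OF measurable_T_iterate incr_diff_measurable[OF c]])

lemma birkhoff_bounded: "\<exists>B. \<forall>x\<in>{0..1}. \<bar>birkhoff n x\<bar> \<le> B"
proof -
  obtain B where B: "\<And>x. x \<in> {0..1} \<Longrightarrow> \<bar>c x\<bar> \<le> B" using incr_diff_bounded[OF c] by blast
  have "\<bar>birkhoff n x\<bar> \<le> (\<Sum>i<n. B)" if "x \<in> {0..1}" for x
    unfolding birkhoff_def using B T_iterate_in_unit[OF that]
    by (intro order_trans[OF sum_abs] sum_mono) blast
  then show ?thesis by blast
qed

definition corr :: "nat \<Rightarrow> real" where
  "corr n = (\<integral>x. (transfer ^^ n) a x * c x \<partial>unit_leb)"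

lemma corr_decay: "\<exists>B. \<forall>n. \<bar>corr n\<bar> \<le> B * (14/15) ^ n"
proof -
  obtain C where C: "\<And>x. x \<in> {0..1} \<Longrightarrow> \<bar>c x\<bar> \<le> C" using incr_diff_bounded[OF c] by blast
  obtain B where "\<And>n. \<bar>(\<integral>x. (transfer ^^ n) a x * c x \<partial>unit_leb)
    - unit_mean a * (\<integral>x. inv_density x * c x \<partial>unit_leb)\<bar> \<le> B * (14/15) ^ n"
    by (rule transfer_iterate_pairing[OF a incr_diff_measurable[OF c] C]) (assumption, rule that)
  then show ?thesis using centred by (auto simp: corr_def mult.commute)
qed

definition second_moment :: "nat \<Rightarrow> real" where
  "second_moment n = (\<integral>x. inv_density x * (birkhoff n x)\<^sup>2 \<partial>unit_leb)"

lemma transfer_iterate_poisson: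
  assumes "x \<in> {0..1}"
  shows "(transfer ^^ Suc i) (\<lambda>x. c x * inv_density x) x = (transfer ^^ i) a x - (transfer ^^ Suc i) a x"
proof -
  have "(transfer ^^ Suc i) (\<lambda>x. c x * inv_density x) x = (transfer ^^ i) (transfer (\<lambda>x. c x * inv_density x)) x"
    by (simp add: funpow_swap1)
  also have "\<dots> = (transfer ^^ i) (\<lambda>x. a x - transfer a x) x"
    by (rule transfer_iterate_cong) (use poisson assms in auto)
  finally show ?thesis by (simp add: transfer_iterate_diff funpow_swap1)
qed

text \<open>The correlation of \<open>c\<close> with its \<open>(i+1)\<close>-st iterate is \<open>corr i - corr (Suc i)\<close> by
  the Poisson equation, so the sum telescopes.\<close>
lemma integral_cross_term:
  "(\<integral>x. (c x * inv_density x) * birkhoff n (T x) \<partial>unit_leb) = corr 0 - corr n"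
proof -
  obtain C where C: "0 \<le> C" "\<And>x. x \<in> {0..1} \<Longrightarrow> \<bar>c x\<bar> \<le> C" using incr_diff_bounded[OF c] by blast
  have cr: "incr_diff (\<lambda>x. c x * inv_density x)" by (intro incr_diff_mult c incr_diff_inv_density)
  have int: "integrable unit_leb (\<lambda>x. (c x * inv_density x) * c ((T ^^ Suc i) x))" for i
  proof -
    obtain K where K: "0 \<le> K" "\<And>x. x \<in> {0..1} \<Longrightarrow> \<bar>c x * inv_density x\<bar> \<le> K" using incr_diff_bounded[OF cr] by blast
    show ?thesis
    proof (rule bounded_measurable_integrable[of _ "K * C"])
      show "(\<lambda>x. c x * inv_density x * c ((T ^^ Suc i) x)) \<in> borel_measurable unit_leb"
        by (intro borel_measurable_times incr_diff_measurable c incr_diff_inv_density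
            measurable_compose[OF measurable_T_iterate])
      show "norm (c x * inv_density x * c ((T ^^ Suc i) x)) \<le> K * C" if "x \<in> {0..1}" for x
        unfolding real_norm_def abs_mult[of "c x * inv_density x" "c ((T ^^ Suc i) x)"]
        by (intro mult_mono K C that T_iterate_in_unit) simp
    qed
  qed
  have term_eq: "(\<integral>x. (c x * inv_density x) * c ((T ^^ Suc i) x) \<partial>unit_leb) = corr i - corr (Suc i)" for i
  proof -
    have "(\<integral>x. (c x * inv_density x) * c ((T ^^ Suc i) x) \<partial>unit_leb)
      = (\<integral>x. (transfer ^^ Suc i) (\<lambda>x. c x * inv_density x) x * c x \<partial>unit_leb)"
      using integral_T_iterate_transfer[OF cr incr_diff_measurable[OF c], of C "Suc i"] C by simp
    also have "\<dots> = (\<integral>x. (transfer ^^ i) a x * c x - (transfer ^^ Suc i) a x * c x \<partial>unit_leb)"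
      by (intro Bochner_Integration.integral_cong refl)
         (simp only: transfer_iterate_poisson space_unit_leb left_diff_distrib)
    also have "\<dots> = corr i - corr (Suc i)"
      unfolding corr_def
      by (intro Bochner_Integration.integral_diff incr_diff_integrable incr_diff_mult c incr_diff_transfer_iterate a)
    finally show ?thesis .
  qed
  have "(\<integral>x. (c x * inv_density x) * birkhoff n (T x) \<partial>unit_leb)
    = (\<integral>x. (\<Sum>i<n. (c x * inv_density x) * c ((T ^^ Suc i) x)) \<partial>unit_leb)"
    unfolding birkhoff_def by (simp add: sum_distrib_left funpow_swap1)
  also have "\<dots> = (\<Sum>i<n. corr i - corr (Suc i))"
    by (subst Bochner_Integration.integral_sum) (auto simp only: int term_eq)
  also have "\<dots> = corr 0 - corr n"
    using sum_lessThan_telescope'[of corr n] by simp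
  finally show ?thesis .
qed

text \<open>Expand the square of \<open>birkhoff (Suc n) = c + birkhoff n \<circ> T\<close>; the last square has the same
  integral as \<open>(birkhoff n)\<^sup>2\<close> by invariance, and the cross term is the preceding lemma.\<close>
lemma second_moment_Suc: "second_moment (Suc n) = second_moment n + (variance - 2 * corr n)"
proof -
  obtain B where B: "\<And>x. x \<in> {0..1} \<Longrightarrow> \<bar>birkhoff n x\<bar> \<le> B" using birkhoff_bounded[of n] by blast
  have B2: "norm ((birkhoff n x)\<^sup>2) \<le> B\<^sup>2" if "x \<in> {0..1}" for x
    using B[OF that] by (simp add: abs_le_square_iff[symmetric])
  have TB: "(\<lambda>x. birkhoff n (T x)) \<in> borel_measurable unit_leb"
    by (rule measurable_compose[OF measurable_T_unit birkhoff_measurable])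
  note TB[measurable] incr_diff_measurable[OF c, measurable] inv_density_measurable[measurable]
  obtain K where K: "\<And>x. x \<in> {0..1} \<Longrightarrow> \<bar>c x * inv_density x\<bar> \<le> K" 
    using incr_diff_bounded[OF incr_diff_mult[OF c incr_diff_inv_density]] by blast
  obtain R where R: "\<And>x. x \<in> {0..1} \<Longrightarrow> \<bar>inv_density x\<bar> \<le> R" 
    using incr_diff_bounded[OF incr_diff_inv_density] by blast
  have i1: "integrable unit_leb (\<lambda>x. (c x)\<^sup>2 * inv_density x)"
    unfolding power2_eq_square by (intro incr_diff_integrable incr_diff_mult c incr_diff_inv_density)
  have i2: "integrable unit_leb (\<lambda>x. (c x * inv_density x) * birkhoff n (T x))"
  proof (rule bounded_measurable_integrable[of _ "K * B"])
    show "norm (c x * inv_density x * birkhoff n (T x)) \<le> K * B" if "x \<in> {0..1}" for x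
      unfolding real_norm_def abs_mult[of "c x * inv_density x" "birkhoff n (T x)"]
      by (intro mult_mono K B that T_in_unit order_trans[OF abs_ge_zero K[OF that]]) simp
  qed measurable
  have i3: "integrable unit_leb (\<lambda>x. inv_density x * (birkhoff n (T x))\<^sup>2)"
  proof (rule bounded_measurable_integrable[of _ "R * B\<^sup>2"])
    show "norm (inv_density x * (birkhoff n (T x))\<^sup>2) \<le> R * B\<^sup>2" if "x \<in> {0..1}" for x
      unfolding norm_mult[of "inv_density x"] real_norm_def[of "inv_density x"]
      by (intro mult_mono R B2 that T_in_unit order_trans[OF abs_ge_zero R[OF that]]) simp
  qed measurable
  have "second_moment (Suc n) = (\<integral>x. (c x)\<^sup>2 * inv_density x + 2 * ((c x * inv_density x) * birkhoff n (T x))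
      + inv_density x * (birkhoff n (T x))\<^sup>2 \<partial>unit_leb)"
    unfolding second_moment_def birkhoff_Suc by (simp add: power2_eq_square algebra_simps)
  also have "\<dots> = unit_mean (\<lambda>x. (c x)\<^sup>2 * inv_density x) + 2 * (corr 0 - corr n)
      + (\<integral>x. inv_density x * (birkhoff n (T x))\<^sup>2 \<partial>unit_leb)"
    using i1 i2 i3 by (simp add: integral_cross_term[symmetric])
  also have "(\<integral>x. inv_density x * (birkhoff n (T x))\<^sup>2 \<partial>unit_leb)
      = (\<integral>x. transfer inv_density x * (birkhoff n x)\<^sup>2 \<partial>unit_leb)"
    using integral_T_transfer[OF incr_diff_inv_density, of "\<lambda>x. (birkhoff n x)\<^sup>2" "B\<^sup>2"] B2 birkhoff_measurable[of n]
    by simp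
  also have "\<dots> = second_moment n"
    unfolding second_moment_def
    by (intro Bochner_Integration.integral_cong refl) (simp add: transfer_inv_density)
  finally show ?thesis by (simp add: variance_def corr_def)
qed

lemma second_moment_asymp: "(\<lambda>n. 1 / real n * second_moment n) \<longlonglongrightarrow> variance"
proof -
  obtain B where B: "\<And>n. \<bar>corr n\<bar> \<le> B * (14/15) ^ n" using corr_decay by blast
  have sm: "second_moment n = real n * variance - 2 * (\<Sum>i<n. corr i)" for n
  proof (induction n)
    case (Suc n)
    then show ?case by (simp add: second_moment_Suc algebra_simps)
  qed (simp add: second_moment_def birkhoff_def)
  have "summable corr"
    by (rule summable_comparison_test'[of "\<lambda>n. B * (14/15) ^ n" 0])
       (use B in \<open>auto intro!: summable_mult summable_geometric\<close>)
  then have "(\<lambda>n. \<Sum>i<n. corr i) \<longlonglongrightarrow> suminf corr" by (rule summable_LIMSEQ)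
  then have "(\<lambda>n. variance - 2 * (\<Sum>i<n. corr i) * (1 / real n)) \<longlonglongrightarrow> variance - 2 * suminf corr * 0"
    by (intro tendsto_intros lim_1_over_n)
  then have "(\<lambda>n. variance - 2 * (\<Sum>i<n. corr i) * (1 / real n)) \<longlonglongrightarrow> variance" by simp
  then show ?thesis
    by (rule Lim_transform_eventually)
       (use eventually_gt_at_top[of 0] in eventually_elim, simp add: sm field_simps)
qed

lemma second_moment_nonneg: "0 \<le> second_moment n"
  unfolding second_moment_def by (rule Bochner_Integration.integral_nonneg) (simp add: inv_density_nonneg)

lemma variance_nonneg: "0 \<le> variance"
  by (rule LIMSEQ_le_const[OF second_moment_asymp]) (simp add: second_moment_nonneg)

definition phase :: "real \<Rightarrow> nat \<Rightarrow> real \<Rightarrow> complex" where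
  "phase t n x = iexp (t * birkhoff n x)"

lemma phase_measurable: "phase t n \<in> borel_measurable unit_leb"
  unfolding phase_def [abs_def] using birkhoff_measurable[of n] by measurable

lemma norm_phase: "norm (phase t n x) = 1"
  unfolding phase_def by (simp add: norm_exp_i_times)

text \<open>For \<open>u = inv_density\<close> this is the characteristic function at \<open>t\<close> of the Birkhoff sum.\<close>
definition paired :: "real \<Rightarrow> nat \<Rightarrow> (real \<Rightarrow> real) \<Rightarrow> complex" where
  "paired t n u = (\<integral>x. u x *\<^sub>R phase t n x \<partial>unit_leb)"

lemma paired_integrable:
  assumes "incr_diff u"
  shows "integrable unit_leb (\<lambda>x. u x *\<^sub>R phase t n x)" "integrable unit_leb (\<lambda>x. u x *\<^sub>R phase t n (T x))"
proof -
  obtain B where B: "\<And>x. x \<in> {0..1} \<Longrightarrow> \<bar>u x\<bar> \<le> B" using incr_diff_bounded[OF assms] by blast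
  have "(\<lambda>x. u x *\<^sub>R phase t n x) \<in> borel_measurable unit_leb" "(\<lambda>x. u x *\<^sub>R phase t n (T x)) \<in> borel_measurable unit_leb"
    by (intro borel_measurable_scaleR incr_diff_measurable assms phase_measurable
        measurable_compose[OF measurable_T_unit phase_measurable])+
  note meas = this
  show "integrable unit_leb (\<lambda>x. u x *\<^sub>R phase t n x)"
    by (rule bounded_measurable_integrable[OF meas(1), of B]) (simp add: norm_phase B)
  show "integrable unit_leb (\<lambda>x. u x *\<^sub>R phase t n (T x))"
    by (rule bounded_measurable_integrable[OF meas(2), of B]) (simp add: norm_phase B)
qed

lemma paired_transfer:
  "incr_diff u \<Longrightarrow> (\<integral>x. u x *\<^sub>R phase t n (T x) \<partial>unit_leb) = paired t n (transfer u)"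
  unfolding paired_def
  by (rule integral_T_transfer[where B = 1]) (auto simp: phase_measurable norm_phase)

lemma norm_paired_le:
  assumes "incr_diff u" "\<And>x. x \<in> {0..1} \<Longrightarrow> \<bar>u x\<bar> \<le> B"
  shows "norm (paired t n u) \<le> B"
proof -
  have "norm (paired t n u) \<le> unit_mean (\<lambda>x. norm (u x *\<^sub>R phase t n x))"
    unfolding paired_def by (rule integral_norm_bound)
  also have "\<dots> \<le> unit_mean (\<lambda>_. B)"
    by (rule integral_mono) (use assms incr_diff_integrable[OF assms(1)] in \<open>auto simp: norm_phase\<close>)
  finally have "norm (paired t n u) \<le> unit_mean (\<lambda>_. B)" .
  then show ?thesis by (simp add: unit_leb.prob_space[simplified])
qed

lemma paired_cong: "(\<And>x. x \<in> {0..1} \<Longrightarrow> u x = v x) \<Longrightarrow> paired t n u = paired t n v"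
  unfolding paired_def by (intro Bochner_Integration.integral_cong) auto

lemma paired_diff_cmult:
  assumes "incr_diff u" "incr_diff v"
  shows "paired t n (\<lambda>x. u x - r * v x) = paired t n u - of_real r * paired t n v"
proof -
  have "paired t n (\<lambda>x. u x - r * v x)
    = (\<integral>x. u x *\<^sub>R phase t n x - of_real r * (v x *\<^sub>R phase t n x) \<partial>unit_leb)"
    unfolding paired_def
    by (intro Bochner_Integration.integral_cong refl) (simp add: scaleR_conv_of_real algebra_simps)
  also have "\<dots> = paired t n u - of_real r * paired t n v"
    unfolding paired_def using paired_integrable(1)[OF assms(1)] paired_integrable(1)[OF assms(2)]
    by (simp del: mult_scaleR_right)
  finally show ?thesis .
qed

lemma phase_Suc: "phase t (Suc n) x = iexp (t * c x) * phase t n (T x)"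
  unfolding phase_def birkhoff_Suc by (simp add: exp_add[symmetric] algebra_simps)

lemma paired_0: "paired t 0 u = of_real (unit_mean u)"
  unfolding paired_def by (simp add: phase_def birkhoff_def scaleR_conv_of_real)

text \<open>The coefficient of \<open>t\<^sup>2\<close> in the perturbed density. It has to solve another Poisson equation,
  whose right-hand side has mean zero exactly because \<open>variance\<close> is given by the Green--Kubo
  formula.\<close>
lemma second_order_corrector:
  obtains b where "incr_diff b"
    "\<And>x. x \<in> {0..1} \<Longrightarrow>
       transfer (\<lambda>x. b x - (a x * c x + (c x)\<^sup>2 * inv_density x / 2)) x = b x - variance / 2 * inv_density x"
proof -
  define g where "g x = a x * c x + 1/2 * (c x * c x * inv_density x)" for x
  define h where "h x = variance / 2 * inv_density x - transfer g x" for x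
  have m1: "incr_diff (\<lambda>x. a x * c x)" by (intro incr_diff_mult a c)
  have m2: "incr_diff (\<lambda>x. c x * c x * inv_density x)" by (intro incr_diff_mult c incr_diff_inv_density)
  have g: "incr_diff g"
    unfolding g_def by (intro incr_diff_add incr_diff_cmult m1 m2)
  have "unit_mean g = variance / 2"
    unfolding g_def variance_def using incr_diff_integrable[OF m1] incr_diff_integrable[OF m2]
    by (simp add: power2_eq_square)
  then have "unit_mean (transfer g) = variance / 2" using transfer_mean[OF g] by simp
  then have h0: "unit_mean h = 0"
    unfolding h_def using incr_diff_integrable[OF incr_diff_inv_density] incr_diff_integrable[OF incr_diff_transfer[OF g]]
    by (simp add: inv_density_mean)
  have h: "incr_diff h"
    unfolding h_def by (intro incr_diff_diff incr_diff_cmult incr_diff_inv_density incr_diff_transfer g)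
  obtain b where b: "incr_diff b" "\<And>x. x \<in> {0..1} \<Longrightarrow> b x - transfer b x = h x"
    by (rule poisson_equation[OF h h0]) blast
  show ?thesis
  proof (rule that[OF b(1)])
    fix x :: real assume x: "x \<in> {0..1}"
    have "g = (\<lambda>x. a x * c x + (c x)\<^sup>2 * inv_density x / 2)"
      by (simp add: g_def fun_eq_iff power2_eq_square)
    then have "transfer (\<lambda>x. b x - (a x * c x + (c x)\<^sup>2 * inv_density x / 2)) x = transfer b x - transfer g x"
      by (simp add: transfer_diff)
    then show "transfer (\<lambda>x. b x - (a x * c x + (c x)\<^sup>2 * inv_density x / 2)) x = b x - variance / 2 * inv_density x"
      using b(2)[OF x] by (simp add: h_def)
  qed
qed

text \<open>The function \<open>inv_density + ita + t\<^sup>2b\<close> is an approximate eigenfunction of the transfer operator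
  twisted by \<open>exp(itc)\<close>, with eigenvalue \<open>1 - variance * t\<^sup>2 / 2\<close> and an error of order
  \<open>t\<^sup>3\<close>. The twisted operator does not increase the \<open>L\<^sup>1\<close> norm, so after \<open>n\<close>
  iterations the errors add up to at most \<open>n * \<bar>t\<bar>\<^sup>3\<close>. For \<open>t\<close> of order
  \<open>1 / sqrt n\<close> this tends to zero.\<close>
lemma paired_inv_density_asymp:
  "\<exists>K. \<forall>t n. \<bar>t\<bar> \<le> 1 \<longrightarrow> variance * t\<^sup>2 \<le> 2 \<longrightarrow>
     norm (paired t n inv_density - of_real ((1 - variance * t\<^sup>2 / 2) ^ n)) \<le> K * (real n * \<bar>t\<bar> ^ 3 + \<bar>t\<bar>)"
proof -
  obtain b where b: "incr_diff b" and Lb: "\<And>x. x \<in> {0..1} \<Longrightarrow>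
       transfer (\<lambda>x. b x - (a x * c x + (c x)\<^sup>2 * inv_density x / 2)) x = b x - variance / 2 * inv_density x"
    by (rule second_order_corrector) blast
  obtain B1 where B1: "\<And>x. x \<in> {0..1} \<Longrightarrow> \<bar>a x\<bar> \<le> B1" using incr_diff_bounded[OF a] by blast
  obtain B2 where B2: "\<And>x. x \<in> {0..1} \<Longrightarrow> \<bar>b x\<bar> \<le> B2" using incr_diff_bounded[OF b] by blast
  obtain B3 where B3: "\<And>x. x \<in> {0..1} \<Longrightarrow> \<bar>c x\<bar> \<le> B3" using incr_diff_bounded[OF c] by blast
  obtain B4 where B4: "\<And>x. x \<in> {0..1} \<Longrightarrow> \<bar>inv_density x\<bar> \<le> B4"
    using incr_diff_bounded[OF incr_diff_inv_density] by blast
  define M where "M = Max {B1, B2, B3, B4}"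
  have M: "\<bar>a x\<bar> \<le> M" "\<bar>b x\<bar> \<le> M" "\<bar>c x\<bar> \<le> M" "\<bar>inv_density x\<bar> \<le> M" if "x \<in> {0..1}" for x
    using B1[OF that] B2[OF that] B3[OF that] B4[OF that] by (auto simp: M_def)
  have M0: "0 \<le> M" using M(1)[of 0] by simp
  define a1 where "a1 x = a x + c x * inv_density x" for x
  define b1 where "b1 x = b x - (a x * c x + (c x)\<^sup>2 * inv_density x / 2)" for x
  have id: "incr_diff inv_density" by (rule incr_diff_inv_density)
  have a1: "incr_diff a1" unfolding a1_def by (intro incr_diff_add incr_diff_mult a c id)
  have b1: "incr_diff b1"
  proof -
    have "incr_diff (\<lambda>x. b x - (a x * c x + 1/2 * (c x * c x * inv_density x)))"
      by (intro incr_diff_diff incr_diff_add incr_diff_cmult incr_diff_mult a b c id)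
    then show ?thesis by (simp add: b1_def[abs_def] power2_eq_square)
  qed
  have La1: "transfer a1 x = a x" if "x \<in> {0..1}" for x
    using poisson[OF that] by (simp add: a1_def[abs_def] transfer_add)
  \<comment> \<open>the pairing with the approximate eigenfunction\<close>
  define G where "G t n = paired t n inv_density + \<i> * of_real t * paired t n a + (of_real t)\<^sup>2 * paired t n b" for t n
  have factor: "(R * (E * P) + \<i> * s * (A * (E * P)) + s\<^sup>2 * (B * (E * P)))
      - (R * P + \<i> * s * (A' * P) + s\<^sup>2 * (B' * P))
      = (E * (R + \<i> * s * A + s\<^sup>2 * B) - (R + \<i> * s * A' + s\<^sup>2 * B')) * P"
    for R E P A B A' B' s :: complex by (simp add: algebra_simps)
  define K0 where "K0 = 3 * M ^ 4 + M\<^sup>2 + M ^ 3"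
  define K1 where "K1 = K0 + variance * M"
  have step: "norm (G t (Suc n) - of_real (1 - variance * t\<^sup>2 / 2) * G t n) \<le> K1 * \<bar>t\<bar> ^ 3" if t: "\<bar>t\<bar> \<le> 1" for t n
  proof -
    \<comment> \<open>the main part of \<open>G t (Suc n)\<close>, after the weight \<open>iexp (t * c x)\<close> has been expanded\<close>
    define H where "H = paired t n inv_density + \<i> * of_real t * paired t n a
      + (of_real t)\<^sup>2 * (paired t n b - of_real (variance / 2) * paired t n inv_density)"
    note iS = paired_integrable(1)[of _ t "Suc n"] and iT = paired_integrable(2)[of _ t n]
    have GS: "G t (Suc n) = (\<integral>x. inv_density x *\<^sub>R phase t (Suc n) x + \<i> * of_real t * (a x *\<^sub>R phase t (Suc n) x)
        + (of_real t)\<^sup>2 * (b x *\<^sub>R phase t (Suc n) x) \<partial>unit_leb)"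
      unfolding G_def paired_def using iS[OF id] iS[OF a] iS[OF b] by (simp del: mult_scaleR_right)
    have "H = paired t n (transfer inv_density) + \<i> * of_real t * paired t n (transfer a1)
      + (of_real t)\<^sup>2 * paired t n (transfer b1)"
      unfolding H_def paired_diff_cmult[OF b id, symmetric]
      using paired_cong[of "transfer inv_density" inv_density t n] paired_cong[of "transfer a1" a t n]
        paired_cong[of "transfer b1" "\<lambda>x. b x - variance / 2 * inv_density x" t n]
        transfer_inv_density La1 Lb
      by (simp add: b1_def[abs_def])
    also have "\<dots> = (\<integral>x. inv_density x *\<^sub>R phase t n (T x) + \<i> * of_real t * (a1 x *\<^sub>R phase t n (T x))
        + (of_real t)\<^sup>2 * (b1 x *\<^sub>R phase t n (T x)) \<partial>unit_leb)"
      unfolding paired_transfer[OF id, symmetric] paired_transfer[OF a1, symmetric] paired_transfer[OF b1, symmetric]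
      using iT[OF id] iT[OF a1] iT[OF b1] by (simp del: mult_scaleR_right)
    finally have HT: "H = (\<integral>x. inv_density x *\<^sub>R phase t n (T x) + \<i> * of_real t * (a1 x *\<^sub>R phase t n (T x))
        + (of_real t)\<^sup>2 * (b1 x *\<^sub>R phase t n (T x)) \<partial>unit_leb)" .
    define Q where "Q x = (inv_density x *\<^sub>R phase t (Suc n) x + \<i> * of_real t * (a x *\<^sub>R phase t (Suc n) x)
        + (of_real t)\<^sup>2 * (b x *\<^sub>R phase t (Suc n) x)) - (inv_density x *\<^sub>R phase t n (T x) + \<i> * of_real t * (a1 x *\<^sub>R phase t n (T x))
        + (of_real t)\<^sup>2 * (b1 x *\<^sub>R phase t n (T x)))" for x
    have intQ: "integrable unit_leb Q"
      unfolding Q_def using iS[OF id] iS[OF a] iS[OF b] iT[OF id] iT[OF a1] iT[OF b1]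
      by (intro Bochner_Integration.integrable_diff Bochner_Integration.integrable_add integrable_mult_right)
    have GHQ: "G t (Suc n) - H = (\<integral>x. Q x \<partial>unit_leb)"
      unfolding GS HT Q_def using iS[OF id] iS[OF a] iS[OF b] iT[OF id] iT[OF a1] iT[OF b1]
      by (intro Bochner_Integration.integral_diff[symmetric] Bochner_Integration.integrable_add integrable_mult_right)
    have "norm (\<integral>x. Q x \<partial>unit_leb) \<le> unit_mean (\<lambda>_. K0 * \<bar>t\<bar> ^ 3)"
    proof (rule order_trans[OF integral_norm_bound integral_mono])
      show "integrable unit_leb (\<lambda>x. norm (Q x))"
        by (rule Bochner_Integration.integrable_norm[OF intQ])
      fix x assume "x \<in> space unit_leb"
      then have x: "x \<in> {0..1}" by simp
      have "Q x = (iexp (t * c x) * (of_real (inv_density x) + \<i> * of_real t * of_real (a x) + (of_real t)\<^sup>2 * of_real (b x))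
      - (of_real (inv_density x) + \<i> * of_real t * of_real (a x + c x * inv_density x)
        + (of_real t)\<^sup>2 * of_real (b x - (a x * c x + (c x)\<^sup>2 * inv_density x / 2)))) * phase t n (T x)"
        unfolding Q_def phase_Suc scaleR_conv_of_real a1_def b1_def by (rule factor)
      then show "norm (Q x) \<le> K0 * \<bar>t\<bar> ^ 3"
        using perturbed_density_remainder[OF t M(4)[OF x] M(1)[OF x] M(2)[OF x] M(3)[OF x]]
        by (simp add: norm_mult norm_phase K0_def)
    qed simp
    then have GH: "norm (G t (Suc n) - H) \<le> K0 * \<bar>t\<bar> ^ 3" by (simp add: GHQ unit_leb.prob_space[simplified])
    define Z where "Z = of_real (variance * t\<^sup>2 / 2) * (\<i> * of_real t * paired t n a + (of_real t)\<^sup>2 * paired t n b)"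
    have HZ: "H - of_real (1 - variance * t\<^sup>2 / 2) * G t n = Z"
      unfolding H_def G_def Z_def by (simp add: field_simps)
    have "norm (\<i> * of_real t * paired t n a + (of_real t)\<^sup>2 * paired t n b) \<le> \<bar>t\<bar> * M + \<bar>t\<bar> * M"
    proof (intro order_trans[OF norm_triangle_ineq] add_mono)
      show "norm (\<i> * of_real t * paired t n a) \<le> \<bar>t\<bar> * M"
        using norm_paired_le[OF a M(1), of t n] by (simp add: norm_mult mult_left_mono)
      have "t\<^sup>2 \<le> \<bar>t\<bar>" using t by (metis abs_ge_zero mult_left_le power2_abs power2_eq_square)
      then show "norm ((of_real t)\<^sup>2 * paired t n b) \<le> \<bar>t\<bar> * M"
        using norm_paired_le[OF b M(2), of t n] by (auto simp: norm_mult norm_power intro!: mult_mono)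
    qed
    then have "norm Z \<le> (variance * t\<^sup>2 / 2) * (\<bar>t\<bar> * M + \<bar>t\<bar> * M)"
      unfolding Z_def norm_mult[of "of_real (variance * t\<^sup>2 / 2)"] norm_of_real using variance_nonneg
      by (intro mult_mono) auto
    also have "\<dots> = variance * M * \<bar>t\<bar> ^ 3"
      by (simp add: power3_eq_cube power2_eq_square algebra_simps abs_mult_self_eq)
    finally have "norm Z \<le> variance * M * \<bar>t\<bar> ^ 3" .
    then have "norm ((G t (Suc n) - H) + Z) \<le> K0 * \<bar>t\<bar> ^ 3 + variance * M * \<bar>t\<bar> ^ 3"
      using GH by (intro order_trans[OF norm_triangle_ineq] add_mono)
    then show ?thesis
      unfolding HZ[symmetric] K1_def by (simp add: algebra_simps)
  qed
  have K1: "0 \<le> K1" using M0 variance_nonneg by (simp add: K1_def K0_def)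
  have diff: "norm (paired t n inv_density - G t n) \<le> 2 * M * \<bar>t\<bar>" if t: "\<bar>t\<bar> \<le> 1" for t n
  proof -
    have "paired t n inv_density - G t n = - (\<i> * of_real t * paired t n a) - (of_real t)\<^sup>2 * paired t n b"
      by (simp add: G_def)
    also have "norm \<dots> \<le> \<bar>t\<bar> * M + \<bar>t\<bar> * M"
    proof (intro order_trans[OF norm_triangle_ineq4] add_mono)
      show "norm (- (\<i> * of_real t * paired t n a)) \<le> \<bar>t\<bar> * M"
        using norm_paired_le[OF a M(1), of t n] by (simp add: norm_mult mult_left_mono)
      have "t\<^sup>2 \<le> \<bar>t\<bar>" using t by (metis abs_ge_zero mult_left_le power2_abs power2_eq_square)
      then show "norm ((of_real t)\<^sup>2 * paired t n b) \<le> \<bar>t\<bar> * M"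
        using norm_paired_le[OF b M(2), of t n] by (auto simp: norm_mult norm_power intro!: mult_mono)
    qed
    finally show ?thesis by simp
  qed
  have iter: "norm (G t n - of_real ((1 - variance * t\<^sup>2 / 2) ^ n) * G t 0) \<le> real n * (K1 * \<bar>t\<bar> ^ 3)"
    if t: "\<bar>t\<bar> \<le> 1" "variance * t\<^sup>2 \<le> 2" for t n
  proof (induction n)
    case (Suc n)
    let ?q = "1 - variance * t\<^sup>2 / 2"
    have q: "\<bar>?q\<bar> \<le> 1" using t variance_nonneg by (auto simp: abs_le_iff)
    have "G t (Suc n) - of_real (?q ^ Suc n) * G t 0
      = (G t (Suc n) - of_real ?q * G t n) + of_real ?q * (G t n - of_real (?q ^ n) * G t 0)"
      by (simp add: right_diff_distrib)
    also have "norm \<dots> \<le> K1 * \<bar>t\<bar> ^ 3 + 1 * (real n * (K1 * \<bar>t\<bar> ^ 3))"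
      by (intro order_trans[OF norm_triangle_ineq] add_mono step[OF t(1)])
         (unfold norm_mult norm_of_real, intro mult_mono Suc q, use K1 in auto)
    finally show ?case by (simp add: algebra_simps)
  qed simp
  show ?thesis
  proof (intro exI[of _ "K1 + 4 * M"] allI impI)
    fix t :: real and n assume t: "\<bar>t\<bar> \<le> 1" "variance * t\<^sup>2 \<le> 2"
    let ?q = "1 - variance * t\<^sup>2 / 2"
    have q: "\<bar>?q\<bar> \<le> 1" using t variance_nonneg by (auto simp: abs_le_iff)
    have "norm (of_real (?q ^ n) * (G t 0 - paired t 0 inv_density)) \<le> 1 * (2 * M * \<bar>t\<bar>)"
      unfolding norm_mult norm_of_real power_abs
      by (intro mult_mono power_le_one) (use q diff[OF t(1), of 0] in \<open>auto simp: norm_minus_commute\<close>)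
    moreover have "paired t n inv_density - of_real (?q ^ n)
      = (paired t n inv_density - G t n) + ((G t n - of_real (?q ^ n) * G t 0)
        + of_real (?q ^ n) * (G t 0 - paired t 0 inv_density))"
      by (simp add: paired_0 inv_density_mean algebra_simps)
    moreover have "norm ((paired t n inv_density - G t n) + ((G t n - of_real (?q ^ n) * G t 0)
        + of_real (?q ^ n) * (G t 0 - paired t 0 inv_density)))
        \<le> 2 * M * \<bar>t\<bar> + (real n * (K1 * \<bar>t\<bar> ^ 3) + 1 * (2 * M * \<bar>t\<bar>))"
      using calculation(1)
      by (intro order_trans[OF norm_triangle_ineq] add_mono diff[OF t(1)] iter[OF t])
    moreover have "2 * M * \<bar>t\<bar> + (real n * (K1 * \<bar>t\<bar> ^ 3) + 1 * (2 * M * \<bar>t\<bar>))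
      \<le> (K1 + 4 * M) * (real n * \<bar>t\<bar> ^ 3 + \<bar>t\<bar>)"
    proof -
      have "(K1 + 4 * M) * (real n * \<bar>t\<bar> ^ 3 + \<bar>t\<bar>) - (2 * M * \<bar>t\<bar> + (real n * (K1 * \<bar>t\<bar> ^ 3) + 1 * (2 * M * \<bar>t\<bar>)))
        = K1 * \<bar>t\<bar> + 4 * M * (real n * \<bar>t\<bar> ^ 3)" by (simp add: algebra_simps)
      moreover have "0 \<le> K1 * \<bar>t\<bar>" "0 \<le> 4 * M * (real n * \<bar>t\<bar> ^ 3)" using K1 M0 by auto
      ultimately show ?thesis by linarith
    qed
    ultimately show "norm (paired t n inv_density - of_real (?q ^ n)) \<le> (K1 + 4 * M) * (real n * \<bar>t\<bar> ^ 3 + \<bar>t\<bar>)"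
      by (simp only:)
  qed
qed

lemma paired_inv_density_tendsto:
  "(\<lambda>n. paired (s / sqrt (real n)) n inv_density) \<longlonglongrightarrow> of_real (exp (- variance * s\<^sup>2 / 2))"
proof -
  obtain K where K: "\<And>t n. \<bar>t\<bar> \<le> 1 \<Longrightarrow> variance * t\<^sup>2 \<le> 2 \<Longrightarrow>
     norm (paired t n inv_density - of_real ((1 - variance * t\<^sup>2 / 2) ^ n)) \<le> K * (real n * \<bar>t\<bar> ^ 3 + \<bar>t\<bar>)"
    using paired_inv_density_asymp by blast
  have vanish: "(\<lambda>n. r / sqrt (real n)) \<longlonglongrightarrow> 0" for r :: real
    by (rule real_tendsto_divide_at_top[OF tendsto_const])
       (rule filterlim_compose[OF sqrt_at_top filterlim_real_sequentially])
  note t0 = vanish[of s]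
  have ev1: "\<forall>\<^sub>F n in sequentially. \<bar>s / sqrt (real n)\<bar> < 1"
    using order_tendstoD(2)[OF tendsto_rabs_zero[OF t0], of 1] by simp
  have "(\<lambda>n. variance * (s / sqrt (real n))\<^sup>2) \<longlonglongrightarrow> variance * 0\<^sup>2"
    by (intro tendsto_intros t0)
  then have ev2: "\<forall>\<^sub>F n in sequentially. variance * (s / sqrt (real n))\<^sup>2 < 2"
    by (rule order_tendstoD(2)) simp
  have "(\<lambda>n. paired (s / sqrt (real n)) n inv_density - of_real ((1 - variance * (s / sqrt (real n))\<^sup>2 / 2) ^ n)) \<longlonglongrightarrow> 0"
  proof (rule Lim_null_comparison)
    show "\<forall>\<^sub>F n in sequentially. norm (paired (s / sqrt (real n)) n inv_density - of_real ((1 - variance * (s / sqrt (real n))\<^sup>2 / 2) ^ n))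
       \<le> K * (\<bar>s\<bar> ^ 3 / sqrt (real n) + \<bar>s\<bar> / sqrt (real n))"
      using ev1 ev2 eventually_gt_at_top[of 0]
    proof eventually_elim
      case (elim n)
      have "real n * \<bar>s / sqrt (real n)\<bar> ^ 3 = \<bar>s\<bar> ^ 3 * (real n / (sqrt (real n) * sqrt (real n) * sqrt (real n)))"
        using elim by (simp add: power_divide power3_eq_cube)
      also have "\<dots> = \<bar>s\<bar> ^ 3 / sqrt (real n)"
        using elim by simp
      finally show ?case using K[of "s / sqrt (real n)" n] elim by simp
    qed
    show "(\<lambda>n. K * (\<bar>s\<bar> ^ 3 / sqrt (real n) + \<bar>s\<bar> / sqrt (real n))) \<longlonglongrightarrow> 0"
      using tendsto_mult_right_zero[OF tendsto_add_zero[OF vanish vanish]] .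
  qed
  moreover have "(\<lambda>n. complex_of_real ((1 - variance * (s / sqrt (real n))\<^sup>2 / 2) ^ n)) \<longlonglongrightarrow> of_real (exp (- variance * s\<^sup>2 / 2))"
  proof (rule tendsto_of_real, rule Lim_transform_eventually)
    show "(\<lambda>n. (1 + (- variance * s\<^sup>2 / 2) / real n) ^ n) \<longlonglongrightarrow> exp (- variance * s\<^sup>2 / 2)"
      by (rule tendsto_exp_limit_sequentially)
    show "\<forall>\<^sub>F n in sequentially. (1 + (- variance * s\<^sup>2 / 2) / real n) ^ n = (1 - variance * (s / sqrt (real n))\<^sup>2 / 2) ^ n"
      by (rule always_eventually) (simp add: power_divide mult.commute)
  qed
  ultimately have "(\<lambda>n. (paired (s / sqrt (real n)) n inv_density - of_real ((1 - variance * (s / sqrt (real n))\<^sup>2 / 2) ^ n))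
      + of_real ((1 - variance * (s / sqrt (real n))\<^sup>2 / 2) ^ n)) \<longlonglongrightarrow> 0 + of_real (exp (- variance * s\<^sup>2 / 2))"
    by (rule tendsto_add)
  then show ?thesis by (simp only: diff_add_cancel add_0)
qed

text \<open>By Levy's continuity theorem it is enough to have convergence of characteristic functions. The
  argument covers variance zero, where the limit is the point mass at zero.\<close>
theorem central_limit_birkhoff:
  "weak_conv_m (\<lambda>n. distr inv_measure borel (\<lambda>x. 1 / sqrt (real n) * birkhoff n x)) (centred_normal variance)"
proof (rule levy_continuity)
  have meas: "(\<lambda>x. 1 / sqrt (real n) * birkhoff n x) \<in> borel_measurable inv_measure" for n
    using birkhoff_measurable[of n] by measurable
  show "real_distribution (distr inv_measure borel (\<lambda>x. 1 / sqrt (real n) * birkhoff n x))" for n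
    using inv_measure.prob_space_distr[OF meas, of n] by (simp add: real_distribution_def real_distribution_axioms_def)
  show "real_distribution (centred_normal variance)"
    by (rule real_distribution_centred_normal[OF variance_nonneg])
  fix s
  have "char (distr inv_measure borel (\<lambda>x. 1 / sqrt (real n) * birkhoff n x)) s = paired (s / sqrt (real n)) n inv_density" for n
  proof -
    have "char (distr inv_measure borel (\<lambda>x. 1 / sqrt (real n) * birkhoff n x)) s
      = (\<integral>x. phase (s / sqrt (real n)) n x \<partial>inv_measure)"
      unfolding char_def by (subst integral_distr[OF meas]) (simp_all add: phase_def [abs_def])
    then show ?thesis
      unfolding paired_def by (simp add: integral_inv_measure[OF phase_measurable])
  qed
  then show "(\<lambda>n. char (distr inv_measure borel (\<lambda>x. 1 / sqrt (real n) * birkhoff n x)) s)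
      \<longlonglongrightarrow> char (centred_normal variance) s"
    using paired_inv_density_tendsto[of s] by (simp add: char_centred_normal[OF variance_nonneg])
qed

end

lemma integral_inv_measure_real:
  assumes "incr_diff \<psi>"
  shows "(\<integral>x. \<psi> x \<partial>inv_measure) = unit_mean (\<lambda>x. \<psi> x * inv_density x)"
  using integral_inv_measure[OF incr_diff_measurable[OF assms]] by (simp add: mult.commute)

lemma centre_mean_zero:
  assumes "incr_diff \<psi>" and m: "m = unit_mean (\<lambda>x. \<psi> x * inv_density x)"
  shows "incr_diff (\<lambda>x. \<psi> x - m)" "unit_mean (\<lambda>x. (\<psi> x - m) * inv_density x) = 0"
proof -
  show "incr_diff (\<lambda>x. \<psi> x - m)" by (intro incr_diff_diff assms incr_diff_const)
  have "incr_diff (\<lambda>x. \<psi> x * inv_density x)" by (intro incr_diff_mult assms incr_diff_inv_density)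
  then show "unit_mean (\<lambda>x. (\<psi> x - m) * inv_density x) = 0"
    using incr_diff_integrable incr_diff_integrable[OF incr_diff_inv_density]
    by (simp add: left_diff_distrib inv_density_mean m)
qed

lemma poisson_solution_exists:
  assumes "incr_diff \<psi>" and m: "m = unit_mean (\<lambda>x. \<psi> x * inv_density x)"
  obtains a where "poisson_solution (\<lambda>x. \<psi> x - m) a"
proof -
  note cm = centre_mean_zero[OF assms]
  have i: "incr_diff (\<lambda>x. (\<psi> x - m) * inv_density x)"
    by (intro incr_diff_mult cm incr_diff_inv_density)
  have "unit_mean (transfer (\<lambda>x. (\<psi> x - m) * inv_density x)) = 0"
    using transfer_mean[OF i] cm(2) by simp
  then show ?thesis
  proof (rule poisson_equation[OF incr_diff_transfer[OF i]])
    fix a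
    assume "incr_diff a"
      "\<And>x. x \<in> {0..1} \<Longrightarrow> a x - transfer a x = transfer (\<lambda>x. (\<psi> x - m) * inv_density x) x"
    then have "poisson_solution (\<lambda>x. \<psi> x - m) a"
      by (intro poisson_solution.intro cm)
    then show ?thesis by (rule that)
  qed
qed

lemma
  assumes \<psi>: "incr_diff \<psi>"
    and ps: "poisson_solution (\<lambda>x. \<psi> x - unit_mean (\<lambda>x. \<psi> x * inv_density x)) a"
  defines "v \<equiv> poisson_solution.variance (\<lambda>x. \<psi> x - unit_mean (\<lambda>x. \<psi> x * inv_density x)) a"
  shows scaled_variance_tendsto: "scaled_variance T inv_measure \<psi> \<longlonglongrightarrow> v"
    and diffusion_coeff_eq: "diffusion_coeff T inv_measure \<psi> = v"
    and central_limit: "weak_conv_m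
           (\<lambda>n. distr inv_measure borel (\<lambda>x. 1 / sqrt (real n) * centred_birkhoff_sum T inv_measure \<psi> n x))
           (centred_normal (diffusion_coeff T inv_measure \<psi>))"
proof -
  interpret poisson_solution "\<lambda>x. \<psi> x - unit_mean (\<lambda>x. \<psi> x * inv_density x)" a by (rule ps)
  have cbs: "centred_birkhoff_sum T inv_measure \<psi> n x = birkhoff n x" for n x
    by (simp add: centred_birkhoff_sum_def birkhoff_def integral_inv_measure_real[OF \<psi>] sum_subtractf)
  have "scaled_variance T inv_measure \<psi> = (\<lambda>n. 1 / real n * second_moment n)"
  proof
    fix n
    have "(\<lambda>x. (birkhoff n x)\<^sup>2) \<in> borel_measurable unit_leb" using birkhoff_measurable[of n] by measurable
    from integral_inv_measure[OF this]
    show "scaled_variance T inv_measure \<psi> n = 1 / real n * second_moment n"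
      by (simp add: scaled_variance_def cbs second_moment_def)
  qed
  then show sv: "scaled_variance T inv_measure \<psi> \<longlonglongrightarrow> v"
    using second_moment_asymp by (simp only: v_def)
  then show dc: "diffusion_coeff T inv_measure \<psi> = v"
    unfolding diffusion_coeff_def by (rule limI)
  show "weak_conv_m
           (\<lambda>n. distr inv_measure borel (\<lambda>x. 1 / sqrt (real n) * centred_birkhoff_sum T inv_measure \<psi> n x))
           (centred_normal (diffusion_coeff T inv_measure \<psi>))"
    using central_limit_birkhoff by (simp add: cbs dc v_def)
qed

section \<open>Lipschitz estimates for the transfer operator\<close>

text \<open>In the coordinate \<open>v = 5/2 - inv_branch x\<close> the map is quadratic, \<open>x = 25/8 - v\<^sup>2 / 2\<close>, and the
  derivative of the branch is \<open>1/v\<close>. Both bounds follow by factoring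
  \<open>w\<^sup>2 - v\<^sup>2\<close>.\<close>
lemma inv_branch_lipschitz:
  assumes "x < 25/8" "y < 25/8" "inv_branch_deriv x \<le> m" "inv_branch_deriv y \<le> m"
  shows "\<bar>inv_branch x - inv_branch y\<bar> \<le> m * \<bar>x - y\<bar>"
    and "\<bar>inv_branch_deriv x - inv_branch_deriv y\<bar> \<le> m ^ 3 * \<bar>x - y\<bar>"
proof -
  \<comment> \<open>slopes of \<open>lift_map\<close> at the two preimages\<close>
  define v w where "v = 5/2 - inv_branch x" and "w = 5/2 - inv_branch y"
  have dx: "inv_branch_deriv x = 1 / v" and dy: "inv_branch_deriv y = 1 / w"
    using assms by (simp_all add: inv_branch_deriv_eq v_def w_def)
  then have pos: "0 < v" "0 < w"
    using inv_branch_deriv_pos[OF assms(1)] inv_branch_deriv_pos[OF assms(2)] by auto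
  have m: "0 < m" using inv_branch_deriv_pos[OF assms(1)] assms(3) by linarith
  have "1 \<le> m * v" "1 \<le> m * w"
    using assms(3,4) pos unfolding dx dy by (simp_all add: pos_divide_le_eq)
  then have vw: "2 \<le> m * (v + w)" by (simp add: distrib_left)
  have "x = 25/8 - v\<^sup>2 / 2" "y = 25/8 - w\<^sup>2 / 2"
    using lift_map_inv_branch[of x] lift_map_inv_branch[of y] assms
    by (simp_all add: lift_map_def v_def w_def power2_eq_square field_simps)
  then have "2 * (x - y) = (w - v) * (v + w)"
    by (simp add: power2_eq_square algebra_simps)
  then have xy: "2 * \<bar>x - y\<bar> = \<bar>w - v\<bar> * (v + w)"
    using pos by (metis abs_mult abs_numeral abs_of_pos add_pos_pos)
  have "2 * \<bar>w - v\<bar> \<le> m * (v + w) * \<bar>w - v\<bar>" using vw by (intro mult_right_mono) auto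
  also have "\<dots> = 2 * (m * \<bar>x - y\<bar>)" using xy by (simp add: mult_ac)
  finally have wv: "\<bar>w - v\<bar> \<le> m * \<bar>x - y\<bar>" by simp
  have "inv_branch x - inv_branch y = w - v" by (simp add: v_def w_def)
  then show "\<bar>inv_branch x - inv_branch y\<bar> \<le> m * \<bar>x - y\<bar>" using wv by (simp only:)
  have "inv_branch_deriv x - inv_branch_deriv y = (w - v) * (inv_branch_deriv x * inv_branch_deriv y)"
    using pos unfolding dx dy by (simp add: field_simps)
  then have "\<bar>inv_branch_deriv x - inv_branch_deriv y\<bar> = \<bar>w - v\<bar> * (inv_branch_deriv x * inv_branch_deriv y)"
    using inv_branch_deriv_pos[OF assms(1)] inv_branch_deriv_pos[OF assms(2)] by (simp add: abs_mult)
  also have "\<dots> \<le> (m * \<bar>x - y\<bar>) * (m * m)"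
    using inv_branch_deriv_pos[OF assms(1)] inv_branch_deriv_pos[OF assms(2)] m
    by (intro mult_mono wv assms) auto
  finally show "\<bar>inv_branch_deriv x - inv_branch_deriv y\<bar> \<le> m ^ 3 * \<bar>x - y\<bar>"
    by (simp add: power3_eq_cube mult_ac)
qed

lemma unit_mean_FTC:
  assumes "\<And>x. (F has_real_derivative f x) (at x)" "\<And>x. isCont f x"
  shows "unit_mean f = F 1 - F 0"
proof -
  have "unit_mean f = (\<integral>x. indicator {0..1} x *\<^sub>R f x \<partial>lborel)"
    by (rule integral_restrict_space) simp
  also have "\<dots> = F 1 - F 0"
    by (rule integral_FTC_atLeastAtMost)
       (use assms in \<open>auto simp: has_real_derivative_iff_has_vector_derivative
          intro: has_vector_derivative_at_within continuous_at_imp_continuous_on\<close>)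
  finally show ?thesis .
qed

abbreviation lip :: "real \<Rightarrow> (real \<Rightarrow> real) \<Rightarrow> bool" where
  "lip D h \<equiv> D-lipschitz_on {0..1} h"

lemma lipI:
  assumes "0 \<le> D" "\<And>x y. x \<in> {0..1} \<Longrightarrow> y \<in> {0..1} \<Longrightarrow> \<bar>h x - h y\<bar> \<le> D * \<bar>x - y\<bar>"
  shows "lip D h"
  using assms by (intro lipschitz_onI) (auto simp: dist_real_def)

lemma lipD: "lip D h \<Longrightarrow> x \<in> {0..1} \<Longrightarrow> y \<in> {0..1} \<Longrightarrow> \<bar>h x - h y\<bar> \<le> D * \<bar>x - y\<bar>"
  by (auto simp: dist_real_def dest: lipschitz_onD)

text \<open>Adding the linear function \<open>D * x\<close> makes a \<open>D\<close>-Lipschitz function increasing.\<close>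
lemma lip_imp_incr_diff:
  assumes "lip D h"
  shows "incr_diff h"
proof (rule incr_diffI[of "\<lambda>x. h x + (D * x + \<bar>h 0\<bar>)" "\<lambda>x. D * x + \<bar>h 0\<bar>"])
  have D: "0 \<le> D" by (rule lipschitz_on_nonneg[OF assms])
  show "incr_nonneg (\<lambda>x. h x + (D * x + \<bar>h 0\<bar>))"
  proof (rule incr_nonnegI)
    fix x y :: real assume "0 \<le> x" "x \<le> y" "y \<le> 1"
    then show "h x + (D * x + \<bar>h 0\<bar>) \<le> h y + (D * y + \<bar>h 0\<bar>)"
      using lipD[OF assms, of x y] by (auto simp: algebra_simps abs_if split: if_splits)
  qed simp
  show "incr_nonneg (\<lambda>x. D * x + \<bar>h 0\<bar>)"
    using D by (intro incr_nonnegI) (auto intro: mult_left_mono)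
qed simp

lemma incr_diff_id: "incr_diff (\<lambda>x. x)"
  by (rule incr_nonneg_imp_incr_diff[OF incr_nonnegI]) auto

lemma incr_diff_square: "incr_diff (\<lambda>x. x\<^sup>2)"
  by (rule incr_nonneg_imp_incr_diff[OF incr_nonnegI]) (auto intro: power_mono)

text \<open>A function of mean zero is the average over \<open>y\<close> of the differences \<open>h x - h y\<close>. On the unit
  square \<open>\<bar>x - y\<bar> \<le> x + y - 2xy\<close>, and the average of this bound over \<open>y\<close> is \<open>1/2\<close>,
  whatever \<open>x\<close> is.\<close>
lemma lip_zero_mean_bound:
  assumes h: "lip D h" "unit_mean h = 0" and x: "x \<in> {0..1}"
  shows "\<bar>h x\<bar> \<le> D / 2"
proof -
  have int: "integrable unit_leb h" by (rule incr_diff_integrable[OF lip_imp_incr_diff[OF h(1)]])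
  have D: "0 \<le> D" by (rule lipschitz_on_nonneg[OF h(1)])
  have id: "integrable unit_leb (\<lambda>y. D * (x + y - 2 * x * y))"
    by (intro incr_diff_integrable incr_diff_cmult incr_diff_diff incr_diff_add incr_diff_const incr_diff_id)
  have "h x = unit_mean (\<lambda>y. h x - h y)"
    using int h(2) by (simp add: unit_leb.prob_space[simplified])
  also have "\<bar>\<dots>\<bar> \<le> unit_mean (\<lambda>y. D * (x + y - 2 * x * y))"
  proof (rule integral_abs_bound_integral)
    show "integrable unit_leb (\<lambda>y. h x - h y)" using int by simp
    fix y assume "y \<in> space unit_leb"
    then have y: "y \<in> {0..1}" by simp
    have "0 \<le> x * (1 - y)" "0 \<le> y * (1 - x)" using x y by auto
    then have "\<bar>x - y\<bar> \<le> x + y - 2 * x * y" by (auto simp: abs_le_iff algebra_simps)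
    then show "\<bar>h x - h y\<bar> \<le> D * (x + y - 2 * x * y)"
      using lipD[OF h(1) x y] D by (meson mult_left_mono order_trans)
  qed (rule id)
  also have "\<dots> = D * (x + 1/2 - x)"
    by (subst unit_mean_FTC[where F = "\<lambda>y. D * (x * y + y\<^sup>2 / 2 - x * y\<^sup>2)"])
       (auto intro!: derivative_eq_intros simp: algebra_simps)
  finally show ?thesis by simp
qed

text \<open>Since \<open>x\<^sup>2 - 1/3\<close> and \<open>h\<close> both have mean zero, the moment is the mean of
  \<open>(x\<^sup>2 - 1/3) * (h x - h z)\<close> for any \<open>z\<close>. If \<open>z\<close> is the zero of \<open>x\<^sup>2 - 1/3\<close>, then
  \<open>(x\<^sup>2 - 1/3) * (x - z)\<close> is nonnegative and has mean \<open>1/12\<close>.\<close>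
lemma lip_square_moment:
  assumes h: "lip D h" "unit_mean h = 0"
  shows "\<bar>unit_mean (\<lambda>x. x\<^sup>2 * h x)\<bar> \<le> D / 12"
proof -
  have hd: "incr_diff h" by (rule lip_imp_incr_diff[OF h(1)])
  have D: "0 \<le> D" by (rule lipschitz_on_nonneg[OF h(1)])
  define z :: real where "z = sqrt (1/3)"
  have z: "z\<^sup>2 = 1/3" "0 \<le> z" by (simp_all add: z_def)
  then have z1: "z \<in> {0..1}" using power2_le_imp_le[of z 1] by simp
  note sq = incr_diff_square and idd = incr_diff_id
  have m2: "unit_mean (\<lambda>x. x\<^sup>2) = 1/3"
    by (subst unit_mean_FTC[where F = "\<lambda>y. y ^ 3 / 3"]) (auto intro!: derivative_eq_intros)
  have "unit_mean (\<lambda>x. x\<^sup>2 * h x) = unit_mean (\<lambda>x. x\<^sup>2 * h x - (1/3 * h x + h z * (x\<^sup>2 - 1/3)))"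
    using incr_diff_integrable[OF incr_diff_mult[OF sq hd]] incr_diff_integrable[OF hd] incr_diff_integrable[OF sq] h(2)
    by (simp add: m2 unit_leb.prob_space[simplified])
  also have "\<dots> = unit_mean (\<lambda>x. (x\<^sup>2 - 1/3) * (h x - h z))"
    by (intro Bochner_Integration.integral_cong refl) (simp add: field_simps)
  also have "\<bar>\<dots>\<bar> \<le> unit_mean (\<lambda>x. D * ((x\<^sup>2 - 1/3) * (x - z)))"
  proof (rule integral_abs_bound_integral)
    show "integrable unit_leb (\<lambda>x. (x\<^sup>2 - 1/3) * (h x - h z))" "integrable unit_leb (\<lambda>x. D * ((x\<^sup>2 - 1/3) * (x - z)))"
      by (intro incr_diff_integrable incr_diff_mult incr_diff_diff incr_diff_const sq hd idd)+
    fix x assume "x \<in> space unit_leb"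
    then have x: "x \<in> {0..1}" by simp
    have "(x\<^sup>2 - 1/3) * (x - z) = (x + z) * (x - z)\<^sup>2"
      unfolding z(1)[symmetric] by (simp add: power2_eq_square algebra_simps)
    then have "(x\<^sup>2 - 1/3) * (x - z) = \<bar>(x\<^sup>2 - 1/3) * (x - z)\<bar>" using x z by simp
    then have eq: "D * ((x\<^sup>2 - 1/3) * (x - z)) = \<bar>x\<^sup>2 - 1/3\<bar> * (D * \<bar>x - z\<bar>)"
      by (simp add: abs_mult)
    show "\<bar>(x\<^sup>2 - 1/3) * (h x - h z)\<bar> \<le> D * ((x\<^sup>2 - 1/3) * (x - z))"
      unfolding eq abs_mult by (rule mult_left_mono[OF lipD[OF h(1) x z1]]) simp
  qed
  also have "\<dots> = D / 12"
    by (subst unit_mean_FTC[where F = "\<lambda>x. D * (x ^ 4 / 4 - z * x ^ 3 / 3 - x\<^sup>2 / 6 + z * x / 3)"])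
       (auto intro!: derivative_eq_intros simp: field_simps power2_eq_square power3_eq_cube)
  finally show ?thesis .
qed

lemma inv_branch_deriv_1_le: "inv_branch_deriv 1 \<le> 243/500"
proof -
  have "1000/243 \<le> sqrt (17::real)" by (rule real_le_rsqrt) (simp add: power2_eq_square)
  then show ?thesis by (simp add: inv_branch_deriv_def field_simps)
qed

text \<open>On functions of mean zero the Lipschitz constant contracts. An inverse branch of slope at most
  \<open>m\<close> contributes \<open>m\<^sup>2\<close> from the variation of \<open>h\<close> and \<open>m\<^sup>3 / 2\<close> from that of the weight, the
  latter since \<open>\<bar>h\<bar> \<le> D / 2\<close>. With the slopes \<open>243/500\<close> and \<open>2/3\<close> the sum is about
  \<open>0.8862\<close>. This rate and the constant \<open>1000/113 = 1 / (1 - 887/1000)\<close> are much better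
  than those obtained from balanced functions, which matters for the numerical enclosure.\<close>
lemma lip_transfer:
  assumes h: "lip D h" "unit_mean h = 0"
  shows "lip (887/1000 * D) (transfer h)"
proof (rule lipI)
  have D: "0 \<le> D" by (rule lipschitz_on_nonneg[OF h(1)])
  then show "0 \<le> 887/1000 * D" by simp
  fix x y :: real assume x: "x \<in> {0..1}" and y: "y \<in> {0..1}"
  have branch: "\<bar>inv_branch_deriv u * h (inv_branch u) - inv_branch_deriv v * h (inv_branch v)\<bar>
      \<le> (m\<^sup>2 + m ^ 3 / 2) * (D * \<bar>u - v\<bar>)"
    if uv: "0 \<le> u" "0 \<le> v" "u \<le> 2" "v \<le> 2" and m: "inv_branch_deriv u \<le> m" "inv_branch_deriv v \<le> m" for u v m
  proof -
    have less: "u < 25/8" "v < 25/8" using uv by auto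
    note br = inv_branch_lipschitz[OF less m]
    have gu: "inv_branch u \<in> {0..1}" "inv_branch v \<in> {0..1}"
      using inv_branch_bounds[of u] inv_branch_bounds[of v] uv by auto
    have m0: "0 \<le> m" using inv_branch_deriv_pos[OF less(1)] m(1) by linarith
    have "\<bar>inv_branch_deriv u * (h (inv_branch u) - h (inv_branch v))\<bar> \<le> m * (D * (m * \<bar>u - v\<bar>))"
      unfolding abs_mult using inv_branch_deriv_pos[OF less(1)] m(1) m0
      by (intro mult_mono order_trans[OF lipD[OF h(1) gu]] mult_left_mono br D) auto
    moreover have "\<bar>(inv_branch_deriv u - inv_branch_deriv v) * h (inv_branch v)\<bar> \<le> (m ^ 3 * \<bar>u - v\<bar>) * (D / 2)"
      unfolding abs_mult using m0 by (intro mult_mono br lip_zero_mean_bound[OF h gu(2)]) auto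
    moreover have "inv_branch_deriv u * h (inv_branch u) - inv_branch_deriv v * h (inv_branch v)
      = inv_branch_deriv u * (h (inv_branch u) - h (inv_branch v)) + (inv_branch_deriv u - inv_branch_deriv v) * h (inv_branch v)"
      by (simp add: algebra_simps)
    ultimately have "\<bar>inv_branch_deriv u * h (inv_branch u) - inv_branch_deriv v * h (inv_branch v)\<bar>
      \<le> m * (D * (m * \<bar>u - v\<bar>)) + (m ^ 3 * \<bar>u - v\<bar>) * (D / 2)" by linarith
    then show ?thesis by (simp add: power2_eq_square algebra_simps)
  qed
  have b1: "inv_branch_deriv u \<le> 243/500" if "u \<in> {0..1}" for u
    using inv_branch_deriv_mono[of u 1] inv_branch_deriv_1_le that by simp
  have b2: "inv_branch_deriv (u + 1) \<le> 2/3" if "u \<in> {0..1}" for u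
    using inv_branch_deriv_mono[of "u + 1" 2] that by simp
  have "\<bar>transfer h x - transfer h y\<bar>
    \<le> \<bar>inv_branch_deriv x * h (inv_branch x) - inv_branch_deriv y * h (inv_branch y)\<bar>
      + \<bar>inv_branch_deriv (x + 1) * h (inv_branch (x + 1)) - inv_branch_deriv (y + 1) * h (inv_branch (y + 1))\<bar>"
    unfolding transfer_def by linarith
  also have "\<dots> \<le> ((243/500)\<^sup>2 + (243/500) ^ 3 / 2) * (D * \<bar>x - y\<bar>) + ((2/3)\<^sup>2 + (2/3) ^ 3 / 2) * (D * \<bar>(x + 1) - (y + 1)\<bar>)"
    by (intro add_mono branch b1 b2 x y) (use x y in auto)
  also have "\<dots> \<le> 887/1000 * (D * \<bar>x - y\<bar>)"
    using mult_nonneg_nonneg[OF D, of "\<bar>x - y\<bar>"] by (simp add: power2_eq_square power3_eq_cube)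
  finally show "\<bar>transfer h x - transfer h y\<bar> \<le> 887/1000 * D * \<bar>x - y\<bar>" by simp
qed

lemma lip_transfer_iterate:
  assumes h: "lip D h" "unit_mean h = 0"
  shows "lip ((887/1000) ^ n * D) ((transfer ^^ n) h)"
proof (induction n)
  case (Suc n)
  have "unit_mean ((transfer ^^ n) h) = 0"
    using transfer_iterate_mean[OF lip_imp_incr_diff[OF h(1)]] h(2) by simp
  from lip_transfer[OF Suc this] show ?case by (simp add: mult_ac)
qed (use h in simp)

lemma geometric_sum_le: "(\<Sum>k<n. (887/1000) ^ k) \<le> (1000/113 :: real)"
proof -
  have "(\<Sum>k<n. (887/1000 :: real) ^ k) = (1 - (887/1000) ^ n) / (113/1000)"
    using sum_gp_strict[of "887/1000 :: real" n] by simp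
  also have "\<dots> \<le> 1000/113" by simp
  finally show ?thesis .
qed

text \<open>A posteriori error bound: the distance of an approximate density \<open>q\<close> from the invariant one is
  the sum of the iterates of its residual.\<close>
lemma lip_density_error:
  assumes q: "incr_diff q" "unit_mean q = 1" and res: "lip D (\<lambda>x. transfer q x - q x)"
  shows "lip (1000/113 * D) (\<lambda>x. inv_density x - q x)"
proof (rule lipI)
  have D: "0 \<le> D" by (rule lipschitz_on_nonneg[OF res])
  then show "0 \<le> 1000/113 * D" by simp
  define E where "E x = transfer q x - q x" for x
  have E: "lip D E" using res by (simp add: E_def[abs_def])
  have E0: "unit_mean E = 0"
    unfolding E_def using q incr_diff_integrable[OF incr_diff_transfer[OF q(1)]] incr_diff_integrable[OF q(1)] transfer_mean[OF q(1)]
    by simp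
  have iter: "(transfer ^^ n) q x - q x = (\<Sum>k<n. (transfer ^^ k) E x)" for n x
  proof (induction n)
    case (Suc n)
    have "(transfer ^^ n) E x = (transfer ^^ Suc n) q x - (transfer ^^ n) q x"
      unfolding E_def by (simp add: transfer_iterate_diff funpow_swap1)
    with Suc show ?case by simp
  qed simp
  fix x y :: real assume x: "x \<in> {0..1}" and y: "y \<in> {0..1}"
  have bound: "\<bar>((transfer ^^ n) q x - q x) - ((transfer ^^ n) q y - q y)\<bar> \<le> 1000/113 * D * \<bar>x - y\<bar>" for n
  proof -
    have "\<bar>((transfer ^^ n) q x - q x) - ((transfer ^^ n) q y - q y)\<bar>
      = \<bar>\<Sum>k<n. (transfer ^^ k) E x - (transfer ^^ k) E y\<bar>"
      unfolding iter by (simp add: sum_subtractf)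
    also have "\<dots> \<le> (\<Sum>k<n. (887/1000) ^ k * D * \<bar>x - y\<bar>)"
      by (intro order_trans[OF sum_abs] sum_mono lipD[OF lip_transfer_iterate[OF E E0]] x y)
    also have "\<dots> = (\<Sum>k<n. (887/1000) ^ k) * (D * \<bar>x - y\<bar>)"
      by (simp add: sum_distrib_right mult.assoc)
    also have "\<dots> \<le> 1000/113 * (D * \<bar>x - y\<bar>)"
      using D by (intro mult_right_mono geometric_sum_le) simp
    finally show ?thesis by simp
  qed
  have lim: "(\<lambda>n. (transfer ^^ n) q z) \<longlonglongrightarrow> inv_density z" if z: "z \<in> {0..1}" for z
  proof -
    obtain B where B: "\<And>n x. x \<in> {0..1} \<Longrightarrow> \<bar>(transfer ^^ n) q x - unit_mean q * inv_density x\<bar> \<le> B * (14/15) ^ n"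
      by (rule transfer_iterate_converges[OF q(1)]) blast
    have "(\<lambda>n. (transfer ^^ n) q z - inv_density z) \<longlonglongrightarrow> 0"
      by (rule Lim_null_comparison[of _ "\<lambda>n. B * (14/15) ^ n"])
         (use B[OF z] q(2) in \<open>auto intro!: tendsto_mult_right_zero LIMSEQ_power_zero\<close>)
    then show ?thesis by (rule LIM_zero_cancel)
  qed
  have "(\<lambda>n. \<bar>((transfer ^^ n) q x - q x) - ((transfer ^^ n) q y - q y)\<bar>)
    \<longlonglongrightarrow> \<bar>(inv_density x - q x) - (inv_density y - q y)\<bar>"
    by (intro tendsto_intros lim x y)
  then show "\<bar>(inv_density x - q x) - (inv_density y - q y)\<bar> \<le> 1000/113 * D * \<bar>x - y\<bar>"
    by (rule LIMSEQ_le_const2) (use bound in blast)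
qed

lemma unit_mean_add: "incr_diff u \<Longrightarrow> incr_diff v \<Longrightarrow> unit_mean (\<lambda>x. u x + v x) = unit_mean u + unit_mean v"
  and unit_mean_diff: "incr_diff u \<Longrightarrow> incr_diff v \<Longrightarrow> unit_mean (\<lambda>x. u x - v x) = unit_mean u - unit_mean v"
  by (simp_all add: incr_diff_integrable)

text \<open>The moment of \<open>d\<close> is the sum of the moments of the iterates of \<open>\<delta>\<close>, each of which is bounded
  by \<open>lip_square_moment\<close>. The remainder \<open>e n\<close> vanishes in the limit, because \<open>x\<^sup>2 - m\<close> is
  centred for the invariant measure.\<close>
lemma resolvent_square_moment:
  assumes d: "incr_diff d" and \<delta>: "lip D \<delta>" "unit_mean \<delta> = 0"
    and eq: "\<And>x. x \<in> {0..1} \<Longrightarrow> d x - transfer d x = \<delta> x"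
    and m: "unit_mean (\<lambda>x. (x\<^sup>2 - m) * inv_density x) = 0"
  shows "\<bar>unit_mean (\<lambda>x. d x * (x\<^sup>2 - m))\<bar> \<le> 1000/113 * (D / 12)"
proof -
  have \<delta>d: "incr_diff \<delta>" by (rule lip_imp_incr_diff[OF \<delta>(1)])
  have D: "0 \<le> D" by (rule lipschitz_on_nonneg[OF \<delta>(1)])
  have sm: "incr_diff (\<lambda>x. x\<^sup>2 - m)" by (intro incr_diff_diff incr_diff_square incr_diff_const)
  define e where "e n = unit_mean (\<lambda>x. (transfer ^^ n) d x * (x\<^sup>2 - m))" for n
  have "\<bar>x\<^sup>2 - m\<bar> \<le> 1 + \<bar>m\<bar>" if "x \<in> {0..1}" for x :: real
    using that power_le_one[of x 2] abs_triangle_ineq4[of "x\<^sup>2" m] by simp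
  then obtain B where "\<And>n. \<bar>unit_mean (\<lambda>x. (transfer ^^ n) d x * (x\<^sup>2 - m)) - unit_mean d * (\<integral>x. inv_density x * (x\<^sup>2 - m) \<partial>unit_leb)\<bar> \<le> B * (14/15) ^ n"
    by (rule transfer_iterate_pairing[OF d incr_diff_measurable[OF sm]]) (assumption, rule that)
  then have eB: "\<bar>e n\<bar> \<le> B * (14/15) ^ n" for n using m by (simp add: e_def mult.commute)
  have step: "\<bar>e n - e (Suc n)\<bar> \<le> (887/1000) ^ n * (D / 12)" for n
  proof -
    have eqn: "(transfer ^^ n) d x - (transfer ^^ Suc n) d x = (transfer ^^ n) \<delta> x" if "x \<in> {0..1}" for x
    proof -
      have "(transfer ^^ n) \<delta> x = (transfer ^^ n) (\<lambda>x. d x - transfer d x) x"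
        by (rule transfer_iterate_cong) (use eq that in auto)
      then show ?thesis by (simp add: transfer_iterate_diff funpow_swap1)
    qed
    have "e n - e (Suc n) = unit_mean (\<lambda>x. (transfer ^^ n) d x * (x\<^sup>2 - m) - (transfer ^^ Suc n) d x * (x\<^sup>2 - m))"
      unfolding e_def
      by (intro unit_mean_diff[symmetric] incr_diff_mult incr_diff_transfer_iterate d sm)
    also have "\<dots> = unit_mean (\<lambda>x. x\<^sup>2 * (transfer ^^ n) \<delta> x - m * (transfer ^^ n) \<delta> x)"
      by (intro Bochner_Integration.integral_cong refl)
         (simp only: eqn[symmetric] space_unit_leb, simp add: algebra_simps)
    also have "\<dots> = unit_mean (\<lambda>x. x\<^sup>2 * (transfer ^^ n) \<delta> x) - unit_mean (\<lambda>x. m * (transfer ^^ n) \<delta> x)"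
      by (intro unit_mean_diff incr_diff_mult incr_diff_cmult incr_diff_transfer_iterate \<delta>d incr_diff_square)
    also have "unit_mean (\<lambda>x. m * (transfer ^^ n) \<delta> x) = 0"
      using transfer_iterate_mean[OF \<delta>d] \<delta>(2) by simp
    finally have "e n - e (Suc n) = unit_mean (\<lambda>x. x\<^sup>2 * (transfer ^^ n) \<delta> x)" by simp
    moreover have "unit_mean ((transfer ^^ n) \<delta>) = 0" using transfer_iterate_mean[OF \<delta>d] \<delta>(2) by simp
    ultimately show ?thesis
      using lip_square_moment[OF lip_transfer_iterate[OF \<delta>, of n]] by simp
  qed
  have "\<bar>e 0 - e n\<bar> \<le> 1000/113 * (D / 12)" for n
  proof -
    have "e 0 - e n = (\<Sum>k<n. e k - e (Suc k))" by (simp add: sum_lessThan_telescope')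
    also have "\<bar>\<dots>\<bar> \<le> (\<Sum>k<n. (887/1000) ^ k * (D / 12))"
      by (intro order_trans[OF sum_abs] sum_mono step)
    also have "\<dots> = (\<Sum>k<n. (887/1000) ^ k) * (D / 12)" by (simp add: sum_distrib_right)
    also have "\<dots> \<le> 1000/113 * (D / 12)" using D by (intro mult_right_mono geometric_sum_le) simp
    finally show ?thesis .
  qed
  moreover have "(\<lambda>n. \<bar>e 0 - e n\<bar>) \<longlonglongrightarrow> \<bar>e 0 - 0\<bar>"
    by (intro tendsto_intros Lim_null_comparison[of e "\<lambda>n. B * (14/15) ^ n"])
       (use eB in \<open>auto intro!: tendsto_mult_right_zero LIMSEQ_power_zero\<close>)
  ultimately have "\<bar>e 0 - 0\<bar> \<le> 1000/113 * (D / 12)"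
    by (intro LIMSEQ_le_const2) auto
  then show ?thesis by (simp add: e_def)
qed

text \<open>The diffusion coefficient from an approximate invariant density \<open>q\<close> and an approximate solution
  \<open>w\<close> of \<open>w - transfer w = (x\<^sup>2 - \<mu>) * inv_density\<close>, in terms of their residuals. For the exact
  solution \<open>u\<close>, which includes the zeroth term of the series, the Green--Kubo formula reads
  \<open>2 * mean (x\<^sup>2 * u) - mean (x\<^sup>4 * inv_density) + \<mu>\<^sup>2\<close>; the expression below replaces \<open>u\<close> and
  \<open>inv_density\<close> by \<open>w\<close> and \<open>q\<close>. The number \<open>m\<close> is a convenient rational
  close to \<open>\<mu>\<close>, and \<open>R\<close> bounds the Lipschitz constant of \<open>inv_density - q\<close>.\<close>
theorem diffusion_coeff_square_approx:
  assumes q: "incr_diff q" "unit_mean q = 1" and w: "incr_diff w" "unit_mean w = 0"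
    and res1: "lip D1 (\<lambda>x. transfer q x - q x)"
    and res2: "lip D2 (\<lambda>x. (x\<^sup>2 - m) * q x - (w x - transfer w x))"
    and q2: "lip 2 q" and m: "\<bar>unit_mean (\<lambda>x. x\<^sup>2 * q x) - m\<bar> \<le> \<epsilon>"
    and R: "1000/113 * D1 \<le> R" "R \<le> 1"
  shows "\<bar>diffusion_coeff T inv_measure (\<lambda>x. x\<^sup>2)
      - (2 * unit_mean (\<lambda>x. x\<^sup>2 * w x) - unit_mean (\<lambda>x. x ^ 4 * q x) + (unit_mean (\<lambda>x. x\<^sup>2 * q x))\<^sup>2)\<bar>
    \<le> 1000/678 * (D2 + 2 * R + 2 * (\<epsilon> + R / 12)) + 7/10 * R"
proof -
  define \<mu> where "\<mu> = unit_mean (\<lambda>x. x\<^sup>2 * inv_density x)"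
  define \<mu>' where "\<mu>' = unit_mean (\<lambda>x. x\<^sup>2 * q x)"
  define r where "r x = inv_density x - q x" for x
  note id = incr_diff_inv_density and sq = incr_diff_square
  have p4: "incr_diff (\<lambda>x. x ^ 4)"
    using incr_diff_mult[OF sq sq] by (simp add: power_add[symmetric])
  have r: "lip R r"
    unfolding r_def by (rule lipschitz_on_le[OF lip_density_error[OF q res1] R(1)])
  have rd: "incr_diff r" by (rule lip_imp_incr_diff[OF r])
  have r0: "unit_mean r = 0"
    unfolding r_def using unit_mean_diff[OF id q(1)] q(2) by (simp add: inv_density_mean)
  have R0: "0 \<le> R" by (rule lipschitz_on_nonneg[OF r])
  have rb: "\<bar>r x\<bar> \<le> R / 2" if "x \<in> {0..1}" for x by (rule lip_zero_mean_bound[OF r r0 that])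
  have "unit_mean (\<lambda>x. x\<^sup>2 * r x) = \<mu> - \<mu>'"
    unfolding \<mu>_def \<mu>'_def r_def right_diff_distrib
    by (intro unit_mean_diff incr_diff_mult sq id q)
  then have mu: "\<bar>\<mu> - \<mu>'\<bar> \<le> R / 12" using lip_square_moment[OF r r0] by simp
  have mm: "\<bar>m - \<mu>\<bar> \<le> \<epsilon> + R / 12" using mu m unfolding \<mu>'_def[symmetric] by linarith
  have mu01: "0 \<le> \<mu>" "\<mu> \<le> 1"
  proof -
    show "0 \<le> \<mu>"
      unfolding \<mu>_def by (rule Bochner_Integration.integral_nonneg) (simp add: inv_density_nonneg)
    have "\<mu> \<le> unit_mean inv_density"
      unfolding \<mu>_def
    proof (rule integral_mono)
      show "x\<^sup>2 * inv_density x \<le> inv_density x" if "x \<in> space unit_leb" for x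
        using that inv_density_nonneg[of x] power_le_one[of x 2] by (simp add: mult_left_le_one_le)
    qed (intro incr_diff_integrable incr_diff_mult sq id)+
    then show "\<mu> \<le> 1" by (simp add: inv_density_mean)
  qed
  obtain a where ps: "poisson_solution (\<lambda>x. x\<^sup>2 - \<mu>) a"
    by (rule poisson_solution_exists[OF sq \<mu>_def]) blast
  interpret poisson_solution "\<lambda>x. x\<^sup>2 - \<mu>" a by (rule ps)
  have dc: "diffusion_coeff T inv_measure (\<lambda>x. x\<^sup>2) = variance"
    using diffusion_coeff_eq[OF sq] ps by (simp add: \<mu>_def)
  have cd: "incr_diff (\<lambda>x. x\<^sup>2 - \<mu>)" and ad: "incr_diff a" by (rule c, rule a)
  \<comment> \<open>the series of the iterates of \<open>(x\<^sup>2 - \<mu>) * inv_density\<close>, including its zeroth term, up to a multiple of \<open>inv_density\<close>\<close>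
  define u where "u x = a x + (x\<^sup>2 - \<mu>) * inv_density x" for x
  have ud: "incr_diff u" unfolding u_def by (intro incr_diff_add ad incr_diff_mult cd id)
  have Lu: "transfer u x = a x" if "x \<in> {0..1}" for x
    using poisson[OF that] by (simp add: u_def[abs_def] transfer_add)
  define d where "d x = u x - w x" for x
  have dd: "incr_diff d" unfolding d_def by (intro incr_diff_diff ud w)
  define \<delta> where "\<delta> x = (x\<^sup>2 - m) * q x - (w x - transfer w x) + ((x\<^sup>2 - \<mu>) * r x + (m - \<mu>) * q x)" for x
  have d\<delta>: "d x - transfer d x = \<delta> x" if "x \<in> {0..1}" for x
  proof -
    have "transfer d x = transfer u x - transfer w x" by (simp add: d_def[abs_def] transfer_diff)
    then show ?thesis using Lu[OF that] by (simp add: d_def u_def \<delta>_def r_def algebra_simps)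
  qed
  have cr: "lip (2 * R) (\<lambda>x. (x\<^sup>2 - \<mu>) * r x)"
  proof (rule lipI)
    fix x y :: real assume x: "x \<in> {0..1}" and y: "y \<in> {0..1}"
    have "\<bar>x\<^sup>2 - y\<^sup>2\<bar> = \<bar>x - y\<bar> * (x + y)"
      using x y by (simp add: power2_eq_square square_diff_square_factored abs_mult mult.commute)
    also have "\<dots> \<le> \<bar>x - y\<bar> * 2" using x y by (intro mult_left_mono) auto
    finally have "\<bar>(x\<^sup>2 - y\<^sup>2) * r x\<bar> \<le> (\<bar>x - y\<bar> * 2) * (R / 2)"
      unfolding abs_mult by (intro mult_mono rb x) auto
    moreover have "0 \<le> y\<^sup>2" "y\<^sup>2 \<le> 1" using y by (auto intro: power_le_one)
    then have "\<bar>y\<^sup>2 - \<mu>\<bar> \<le> 1" using mu01 by linarith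
    then have "\<bar>(y\<^sup>2 - \<mu>) * (r x - r y)\<bar> \<le> 1 * (R * \<bar>x - y\<bar>)"
      unfolding abs_mult by (intro mult_mono lipD[OF r x y]) auto
    moreover have "(x\<^sup>2 - \<mu>) * r x - (y\<^sup>2 - \<mu>) * r y = (x\<^sup>2 - y\<^sup>2) * r x + (y\<^sup>2 - \<mu>) * (r x - r y)"
      by (simp add: algebra_simps)
    ultimately have "\<bar>(x\<^sup>2 - \<mu>) * r x - (y\<^sup>2 - \<mu>) * r y\<bar> \<le> (\<bar>x - y\<bar> * 2) * (R / 2) + 1 * (R * \<bar>x - y\<bar>)"
      by linarith
    then show "\<bar>(x\<^sup>2 - \<mu>) * r x - (y\<^sup>2 - \<mu>) * r y\<bar> \<le> 2 * R * \<bar>x - y\<bar>" by (simp add: algebra_simps)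
  qed (use R0 in simp)
  have mq: "lip (2 * (\<epsilon> + R / 12)) (\<lambda>x. (m - \<mu>) * q x)"
  proof (rule lipI)
    fix x y :: real assume x: "x \<in> {0..1}" and y: "y \<in> {0..1}"
    have "\<bar>(m - \<mu>) * (q x - q y)\<bar> \<le> (\<epsilon> + R / 12) * (2 * \<bar>x - y\<bar>)"
      unfolding abs_mult using mm by (intro mult_mono lipD[OF q2 x y]) auto
    moreover have "(m - \<mu>) * q x - (m - \<mu>) * q y = (m - \<mu>) * (q x - q y)" by (simp add: right_diff_distrib)
    moreover have "(\<epsilon> + R / 12) * (2 * \<bar>x - y\<bar>) = 2 * (\<epsilon> + R / 12) * \<bar>x - y\<bar>" by (simp only: mult_ac)
    ultimately show "\<bar>(m - \<mu>) * q x - (m - \<mu>) * q y\<bar> \<le> 2 * (\<epsilon> + R / 12) * \<bar>x - y\<bar>"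
      by (simp only:)
  qed (use mm in simp)
  define \<Delta> where "\<Delta> = D2 + 2 * R + 2 * (\<epsilon> + R / 12)"
  have \<delta>: "lip \<Delta> \<delta>"
    unfolding \<delta>_def \<Delta>_def using lipschitz_on_add[OF res2 lipschitz_on_add[OF cr mq]] by (simp add: add.assoc)
  have \<delta>0: "unit_mean \<delta> = 0"
  proof -
    have "unit_mean \<delta> = unit_mean (\<lambda>x. d x - transfer d x)"
      by (intro Bochner_Integration.integral_cong refl) (simp add: d\<delta>)
    also have "\<dots> = 0"
      using unit_mean_diff[OF dd incr_diff_transfer[OF dd]] transfer_mean[OF dd] by simp
    finally show ?thesis .
  qed
  have dc_bound: "\<bar>unit_mean (\<lambda>x. d x * (x\<^sup>2 - \<mu>))\<bar> \<le> 1000/113 * (\<Delta> / 12)"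
    by (rule resolvent_square_moment[OF dd \<delta> \<delta>0 d\<delta> centred])
  have r4: "\<bar>unit_mean (\<lambda>x. x ^ 4 * r x)\<bar> \<le> R / 2"
  proof -
    have "\<bar>unit_mean (\<lambda>x. x ^ 4 * r x)\<bar> \<le> unit_mean (\<lambda>_. R / 2)"
    proof (rule integral_abs_bound_integral)
      show "integrable unit_leb (\<lambda>x. x ^ 4 * r x)" by (intro incr_diff_integrable incr_diff_mult p4 rd)
      fix x assume "x \<in> space unit_leb"
      then have x: "x \<in> {0..1}" by simp
      have "\<bar>x ^ 4\<bar> * \<bar>r x\<bar> \<le> 1 * (R / 2)"
        using x by (intro mult_mono rb) (auto intro: power_le_one)
      then show "\<bar>x ^ 4 * r x\<bar> \<le> R / 2" by (simp add: abs_mult)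
    qed simp
    then show ?thesis by (simp add: unit_leb.prob_space[simplified])
  qed
  have i4: "unit_mean (\<lambda>x. x ^ 4 * r x) = unit_mean (\<lambda>x. x ^ 4 * inv_density x) - unit_mean (\<lambda>x. x ^ 4 * q x)"
    unfolding r_def right_diff_distrib by (intro unit_mean_diff incr_diff_mult p4 id q)
  have c2: "unit_mean (\<lambda>x. (x\<^sup>2 - \<mu>)\<^sup>2 * inv_density x) = unit_mean (\<lambda>x. x ^ 4 * inv_density x) - \<mu>\<^sup>2"
  proof -
    have "unit_mean (\<lambda>x. (x\<^sup>2 - \<mu>)\<^sup>2 * inv_density x)
      = unit_mean (\<lambda>x. x ^ 4 * inv_density x - (2 * \<mu> * (x\<^sup>2 * inv_density x) - \<mu>\<^sup>2 * inv_density x))"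
      by (intro Bochner_Integration.integral_cong refl) (simp add: power2_eq_square power4_eq_xxxx algebra_simps)
    also have "\<dots> = unit_mean (\<lambda>x. x ^ 4 * inv_density x)
        - (unit_mean (\<lambda>x. 2 * \<mu> * (x\<^sup>2 * inv_density x)) - unit_mean (\<lambda>x. \<mu>\<^sup>2 * inv_density x))"
      using incr_diff_integrable[OF incr_diff_mult[OF p4 id]] incr_diff_integrable[OF incr_diff_mult[OF sq id]]
        incr_diff_integrable[OF id] by simp
    also have "unit_mean (\<lambda>x. 2 * \<mu> * (x\<^sup>2 * inv_density x)) = 2 * \<mu> * \<mu>" by (simp add: \<mu>_def)
    also have "unit_mean (\<lambda>x. \<mu>\<^sup>2 * inv_density x) = \<mu>\<^sup>2" by (simp add: inv_density_mean)
    finally show ?thesis by (simp add: power2_eq_square[of \<mu>])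
  qed
  have wc: "unit_mean (\<lambda>x. w x * (x\<^sup>2 - \<mu>)) = unit_mean (\<lambda>x. x\<^sup>2 * w x)"
  proof -
    have "unit_mean (\<lambda>x. w x * (x\<^sup>2 - \<mu>)) = unit_mean (\<lambda>x. x\<^sup>2 * w x - \<mu> * w x)"
      by (simp add: algebra_simps)
    also have "\<dots> = unit_mean (\<lambda>x. x\<^sup>2 * w x) - unit_mean (\<lambda>x. \<mu> * w x)"
      by (intro unit_mean_diff incr_diff_mult incr_diff_cmult sq w)
    finally show ?thesis using w(2) by simp
  qed
  have "unit_mean (\<lambda>x. a x * (x\<^sup>2 - \<mu>))
    = unit_mean (\<lambda>x. (d x * (x\<^sup>2 - \<mu>) + w x * (x\<^sup>2 - \<mu>)) - (x\<^sup>2 - \<mu>)\<^sup>2 * inv_density x)"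
    by (simp add: d_def u_def algebra_simps power2_eq_square)
  also have "\<dots> = unit_mean (\<lambda>x. d x * (x\<^sup>2 - \<mu>) + w x * (x\<^sup>2 - \<mu>)) - unit_mean (\<lambda>x. (x\<^sup>2 - \<mu>)\<^sup>2 * inv_density x)"
    unfolding power2_eq_square[of "_ - \<mu>"] by (intro unit_mean_diff incr_diff_add incr_diff_mult dd cd w id)
  also have "unit_mean (\<lambda>x. d x * (x\<^sup>2 - \<mu>) + w x * (x\<^sup>2 - \<mu>))
    = unit_mean (\<lambda>x. d x * (x\<^sup>2 - \<mu>)) + unit_mean (\<lambda>x. w x * (x\<^sup>2 - \<mu>))"
    by (intro unit_mean_add incr_diff_mult dd cd w)
  finally have ac: "unit_mean (\<lambda>x. a x * (x\<^sup>2 - \<mu>)) = unit_mean (\<lambda>x. d x * (x\<^sup>2 - \<mu>)) + unit_mean (\<lambda>x. x\<^sup>2 * w x)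
    - (unit_mean (\<lambda>x. x ^ 4 * inv_density x) - \<mu>\<^sup>2)"
    unfolding wc c2 .
  have "\<bar>\<mu>\<^sup>2 - \<mu>'\<^sup>2\<bar> = \<bar>\<mu> - \<mu>'\<bar> * \<bar>\<mu> + \<mu>'\<bar>"
    by (simp add: power2_eq_square square_diff_square_factored abs_mult mult.commute)
  also have "\<dots> \<le> R / 12 * (12/5)"
    using mu mu01 R(2) R0 by (intro mult_mono) (auto simp: abs_if split: if_splits)
  finally have musq: "\<bar>\<mu>\<^sup>2 - \<mu>'\<^sup>2\<bar> \<le> R / 5" by simp
  have "variance - (2 * unit_mean (\<lambda>x. x\<^sup>2 * w x) - unit_mean (\<lambda>x. x ^ 4 * q x) + \<mu>'\<^sup>2)
    = 2 * unit_mean (\<lambda>x. d x * (x\<^sup>2 - \<mu>)) - unit_mean (\<lambda>x. x ^ 4 * r x) + (\<mu>\<^sup>2 - \<mu>'\<^sup>2)"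
    unfolding variance_def c2 ac i4 by simp
  moreover have "\<bar>2 * X - Y + Z\<bar> \<le> 1000/678 * \<Delta> + 7/10 * R"
    if "\<bar>X\<bar> \<le> 1000/113 * (\<Delta> / 12)" "\<bar>Y\<bar> \<le> R / 2" "\<bar>Z\<bar> \<le> R / 5" for X Y Z :: real
    using that by argo
  ultimately show ?thesis
    unfolding dc \<mu>'_def[symmetric] \<Delta>_def[symmetric] using dc_bound r4 musq by presburger
qed

section \<open>Polynomial approximations and the enclosure for the square\<close>

text \<open>The polynomial \<open>K (lift_map x - 1)\<close>. Densities of the form \<open>(K \<circ> (lift_map - 1))'\<close> are
  polynomials whose image under the transfer operator is again a polynomial: the slope of
  \<open>lift_map\<close> cancels against the derivative of the inverse branch, and the image is the derivative of
  \<open>push_comp K\<close>. Residuals of such approximations are therefore polynomials with explicit rational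
  coefficients. The shift by \<open>1\<close> centres the range \<open>[0,2]\<close> of \<open>lift_map\<close>.\<close>
definition lift_comp :: "real poly \<Rightarrow> real poly" where
  "lift_comp K = K \<circ>\<^sub>p [:-1, 5/2, -1/2:]"

definition push_comp :: "real poly \<Rightarrow> real poly" where
  "push_comp K = K + K \<circ>\<^sub>p [:-1, 1:]"

lemma transfer_pderiv_lift_comp:
  assumes "x \<in> {0..1}"
  shows "transfer (poly (pderiv (lift_comp K))) x = poly (pderiv (push_comp K)) x"
proof -
  have branch: "inv_branch_deriv y * poly (pderiv (lift_comp K)) (inv_branch y) = poly (pderiv K) (y - 1)"
    if y: "y < 25/8" for y
  proof -
    have "poly (pderiv (lift_comp K)) z = poly (pderiv K) (lift_map z - 1) * (5/2 - z)" for z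
      by (simp add: lift_comp_def pderiv_pcompose poly_pcompose pderiv_pCons lift_map_def power2_eq_square field_simps)
    moreover have "inv_branch_deriv y * (5/2 - inv_branch y) = 1"
      using inv_branch_deriv_pos[OF y] inv_branch_deriv_eq[OF y] by simp
    ultimately show ?thesis using lift_map_inv_branch[of y] y by simp
  qed
  show ?thesis
    using branch[of x] branch[of "x + 1"] assms
    by (simp add: transfer_def push_comp_def pderiv_add pderiv_pcompose poly_pcompose pderiv_pCons)
qed

lemma incr_diff_poly: "incr_diff (poly p)"
proof (induction p)
  case (pCons a p)
  show ?case unfolding poly_pCons by (intro incr_diff_add incr_diff_const incr_diff_mult incr_diff_id pCons)
qed (simp add: incr_diff_const)

text \<open>The integral over \<open>[0,1]\<close> of \<open>x ^ n\<close> times the polynomial with the given coefficients.\<close>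
primrec weighted_sum :: "nat \<Rightarrow> real list \<Rightarrow> real" where
  "weighted_sum n [] = 0"
| "weighted_sum n (c # cs) = c / real (Suc n) + weighted_sum (Suc n) cs"

lemma incr_diff_power: "incr_diff (\<lambda>x. x ^ n)"
  by (rule incr_nonneg_imp_incr_diff[OF incr_nonnegI]) (auto intro: power_mono)

lemma unit_mean_power: "unit_mean (\<lambda>x. x ^ n) = 1 / real (Suc n)"
  by (subst unit_mean_FTC[where F = "\<lambda>x. x ^ Suc n / real (Suc n)"])
     (auto intro!: derivative_eq_intros simp del: power_Suc of_nat_Suc)

lemma unit_mean_power_poly: "unit_mean (\<lambda>x. x ^ n * poly p x) = weighted_sum n (coeffs p)"
proof (induction p arbitrary: n)
  case (pCons a p)
  have "unit_mean (\<lambda>x. x ^ n * poly (pCons a p) x) = unit_mean (\<lambda>x. a * x ^ n + x ^ Suc n * poly p x)"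
    by (simp add: algebra_simps)
  also have "\<dots> = unit_mean (\<lambda>x. a * x ^ n) + unit_mean (\<lambda>x. x ^ Suc n * poly p x)"
    by (intro unit_mean_add incr_diff_cmult incr_diff_mult incr_diff_power incr_diff_poly)
  also have "\<dots> = weighted_sum n (a # coeffs p)"
    by (simp add: unit_mean_power pCons.IH del: power_Suc of_nat_Suc)
  also have "a # coeffs p = coeffs (pCons a p)"
    using pCons.hyps by (auto simp: cCons_def)
  finally show ?case .
qed simp

text \<open>A bound for a polynomial on \<open>[-1,1]\<close>. It is nearly sharp once the polynomial has been expanded
  about the midpoint of a short interval that is scaled to \<open>[-1,1]\<close>.\<close>
definition coeff_abs_sum :: "real poly \<Rightarrow> real" where
  "coeff_abs_sum p = sum_list (map abs (coeffs p))"

lemma abs_poly_le_coeff_abs_sum: "\<bar>t\<bar> \<le> 1 \<Longrightarrow> \<bar>poly p t\<bar> \<le> coeff_abs_sum p"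
proof (induction p)
  case (pCons a p)
  have "\<bar>poly (pCons a p) t\<bar> \<le> \<bar>a\<bar> + \<bar>t\<bar> * \<bar>poly p t\<bar>"
    using abs_triangle_ineq[of a "t * poly p t"] by (simp add: abs_mult)
  also have "\<dots> \<le> \<bar>a\<bar> + 1 * coeff_abs_sum p"
    by (intro add_mono mult_mono pCons) auto
  also have "\<dots> = coeff_abs_sum (pCons a p)"
    using pCons.hyps by (auto simp: coeff_abs_sum_def cCons_def)
  finally show ?case .
qed (simp add: coeff_abs_sum_def)

lemma abs_poly_le_cell:
  assumes "\<bar>x - m\<bar> \<le> r" "0 < r" "coeff_abs_sum (p \<circ>\<^sub>p [:m, r:]) \<le> D"
  shows "\<bar>poly p x\<bar> \<le> D"
proof -
  have "\<bar>(x - m) / r\<bar> \<le> 1" using assms by simp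
  from abs_poly_le_coeff_abs_sum[OF this, of "p \<circ>\<^sub>p [:m, r:]"] assms show ?thesis
    by (simp add: poly_pcompose)
qed

lemma lip_poly:
  assumes "0 \<le> D" and D: "\<And>x. x \<in> {0..1} \<Longrightarrow> \<bar>poly (pderiv p) x\<bar> \<le> D"
  shows "lip D (poly p)"
proof (rule lipI)
  have less: "\<bar>poly p y - poly p x\<bar> \<le> D * \<bar>y - x\<bar>" if xy: "x \<in> {0..1}" "y \<in> {0..1}" "x < y" for x y
  proof -
    obtain z where "x < z" "z < y" "poly p y - poly p x = (y - x) * poly (pderiv p) z"
      using poly_MVT[OF xy(3), of p] by blast
    then show ?thesis using D[of z] xy by (simp add: abs_mult mult.commute mult_left_mono)
  qed
  show "\<bar>poly p x - poly p y\<bar> \<le> D * \<bar>x - y\<bar>" if "x \<in> {0..1}" "y \<in> {0..1}" for x y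
    using less[OF that] less[OF that(2,1)] by (cases x y rule: linorder_cases) (auto simp: abs_minus_commute)
qed (fact assms(1))

text \<open>The polynomials \<open>K\<close> for the density and for the Poisson equation, multiplied by \<open>10\<^sup>7\<close>. They
  come from a numerical minimisation of the derivative of the residual on \<open>[0,1]\<close>, followed by
  rounding to seven decimals. The linear coefficients are adjusted so that \<open>K 1 - K (-1)\<close>, which is
  the mean of the corresponding function, equals exactly \<open>1\<close> and \<open>0\<close>, respectively.\<close>
definition density_int :: "real poly" where
  "density_int =
    [:0, 4551194, 1137795, 379328, 142263, 56552, 23543, 11005, 4820, 924, 424, 997, 452:]"

definition solution_int :: "real poly" where
  "solution_int =
    [:0, -1893656, 1927362, 1453770, 728491, 340628, 159176, 83714, 38891, 5801, 3103, 9743, 4510:]"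

text \<open>The factor \<open>4096 = 2\<^sup>1\<^sup>2\<close> clears the denominators that arise from composing a polynomial of
  degree 12 with \<open>lift_map - 1\<close>. All coefficients are integers at the scale
  \<open>4096 * 10\<^sup>7 = 40960000000\<close>.\<close>
definition density_scaled :: "real poly" where
  "density_scaled = smult 4096 (pderiv (lift_comp density_int))"

definition solution_scaled :: "real poly" where
  "solution_scaled = smult 4096 (pderiv (lift_comp solution_int))"

lemma density_scaled_eq: "density_scaled =
    [:31069511680, 13463113728, 5967912960, 5489462272, -38949667200, 333791218176, -1730743428960,
    6059617424512, -14946160437000, 26780888598200, -35612161218370, 35694183450168, -27283209871450,
    16046727118660, -7309793034900, 2588579252864, -712725919020, 151903284624, -24798259450,
    3041778120, -271256370, 16602388, -623760, 10848:]"
  unfolding density_scaled_def lift_comp_def density_int_def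
  by (simp add: pcompose_pCons pderiv_pCons)

lemma solution_scaled_eq: "solution_scaled =
    [:-32807403520, 10148548608, 48820615680, 53867672576, -394355206400, 3361381408512,
    -17400609206400, 60897277934080, -150169958143200, 268995071487920, -357522008498270,
    358101923117328, -273496853121830, 160719996017364, -73152304703700, 25885723972832, -7122721209180,
    1517285610216, -247598865750, 30361847200, -2707035870, 165665588, -6223800, 108240:]"
  unfolding solution_scaled_def lift_comp_def solution_int_def
  by (simp add: pcompose_pCons pderiv_pCons)

text \<open>The residual of the invariance equation and that of the Poisson equation. In the latter the mean of
  \<open>x\<^sup>2\<close> is replaced by \<open>4799/12500 = 0.38392\<close>, so that its scale is \<open>12500\<close> times that of
  the former.\<close>
definition density_residual :: "real poly" where
  "density_residual = smult 4096 (pderiv (push_comp density_int)) - density_scaled"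

definition solution_residual :: "real poly" where
  "solution_residual = [:-4799, 0, 12500:] * density_scaled
     - smult 12500 (solution_scaled - smult 4096 (pderiv (push_comp solution_int)))"

lemma pderiv_density_residual: "pderiv density_residual =
    [:249856, 138854400, -7892247552, 159504483840, -1659928220160, 10373598473280, -42399054696320,
    119555423516736, -241020730383480, 356120066762900, -392635529184360, 327398518457400,
    -208607452542580, 102337102488600, -38828688792960, 11403614704320, -2582355838608, 446368670100,
    -57793784280, 5425127400, -348650148, 13722720, -249504:]"
  unfolding density_residual_def push_comp_def density_int_def density_scaled_eq
  by (simp add: pcompose_pCons pderiv_pCons)

lemma pderiv_solution_residual: "pderiv solution_residual =
    [:-53297180672, 20798064209920, -1058552850729984, 20952878515571200, -216751675528133120,
    1350531725051874240, -5500600547149631616, 15415980610198104000, -30736025580234256200,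
    44530813565840326300, -47440841535763018552, 37253889275596062600, -21317801706921191420,
    8518207350486541400, -2031150787674665040, 17311581822031680, 215257173393220208,
    -102511463737940100, 28588739017440280, -5496770708607400, 753306367589748, -72818101416720,
    4740870180304, -187128000000, 3390000000:]"
  unfolding solution_residual_def push_comp_def solution_int_def solution_scaled_eq density_scaled_eq
  by (simp add: pcompose_pCons pderiv_pCons)

text \<open>The cells arise from repeated bisection of \<open>[0,1]\<close> until the coefficient bound is below
  \<open>6144000 = 3/20000 * 40960000000\<close>. Near the ends of the interval the expansion loses more and
  needs shorter cells.\<close>
lemma density_residual_cells:
  shows "coeff_abs_sum (pderiv density_residual \<circ>\<^sub>p [:1/32, 1/32:]) \<le> 6144000"
    and "coeff_abs_sum (pderiv density_residual \<circ>\<^sub>p [:3/32, 1/32:]) \<le> 6144000"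
    and "coeff_abs_sum (pderiv density_residual \<circ>\<^sub>p [:3/16, 1/16:]) \<le> 6144000"
    and "coeff_abs_sum (pderiv density_residual \<circ>\<^sub>p [:3/8, 1/8:]) \<le> 6144000"
    and "coeff_abs_sum (pderiv density_residual \<circ>\<^sub>p [:5/8, 1/8:]) \<le> 6144000"
    and "coeff_abs_sum (pderiv density_residual \<circ>\<^sub>p [:13/16, 1/16:]) \<le> 6144000"
    and "coeff_abs_sum (pderiv density_residual \<circ>\<^sub>p [:15/16, 1/16:]) \<le> 6144000"
  unfolding pderiv_density_residual by (simp_all add: coeff_abs_sum_def pcompose_pCons)

text \<open>The bound is \<open>1/250\<close> at the scale \<open>12500 * 40960000000\<close>.\<close>
lemma solution_residual_cells:
  shows "coeff_abs_sum (pderiv solution_residual \<circ>\<^sub>p [:1/16, 1/16:]) \<le> 2048000000000"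
    and "coeff_abs_sum (pderiv solution_residual \<circ>\<^sub>p [:3/16, 1/16:]) \<le> 2048000000000"
    and "coeff_abs_sum (pderiv solution_residual \<circ>\<^sub>p [:3/8, 1/8:]) \<le> 2048000000000"
    and "coeff_abs_sum (pderiv solution_residual \<circ>\<^sub>p [:5/8, 1/8:]) \<le> 2048000000000"
    and "coeff_abs_sum (pderiv solution_residual \<circ>\<^sub>p [:7/8, 1/8:]) \<le> 2048000000000"
  unfolding pderiv_solution_residual by (simp_all add: coeff_abs_sum_def pcompose_pCons)

lemma density_scaled_cell: "coeff_abs_sum (pderiv density_scaled \<circ>\<^sub>p [:1/2, 1/2:]) \<le> 81920000000"
  unfolding density_scaled_eq by (simp add: coeff_abs_sum_def pcompose_pCons pderiv_pCons)

lemma lip_density_residual: "lip 6144000 (poly density_residual)"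
proof (rule lip_poly)
  fix x :: real assume "x \<in> {0..1}"
  then consider "\<bar>x - 1/32\<bar> \<le> 1/32" | "\<bar>x - 3/32\<bar> \<le> 1/32" | "\<bar>x - 3/16\<bar> \<le> 1/16" | "\<bar>x - 3/8\<bar> \<le> 1/8" | "\<bar>x - 5/8\<bar> \<le> 1/8" | "\<bar>x - 13/16\<bar> \<le> 1/16" | "\<bar>x - 15/16\<bar> \<le> 1/16"
    by (auto simp: abs_le_iff) argo
  then show "\<bar>poly (pderiv density_residual) x\<bar> \<le> 6144000"
    by cases (erule abs_poly_le_cell[OF _ _ density_residual_cells(1)], simp,
      erule abs_poly_le_cell[OF _ _ density_residual_cells(2)], simp,
      erule abs_poly_le_cell[OF _ _ density_residual_cells(3)], simp,
      erule abs_poly_le_cell[OF _ _ density_residual_cells(4)], simp,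
      erule abs_poly_le_cell[OF _ _ density_residual_cells(5)], simp,
      erule abs_poly_le_cell[OF _ _ density_residual_cells(6)], simp,
      erule abs_poly_le_cell[OF _ _ density_residual_cells(7)], simp)
qed simp

lemma lip_solution_residual: "lip 2048000000000 (poly solution_residual)"
proof (rule lip_poly)
  fix x :: real assume "x \<in> {0..1}"
  then consider "\<bar>x - 1/16\<bar> \<le> 1/16" | "\<bar>x - 3/16\<bar> \<le> 1/16" | "\<bar>x - 3/8\<bar> \<le> 1/8" | "\<bar>x - 5/8\<bar> \<le> 1/8" | "\<bar>x - 7/8\<bar> \<le> 1/8"
    by (auto simp: abs_le_iff) argo
  then show "\<bar>poly (pderiv solution_residual) x\<bar> \<le> 2048000000000"
    by cases (erule abs_poly_le_cell[OF _ _ solution_residual_cells(1)], simp,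
      erule abs_poly_le_cell[OF _ _ solution_residual_cells(2)], simp,
      erule abs_poly_le_cell[OF _ _ solution_residual_cells(3)], simp,
      erule abs_poly_le_cell[OF _ _ solution_residual_cells(4)], simp,
      erule abs_poly_le_cell[OF _ _ solution_residual_cells(5)], simp)
qed simp

lemma lip_density_scaled: "lip 81920000000 (poly density_scaled)"
proof (rule lip_poly)
  fix x :: real assume "x \<in> {0..1}"
  then have "\<bar>x - 1/2\<bar> \<le> 1/2" unfolding atLeastAtMost_iff abs_le_iff by argo
  then show "\<bar>poly (pderiv density_scaled) x\<bar> \<le> 81920000000"
    by (rule abs_poly_le_cell) (simp_all add: density_scaled_cell)
qed simp

definition density_approx :: "real \<Rightarrow> real" where
  "density_approx x = 1/40960000000 * poly density_scaled x"

definition solution_approx :: "real \<Rightarrow> real" where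
  "solution_approx x = 1/40960000000 * poly solution_scaled x"

lemma incr_diff_approx: "incr_diff density_approx" "incr_diff solution_approx"
  unfolding density_approx_def [abs_def] solution_approx_def [abs_def]
  by (intro incr_diff_cmult incr_diff_poly)+

lemma transfer_scaled:
  assumes "x \<in> {0..1}"
  shows "transfer density_approx x = 1/40960000000 * poly (smult 4096 (pderiv (push_comp density_int))) x"
    and "transfer solution_approx x = 1/40960000000 * poly (smult 4096 (pderiv (push_comp solution_int))) x"
  unfolding density_approx_def [abs_def] solution_approx_def [abs_def] density_scaled_def solution_scaled_def
    transfer_cmult poly_smult transfer_pderiv_lift_comp[OF assms] by (rule refl)+

lemma lip_scaled:
  assumes "lip D (poly p)" "0 \<le> c" and "\<And>x. x \<in> {0..1} \<Longrightarrow> f x = c * poly p x"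
  shows "lip (c * D) f"
proof (rule lipI)
  show "0 \<le> c * D" using assms(2) lipschitz_on_nonneg[OF assms(1)] by simp
  fix x y :: real assume xy: "x \<in> {0..1}" "y \<in> {0..1}"
  have "f x - f y = c * (poly p x - poly p y)" using assms(3)[OF xy(1)] assms(3)[OF xy(2)] by (simp add: right_diff_distrib)
  then show "\<bar>f x - f y\<bar> \<le> c * D * \<bar>x - y\<bar>"
    using mult_left_mono[OF lipD[OF assms(1) xy] assms(2)] assms(2) by (simp add: abs_mult mult.assoc)
qed

lemma moments:
  shows "unit_mean (\<lambda>x. x\<^sup>2 * density_approx x) \<in> {76783/200000..95979/250000}"
    and "unit_mean (\<lambda>x. x ^ 4 * density_approx x) \<in> {242453/1000000..121227/500000}"
    and "unit_mean (\<lambda>x. x\<^sup>2 * solution_approx x) \<in> {45517/200000..113793/500000}"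
    and "unit_mean density_approx = 1" "unit_mean solution_approx = 0"
proof -
  have scale: "unit_mean (\<lambda>x. x ^ n * (1/40960000000 * poly p x)) = 1/40960000000 * weighted_sum n (coeffs p)" for n p
    using unit_mean_power_poly[of n p] by simp
  show "unit_mean (\<lambda>x. x\<^sup>2 * density_approx x) \<in> {76783/200000..95979/250000}"
    "unit_mean (\<lambda>x. x ^ 4 * density_approx x) \<in> {242453/1000000..121227/500000}"
    unfolding density_approx_def scale density_scaled_eq by simp_all
  show "unit_mean (\<lambda>x. x\<^sup>2 * solution_approx x) \<in> {45517/200000..113793/500000}"
    unfolding solution_approx_def scale solution_scaled_eq by simp_all
  show "unit_mean density_approx = 1"
    using scale[of 0 density_scaled] by (simp add: density_approx_def[abs_def] density_scaled_eq)
  show "unit_mean solution_approx = 0"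
    using scale[of 0 solution_scaled] by (simp add: solution_approx_def[abs_def] solution_scaled_eq)
qed

text \<open>The approximation formula gives about \<open>0.3601\<close> and the error bound is about \<open>0.0111\<close>,
  where \<open>1/750\<close> serves as an upper bound for \<open>1000/113 * 3/20000\<close>.\<close>
theorem diffusion_coeff_square: "diffusion_coeff T inv_measure (\<lambda>x. x\<^sup>2) \<in> {0.3458..0.4152}"
proof -
  have dec: "(0.3458 :: real) = 1729/5000" "(0.4152 :: real) = 519/1250" by simp_all
  have res1: "lip (3/20000) (\<lambda>x. transfer density_approx x - density_approx x)"
    using lip_scaled[OF lip_density_residual, of "1/40960000000" "\<lambda>x. transfer density_approx x - density_approx x"]
    by (simp add: density_residual_def density_approx_def transfer_scaled right_diff_distrib diff_divide_distrib)
  have res2: "lip (1/250) (\<lambda>x. (x\<^sup>2 - 4799/12500) * density_approx x - (solution_approx x - transfer solution_approx x))"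
    using lip_scaled[OF lip_solution_residual, of "1/512000000000000"
        "\<lambda>x. (x\<^sup>2 - 4799/12500) * density_approx x - (solution_approx x - transfer solution_approx x)"]
    by (simp add: solution_residual_def density_approx_def solution_approx_def transfer_scaled power2_eq_square field_simps)
  have lip2: "lip 2 density_approx"
    using lip_scaled[OF lip_density_scaled, of "1/40960000000" density_approx] by (simp add: density_approx_def)
  have eps: "\<bar>unit_mean (\<lambda>x. x\<^sup>2 * density_approx x) - 4799/12500\<bar> \<le> 1/100000"
    using moments(1) unfolding abs_le_iff atLeastAtMost_iff by argo
  have "\<bar>diffusion_coeff T inv_measure (\<lambda>x. x\<^sup>2)
      - (2 * unit_mean (\<lambda>x. x\<^sup>2 * solution_approx x) - unit_mean (\<lambda>x. x ^ 4 * density_approx x)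
        + (unit_mean (\<lambda>x. x\<^sup>2 * density_approx x))\<^sup>2)\<bar>
    \<le> 1000/678 * (1/250 + 2 * (1/750) + 2 * (1/100000 + (1/750) / 12)) + 7/10 * (1/750)"
    by (rule diffusion_coeff_square_approx[OF incr_diff_approx(1) moments(4) incr_diff_approx(2) moments(5) res1 res2 lip2 eps])
       simp_all
  moreover have "(unit_mean (\<lambda>x. x\<^sup>2 * density_approx x))\<^sup>2 \<in> {(76783/200000)\<^sup>2..(95979/250000)\<^sup>2}"
    using moments(1) by (auto intro!: power_mono)
  moreover have "C \<in> {0.3458..0.4152}"
    if "\<bar>C - (2 * A - F + M)\<bar> \<le> 1000/678 * (1/250 + 2 * (1/750) + 2 * (1/100000 + (1/750) / 12)) + 7/10 * (1/750)"
      "A \<in> {45517/200000..113793/500000}" "F \<in> {242453/1000000..121227/500000}" "M \<in> {(76783/200000)\<^sup>2..(95979/250000)\<^sup>2}" for C A F M :: real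
    using that unfolding dec abs_le_iff atLeastAtMost_iff power2_eq_square by argo
  ultimately show ?thesis
    using moments(2,3) by blast
qed

section \<open>The invariant measure, the central limit theorem and the enclosure\<close>

theorem theorem1p1:
  shows "(\<exists>!\<nu>. acip T \<nu>) \<and>
    (\<forall>\<nu>. acip T \<nu> \<longrightarrow>
      (\<forall>\<psi>. bounded_variation_on 0 1 \<psi> \<longrightarrow>
         convergent (scaled_variance T \<nu> \<psi>) \<and>
         weak_conv_m
           (\<lambda>n. distr \<nu> borel (\<lambda>x. 1 / sqrt (real n) * centred_birkhoff_sum T \<nu> \<psi> n x))
           (centred_normal (diffusion_coeff T \<nu> \<psi>))) \<and>
      diffusion_coeff T \<nu> (\<lambda>x. x\<^sup>2) \<in> {0.3458..0.4152})"
proof (intro conjI allI impI)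
  show "\<exists>!\<nu>. acip T \<nu>"
    using acip_inv_measure acip_unique by blast
  fix \<nu> assume "acip T \<nu>"
  then have nu: "\<nu> = inv_measure" by (rule acip_unique)
  show "diffusion_coeff T \<nu> (\<lambda>x. x\<^sup>2) \<in> {0.3458..0.4152}"
    unfolding nu by (rule diffusion_coeff_square)
  fix \<psi> assume "bounded_variation_on 0 1 \<psi>"
  then have \<psi>: "incr_diff \<psi>" by (rule bounded_variation_imp_incr_diff)
  obtain a where ps: "poisson_solution (\<lambda>x. \<psi> x - unit_mean (\<lambda>x. \<psi> x * inv_density x)) a"
    by (rule poisson_solution_exists[OF \<psi> refl])
  show "convergent (scaled_variance T \<nu> \<psi>)"
    unfolding nu by (rule convergentI[OF scaled_variance_tendsto[OF \<psi> ps]])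
  show "weak_conv_m
           (\<lambda>n. distr \<nu> borel (\<lambda>x. 1 / sqrt (real n) * centred_birkhoff_sum T \<nu> \<psi> n x))
           (centred_normal (diffusion_coeff T \<nu> \<psi>))"
    unfolding nu by (rule central_limit[OF \<psi> ps])
qed

end
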